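(* Let $Y_i=\sigma(X_i)Z_i$, $i\in\mathbb Z$, be the stochastic volatility sequence described in the context, where $\{X_i\}$ is a long range dependent Gaussian sequence with $\rho_k=|k|^{2H-2}\ell_0(|k|)$, $H\in(1/2,1)$, and $\bar F_Z(x)=\mathbb P(Z_1>x)=x^{-\alpha}\ell(x)$ with $\alpha\in(0,\infty)$ and $\ell$ slowly varying at infinity. Let $k=k_n$ be a sequence of integers with $k\to\infty$ and $n/k\to\infty$, and let $u_n=U(n/k)$, where $k=n\bar F(u_n)$. Assume Assumption (H), Assumption (SO) with rate function $\eta^*$ regularly varying at infinity with index $-\alpha\beta$ ($\beta\ge0$), that there exists $\epsilon>0$ such that $0<\mathbb E[\sigma^{2\alpha(\beta+1)+\epsilon}(X_1)]<\infty$, and that $\lim_{n\to\infty}\sqrt k\,\eta^*(U(n/k))=0$. Let $\gamma=1/\alpha$ and let $$\hat\gamma_n=\frac1k\sum_{i=1}^k\log\left(\frac{Y_{n-i+1:n}}{Y_{n-k:n}}\right)$$ be the Hill estimator. Then $\sqrt k(\hat\gamma_n-\gamma)$ converges weakly to the centred Gaussian distribution with variance $\gamma^2$.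
   Context: Model. $\{X_i,i\in\mathbb Z\}$ is a stationary centred Gaussian process with unit variance, $\rho_k=\mathrm{cov}(X_0,X_k)$; $\ell_0$ is slowly varying at infinity. $\sigma:\mathbb R\to[0,\infty)$ is a deterministic (measurable) function and $\{Z_i\}$ is i.i.d. and independent of $\{X_i\}$. $F$ is the distribution function of $Y_1$, $\bar F=1-F$, and $U(t)=F^{\leftarrow}(1-1/t)$ for $t\ge1$, with $F^\leftarrow$ the left-continuous inverse of $F$. $Y_{1:n}\le\cdots\le Y_{n:n}$ are the order statistics of $Y_1,\dots,Y_n$ (with probability tending to one $Y_{n-k:n}>0$, so that $\hat\gamma_n$ is well defined). Assumption (H). $H_m$ are the Hermite polynomials with $\mathbb E[H_j(X)H_k(X)]=\delta_{j,k}k!$ for $X$ standard Gaussian; the Hermite rank of $h$ with $\mathbb E[h^2(X)]<\infty$ is the smallest $m\ge1$ with $\mathbb E[h(X)H_m(X)]\ne0$. Let $q$ be the Hermite rank of $G=\sigma^\alpha$; let $G_n(x,s)=\mathbb P(\sigma(x)Z_1>(1+s)u_n)/\mathbb P(Z_1>u_n)$, $q_n(s)$ the Hermite rank of $x\mapsto G_n(x,s)$, $q_n=\inf_{s\ge0}q_n(s)$. Assumption (H): $q_n=q$ for all $n$ large enough. Assumption (SO). There exist a bounded nonincreasing function $\eta^*$ on $[0,\infty)$, regularly varying at infinity with index $-\alpha\beta$ for some $\beta\ge0$, with $\lim_{t\to\infty}\eta^*(t)=0$, a measurable function $\eta$, and constants $c,C>0$ such that $\mathbb P(Z_1>z)=cz^{-\alpha}\exp\int_1^z\frac{\eta(s)}s\,\mathrm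 ds$ for all $z>0$ and $|\eta(s)|\le C\eta^*(s)$ for all $s\ge0$. *)

theory Defs
  imports "HOL-Probability.Probability" "HOL-Library.Extended_Nat"
begin

section \<open>Regular variation\<close>

text \<open>Only values on the positive half-line are relevant, so measurability and positivity
  are demanded only there (positivity only near infinity).\<close>

definition regularly_varying :: "real \<Rightarrow> (real \<Rightarrow> real) \<Rightarrow> bool" where
  "regularly_varying \<rho> f \<longleftrightarrow>
     f \<in> borel_measurable (restrict_space borel {0<..}) \<and>
     (\<forall>\<^sub>F x in at_top. f x > 0) \<and>
     (\<forall>t>0. ((\<lambda>x. f (t * x) / f x) \<longlongrightarrow> t powr \<rho>) at_top)"

abbreviation slowly_varying :: "(real \<Rightarrow> real) \<Rightarrow> bool" where
  "slowly_varying \<equiv> regularly_varying 0"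

section \<open>Gaussian processes\<close>

definition gaussian_measure :: "real \<Rightarrow> real \<Rightarrow> real measure" where
  "gaussian_measure m s =
     (if s = 0 then return borel m else density lborel (normal_density m s))"

text \<open>Here \<open>s\<close> is the standard deviation. A process is Gaussian if every finite linear
  combination of its coordinates has a (possibly degenerate) normal law.\<close>

definition gaussian_process :: "'a measure \<Rightarrow> ('i \<Rightarrow> 'a \<Rightarrow> real) \<Rightarrow> bool" where
  "gaussian_process M X \<longleftrightarrow>
     (\<forall>i. X i \<in> borel_measurable M) \<and>
     (\<forall>J a. finite J \<longrightarrow>
        (\<exists>m s. s \<ge> 0 \<and> distr M borel (\<lambda>\<omega>. \<Sum>j\<in>J. a j * X j \<omega>) = gaussian_measure m s))"

definition stationary_process :: "'a measure \<Rightarrow> (int \<Rightarrow> 'a \<Rightarrow> real) \<Rightarrow> bool" where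
  "stationary_process M X \<longleftrightarrow>
     (\<forall>t. distr M (Pi\<^sub>M UNIV (\<lambda>_. borel)) (\<lambda>\<omega> i. X (i + t) \<omega>) =
          distr M (Pi\<^sub>M UNIV (\<lambda>_. borel)) (\<lambda>\<omega> i. X i \<omega>))"

definition covariance :: "'a measure \<Rightarrow> ('a \<Rightarrow> real) \<Rightarrow> ('a \<Rightarrow> real) \<Rightarrow> real" where
  "covariance M V W =
     (LINT \<omega>|M. (V \<omega> - integral\<^sup>L M V) * (W \<omega> - integral\<^sup>L M W))"

section \<open>Hermite polynomials and Hermite rank\<close>

text \<open>The monic (probabilists') Hermite polynomials, for which
  \<open>E[H\<^sub>j(X) H\<^sub>k(X)]\<close> is \<open>k!\<close> if \<open>j = k\<close> and \<open>0\<close> otherwise, \<open>X\<close> being standard normal.\<close>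

fun hermite :: "nat \<Rightarrow> real \<Rightarrow> real" where
  "hermite 0 x = 1"
| "hermite (Suc 0) x = x"
| "hermite (Suc (Suc m)) x = x * hermite (Suc m) x - real (Suc m) * hermite m x"

text \<open>Meaningful for \<open>h\<close> square integrable under the standard normal law. The rank of an
  almost surely constant function is the infimum of the empty set, i.e. \<open>\<infinity>\<close>.\<close>

definition hermite_rank :: "(real \<Rightarrow> real) \<Rightarrow> enat" where
  "hermite_rank h =
     Inf {enat m |m. m \<ge> 1 \<and> (LINT x|std_normal_distribution. h x * hermite m x) \<noteq> 0}"

section \<open>Tails, quantiles and the Hill estimator\<close>

definition upper_tail :: "'a measure \<Rightarrow> ('a \<Rightarrow> real) \<Rightarrow> real \<Rightarrow> real" where
  "upper_tail M V x = measure M {\<omega> \<in> space M. V \<omega> > x}"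

definition left_inverse :: "(real \<Rightarrow> real) \<Rightarrow> real \<Rightarrow> real" where
  "left_inverse F p = Inf {x. F x \<ge> p}"

text \<open>The function \<open>U\<close> of a distribution function \<open>F\<close>. At \<open>t = 1\<close> the
  infimum may be over an unbounded set; only large \<open>t\<close> matter below.\<close>

definition tail_quantile :: "(real \<Rightarrow> real) \<Rightarrow> real \<Rightarrow> real" where
  "tail_quantile F t = left_inverse F (1 - 1 / t)"

text \<open>\<open>order_stat y n j\<close> is the \<open>j\<close>-th smallest of \<open>y\<^sub>1, \<dots>, y\<^sub>n\<close>, for \<open>1 \<le> j \<le> n\<close>.\<close>

definition order_stat :: "(int \<Rightarrow> real) \<Rightarrow> nat \<Rightarrow> nat \<Rightarrow> real" where
  "order_stat y n j = sort (map y [1..int n]) ! (j - 1)"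

definition hill :: "(int \<Rightarrow> real) \<Rightarrow> nat \<Rightarrow> nat \<Rightarrow> real" where
  "hill y n k =
     1 / real k * (\<Sum>i=1..k. ln (order_stat y n (n - i + 1) / order_stat y n (n - k)))"

section \<open>The two assumptions\<close>

definition G_tail ::
  "'a measure \<Rightarrow> (real \<Rightarrow> real) \<Rightarrow> ('a \<Rightarrow> real) \<Rightarrow> real \<Rightarrow> real \<Rightarrow> real \<Rightarrow> real" where
  "G_tail M \<sigma> V u s x = upper_tail M (\<lambda>\<omega>. \<sigma> x * V \<omega>) ((1 + s) * u) / upper_tail M V u"

text \<open>\<open>V\<close> plays the role of \<open>Z\<^sub>1\<close>.\<close>

definition assumption_H ::
  "'a measure \<Rightarrow> (real \<Rightarrow> real) \<Rightarrow> ('a \<Rightarrow> real) \<Rightarrow> real \<Rightarrow> (nat \<Rightarrow> real) \<Rightarrow> bool" where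
  "assumption_H M \<sigma> V \<alpha> u \<longleftrightarrow>
     (\<forall>\<^sub>F n in sequentially.
        (INF s\<in>{0..}. hermite_rank (\<lambda>x. G_tail M \<sigma> V (u n) s x)) =
        hermite_rank (\<lambda>x. \<sigma> x powr \<alpha>))"

text \<open>The second order condition on a tail function \<open>S\<close> with rate function \<open>\<eta>'\<close>.
  For \<open>z < 1\<close> the integral from \<open>1\<close> to \<open>z\<close> is oriented, i.e. minus the integral from
  \<open>z\<close> to \<open>1\<close>.\<close>

definition assumption_SO ::
  "(real \<Rightarrow> real) \<Rightarrow> real \<Rightarrow> real \<Rightarrow> (real \<Rightarrow> real) \<Rightarrow> bool" where
  "assumption_SO S \<alpha> \<beta> \<eta>' \<longleftrightarrow>
     \<beta> \<ge> 0 \<and>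
     bounded (\<eta>' ` {0..}) \<and>
     antimono_on {0..} \<eta>' \<and>
     regularly_varying (- \<alpha> * \<beta>) \<eta>' \<and>
     (\<eta>' \<longlongrightarrow> 0) at_top \<and>
     (\<exists>\<eta> c C. \<eta> \<in> borel_measurable (restrict_space borel {0..}) \<and> c > 0 \<and> C > 0 \<and>
        (\<forall>z>0. S z = c * z powr (- \<alpha>) * exp (LBINT s=1..z. \<eta> s / s)) \<and>
        (\<forall>s\<ge>0. \<bar>\<eta> s\<bar> \<le> C * \<eta>' s))"

end

theory Submission
  imports Defs
begin

text \<open>
  Write \<open>S\<close> for the tail function of the noise, \<open>Y\<^sub>i = \<sigma>(X\<^sub>i) Z\<^sub>i\<close>, and let \<open>y\<close> be the threshold
  \<open>Y\<^sub>n\<^sub>-\<^sub>k\<^sub>:\<^sub>n\<close> of the Hill estimator. Long memory does not show in the limit because the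
  Hill estimator only looks at the \<^emph>\<open>excesses\<close> of the largest observations over the threshold, and
  these are, on the right scale, exactly independent. Indeed \<open>S\<close> is continuous, so for every level
  \<open>w > 0\<close> the variable \<open>- ln (S(Z\<^sub>i) / S(w))\<close>, given \<open>Z\<^sub>i > w\<close>, is standard exponential
  (\<open>exponential_excess\<close>). Condition on the whole process \<open>X\<close>, on which observation is the
  threshold, on its value, and on the set \<open>A\<close> of the \<open>k\<close> indices above it. What remains random are
  independent variables \<open>Z\<^sub>i\<close>, \<open>i \<in> A\<close>, each conditioned to exceed \<open>y / \<sigma>(X\<^sub>i)\<close>; hence the \<open>k\<close>
  excesses \<open>- ln (S(Z\<^sub>i) / S(y / \<sigma>(X\<^sub>i)))\<close> are independent standard exponential variables,
  independent of \<open>X\<close> and of \<open>y\<close>. Their sum has the characteristic function \<open>(1 - i\<theta>)\<^sup>-\<^sup>k\<close>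
  (\<open>integral_excess_prod\<close>), whose normalisation tends to the Gaussian one
  (\<open>exponential_clt_limit\<close>).

  The second order condition says that \<open>ln (Y\<^sub>i / y)\<close> is \<open>1/\<alpha>\<close> times the excess, up to a factor
  \<open>1 + O(\<eta>'(y / \<sigma>(X\<^sub>i)))\<close> (\<open>hill_linearization\<close>). On the event \<open>y \<ge> v\<close>, with \<open>v\<close> a fixed
  fraction of \<open>u\<^sub>n\<close>, the sum of the errors is at most the sum over all \<open>i \<le> n\<close> with \<open>Y\<^sub>i > v\<close> of
  \<open>\<eta>'(v / \<sigma>(X\<^sub>i)) ln (Y\<^sub>i / v)\<close>, whose mean is \<open>O(n S(v) \<eta>'(v)) = O(k \<eta>'(u\<^sub>n))\<close> by Potter bounds
  and the moment condition on \<open>\<sigma>\<close> (\<open>expectation_weighted_log_excess\<close>). After multiplication by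
  \<open>1 / sqrt k\<close> this vanishes by assumption. This step involves nothing but
  expectations of single terms.

  The dependence of \<open>X\<close> therefore matters in one place only: the threshold must be at least \<open>v\<close>,
  that is, more than \<open>k\<close> observations must exceed \<open>v\<close>, with probability tending to one. This is a
  weak law of large numbers for \<open>1{\<sigma>(X\<^sub>i) > s\<^sub>0} 1{Z\<^sub>i > v / s\<^sub>0}\<close> (\<open>count_lower_bound\<close>). Chebyshev's
  inequality gives it as soon as \<open>P(X\<^sub>0 \<in> A, X\<^sub>j \<in> A) \<rightarrow> P(X\<^sub>0 \<in> A)\<^sup>2\<close>, which holds for a Gaussian
  process with covariances tending to zero (\<open>gaussian_process_asymptotic_independence\<close>). The bound
  \<open>char_approx_by_excesses\<close> puts these pieces together, and the continuity theorem of Levy ends the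
  proof.
\<close>

lemmas bochner_cong = Bochner_Integration.integral_cong and bochner_add = Bochner_Integration.integral_add

section \<open>Regular variation\<close>

lemma regularly_varying_powr_mult:
  assumes L: "slowly_varying L" and f: "\<And>x. 0 < x \<Longrightarrow> f x = x powr a * L x"
  shows "regularly_varying a f"
  unfolding regularly_varying_def
proof (intro conjI allI impI)
  note L' = L[unfolded regularly_varying_def]
  have [measurable]: "L \<in> borel_measurable (restrict_space borel {0<..})" using L' by blast
  have "(\<lambda>x. x) \<in> borel_measurable (restrict_space borel {0<..})"
    by (rule measurable_restrict_space1) simp
  then have "(\<lambda>x. x powr a * L x) \<in> borel_measurable (restrict_space borel {0<..})"
    by (intro borel_measurable_times) (auto intro!: powr_real_measurable)
  then show "f \<in> borel_measurable (restrict_space borel {0<..})"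
    by (subst measurable_cong[where g = "\<lambda>x. x powr a * L x"]) (auto simp: space_restrict_space f)
  have L_pos: "\<forall>\<^sub>F x in at_top. 0 < L x" using L' by blast
  then show "\<forall>\<^sub>F x in at_top. 0 < f x"
    using eventually_gt_at_top[of 0] by eventually_elim (simp add: f)
  fix t :: real assume t: "0 < t"
  have "((\<lambda>x. L (t * x) / L x) \<longlongrightarrow> t powr 0) at_top" using L' t by blast
  then have "((\<lambda>x. t powr a * (L (t * x) / L x)) \<longlongrightarrow> t powr a * t powr 0) at_top" by (rule tendsto_mult_left)
  then have "((\<lambda>x. t powr a * (L (t * x) / L x)) \<longlongrightarrow> t powr a) at_top" using t by simp
  moreover have "\<forall>\<^sub>F x in at_top. t powr a * (L (t * x) / L x) = f (t * x) / f x"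
    using eventually_gt_at_top[of 0] by eventually_elim (use t in \<open>simp add: f powr_mult\<close>)
  ultimately show "((\<lambda>x. f (t * x) / f x) \<longlongrightarrow> t powr a) at_top"
    by (rule Lim_transform_eventually)
qed

text \<open>Monotonicity replaces the uniform convergence theorem in this Potter bound: it is enough to control
  \<open>f (x / 2)\<close> by \<open>f x\<close> and to iterate. The bound \<open>B\<close> takes over once the argument has left the region
  where regular variation is effective, so that \<open>s\<close> may be arbitrarily large compared with \<open>x\<close>. The factor
  \<open>1 + \<bar>s\<bar>\<close> covers \<open>s \<le> 1\<close> as well.\<close>

lemma regularly_varying_potter:
  fixes f :: "real \<Rightarrow> real"
  assumes rv: "regularly_varying (- \<rho>) f"
    and anti: "\<And>x y. 0 < x \<Longrightarrow> x \<le> y \<Longrightarrow> f y \<le> f x"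
    and bdd: "\<And>x. 0 < x \<Longrightarrow> f x \<le> B"
    and "\<rho> < r"
  obtains A x1 where "1 \<le> A" "0 < x1" "\<forall>x\<ge>x1. 0 < f x"
    "\<forall>x\<ge>x1. \<forall>s>0. f (x / s) \<le> A * (1 + \<bar>s\<bar>) powr r * f x"
proof -
  have "\<forall>t>0. ((\<lambda>x. f (t * x) / f x) \<longlongrightarrow> t powr (- \<rho>)) at_top"
    using rv unfolding regularly_varying_def by auto
  from this[rule_format, of "1/2"]
  have "((\<lambda>x. f ((1/2) * x) / f x) \<longlongrightarrow> (1/2) powr (- \<rho>)) at_top"
    by simp
  moreover have "(1/2) powr (- \<rho>) < (2::real) powr r"
  proof -
    have "(1/2) powr (- \<rho>) = (2::real) powr \<rho>"
      by (simp add: powr_minus powr_divide)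
    then show ?thesis using \<open>\<rho> < r\<close> by simp
  qed
  ultimately have "\<forall>\<^sub>F x in at_top. f ((1/2) * x) / f x < 2 powr r"
    by (rule order_tendstoD(2))
  moreover have "\<forall>\<^sub>F x in at_top. f x > 0"
    using rv unfolding regularly_varying_def by auto
  ultimately have "\<forall>\<^sub>F x in at_top. 1 \<le> x \<and> f x > 0 \<and> f (x / 2) \<le> 2 powr r * f x"
    using eventually_ge_at_top[of 1]
    by eventually_elim (auto simp: divide_simps split: if_splits)
  then obtain x1 where x1: "\<And>x. x \<ge> x1 \<Longrightarrow> 1 \<le> x \<and> f x > 0 \<and> f (x / 2) \<le> 2 powr r * f x"
    unfolding eventually_at_top_linorder by blast
  have x1_ge: "1 \<le> x1" using x1[of x1] by simp
  have f2: "f (2 * x1) > 0" using x1[of "2*x1"] x1_ge by simp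
  have r0: "2 powr r * f x \<ge> f x" if "x \<ge> x1" for x
  proof -
    have "f x \<le> f (x/2)" using anti[of "x/2" x] x1[OF that] by simp
    then show ?thesis using x1[OF that] by linarith
  qed
  have rge: "1 \<le> 2 powr r" using r0[of x1] x1[of x1] by simp
  then have rpos: "r \<ge> 0" using powr_le_cancel_iff[of 2 0 r] by simp
  \<comment> \<open>\<open>A0\<close> is chosen so that \<open>B \<le> A0 * f x\<close> for all \<open>x1 \<le> x \<le> 2 * x1\<close>: this is where
     the iteration of the halving step below stops.\<close>
  define A0 where "A0 = max 1 (B / f (2 * x1))"
  have A0: "1 \<le> A0" "B \<le> A0 * f (2 * x1)"
    using f2 unfolding A0_def by (auto simp: pos_divide_le_eq[symmetric])
  have dbl: "f (x / 2 ^ m) \<le> A0 * (2 powr r) ^ m * f x" if "x \<ge> x1" for x m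
    using that
  proof (induction m arbitrary: x)
    case 0
    then show ?case using A0 x1[OF 0] by simp
  next
    case (Suc m)
    have fx: "f x > 0" using x1[OF Suc.prems] by simp
    show ?case
    proof (cases "x / 2 \<ge> x1")
      case True
      have "f (x / 2 ^ Suc m) = f ((x / 2) / 2 ^ m)" by simp
      also have "\<dots> \<le> A0 * (2 powr r) ^ m * f (x / 2)" using Suc.IH[OF True] .
      also have "\<dots> \<le> A0 * (2 powr r) ^ m * (2 powr r * f x)"
        using x1[OF Suc.prems] A0 by (intro mult_left_mono) auto
      finally show ?thesis by (simp add: mult_ac)
    next
      case False
      have "x > 0" using x1[OF Suc.prems] by simp
      then have "f (x / 2 ^ Suc m) \<le> B" by (intro bdd) auto
      also have "\<dots> \<le> A0 * f (2 * x1)" by (rule A0)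
      also have "\<dots> \<le> A0 * f x" using False A0 \<open>x > 0\<close> by (intro mult_left_mono anti) auto
      also have "\<dots> \<le> A0 * (2 powr r) ^ Suc m * f x"
        using fx A0 one_le_power[OF rge, of "Suc m"] by (simp add: mult_left_mono)
      finally show ?thesis .
    qed
  qed
  show thesis
  proof (rule that[of "A0 * 2 powr r" x1])
    show "1 \<le> A0 * 2 powr r" using mult_mono[of 1 A0 1 "2 powr r"] A0 rge by simp
    show "0 < x1" using x1_ge by simp
    show "\<forall>x\<ge>x1. 0 < f x" using x1 by blast
    show "\<forall>x\<ge>x1. \<forall>s>0. f (x / s) \<le> A0 * 2 powr r * (1 + \<bar>s\<bar>) powr r * f x"
    proof (intro allI impI)
      fix x s :: real assume x: "x1 \<le> x" and s: "0 < s"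
      have fx: "f x > 0" "x > 0" using x1[OF x] by auto
      define m where "m = nat \<lceil>log 2 (1 + s)\<rceil>"
      have "log 2 (1 + s) > 0" using s by simp
      then have m: "log 2 (1+s) \<le> real m" "real m \<le> log 2 (1+s) + 1"
        unfolding m_def by linarith+
      have "1 + s = 2 powr (log 2 (1+s))" using s by simp
      also have "\<dots> \<le> 2 powr real m" using m by simp
      also have "\<dots> = 2 ^ m" by (simp add: powr_realpow)
      finally have m1: "1 + s \<le> 2 ^ m" .
      have "x / 2 ^ m \<le> x / s" using m1 s fx by (intro divide_left_mono) auto
      then have "f (x / s) \<le> f (x / 2 ^ m)" using fx by (intro anti) auto
      also have "\<dots> \<le> A0 * (2 powr r) ^ m * f x" by (rule dbl[OF x])
      also have "(2 powr r) ^ m = 2 powr (r * real m)"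
        by (simp add: powr_powr[symmetric] powr_realpow)
      also have "A0 * 2 powr (r * real m) * f x \<le> A0 * 2 powr (r * (log 2 (1+s) + 1)) * f x"
        using m rpos A0 fx by (intro mult_right_mono mult_left_mono) (auto intro!: mult_left_mono)
      also have "2 powr (r * (log 2 (1+s) + 1)) = 2 powr r * (1+s) powr r"
      proof -
        have "2 powr (r * (log 2 (1+s) + 1)) = 2 powr (log 2 (1+s) * r) * 2 powr r"
          by (simp add: powr_add[symmetric] algebra_simps)
        also have "2 powr (log 2 (1+s) * r) = (1+s) powr r"
          using s by (simp add: powr_powr[symmetric])
        finally show ?thesis by simp
      qed
      finally show "f (x / s) \<le> A0 * 2 powr r * (1 + \<bar>s\<bar>) powr r * f x" using s by (simp add: mult_ac)
    qed
  qed
qed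

lemma regularly_varying_double_decay:
  fixes f :: "real \<Rightarrow> real"
  assumes rv: "regularly_varying (- \<rho>) f" and "d < \<rho>"
  obtains x1 where "0 < x1"
    "\<forall>x\<ge>x1. \<forall>m. f (x * 2 ^ m) \<le> (2 powr (- d)) ^ m * f x"
proof -
  have "((\<lambda>x. f (2 * x) / f x) \<longlongrightarrow> 2 powr (- \<rho>)) at_top"
    using rv unfolding regularly_varying_def by auto
  moreover have "2 powr (- \<rho>) < (2::real) powr (- d)" using \<open>d < \<rho>\<close> by simp
  ultimately have "\<forall>\<^sub>F x in at_top. f (2 * x) / f x < 2 powr (- d)"
    by (rule order_tendstoD(2))
  moreover have "\<forall>\<^sub>F x in at_top. f x > 0"
    using rv unfolding regularly_varying_def by auto
  ultimately have "\<forall>\<^sub>F x in at_top. 1 \<le> x \<and> f (2 * x) \<le> 2 powr (- d) * f x"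
    using eventually_ge_at_top[of 1]
    by eventually_elim (auto simp: divide_simps split: if_splits)
  then obtain x1 where x1: "\<And>x. x \<ge> x1 \<Longrightarrow> 1 \<le> x \<and> f (2 * x) \<le> 2 powr (- d) * f x"
    unfolding eventually_at_top_linorder by blast
  have pos: "x1 > 0" using x1[of x1] by simp
  have "f (x * 2 ^ m) \<le> (2 powr (- d)) ^ m * f x" if "x1 \<le> x" for x m
  proof (induction m)
    case (Suc m)
    have "x1 \<le> x * 2 ^ m"
      using that pos mult_left_mono[of 1 "2 ^ m" x] one_le_power[of "2::real" m] by linarith
    then have "f (2 * (x * 2 ^ m)) \<le> 2 powr (- d) * f (x * 2 ^ m)" using x1 by blast
    also have "\<dots> \<le> 2 powr (- d) * ((2 powr (- d)) ^ m * f x)"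
      using Suc by (intro mult_left_mono) auto
    finally show ?case by (simp add: mult_ac)
  qed simp
  then show thesis using that pos by simp
qed

lemma tendsto_integral_indicator_interval:
  fixes V :: "nat \<Rightarrow> real set"
  assumes ev: "\<And>y. y \<in> {0..c} \<Longrightarrow> \<forall>\<^sub>F n in sequentially. y \<in> V n"
    and [measurable]: "\<And>n. V n \<in> sets borel" and sub: "\<And>n. V n \<subseteq> {0..c}" and "0 \<le> c"
  shows "(\<lambda>n. LINT y|lborel. indicator (V n) y :: real) \<longlonglongrightarrow> c"
proof -
  have "(\<lambda>n. LINT y|lborel. indicator (V n) y :: real) \<longlonglongrightarrow> (LINT y|lborel. indicator {0..c} y :: real)"
  proof (rule integral_dominated_convergence[where w = "indicator {0..c}"])
    show "AE y in lborel. (\<lambda>n. indicator (V n) y :: real) \<longlonglongrightarrow> indicator {0..c} y"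
    proof (rule AE_I2, cases)
      fix y assume "y \<in> {0..c}"
      from ev[OF this] have "\<forall>\<^sub>F n in sequentially. indicator (V n) y = (indicator {0..c} y :: real)"
        by eventually_elim (use \<open>y \<in> {0..c}\<close> in auto)
      then show "(\<lambda>n. indicator (V n) y :: real) \<longlonglongrightarrow> indicator {0..c} y" by (rule tendsto_eventually)
    next
      fix y assume y: "y \<notin> {0..c}"
      then have "y \<notin> V n" for n using sub by blast
      then show "(\<lambda>n. indicator (V n) y :: real) \<longlonglongrightarrow> indicator {0..c} y" using y by simp
    qed
    show "AE y in lborel. norm (indicator (V n) y :: real) \<le> indicator {0..c} y" for n
      using sub[of n] by (intro AE_I2) (auto simp: indicator_def)
  qed (auto intro!: integrable_real_indicator simp: emeasure_lborel_Icc_eq)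
  then show ?thesis using \<open>0 \<le> c\<close> by simp
qed

text \<open>The definition gives only pointwise limits, so boundedness along arbitrary sequences needs
  measurability, in the manner of the uniform convergence theorem. On the logarithmic scale, \<open>G t = g (exp t)\<close>
  decays geometrically along the integers. If \<open>G\<close> did not tend to zero, it would be at least \<open>e\<close> at points
  \<open>x n\<close>, and then of the order of \<open>e\<close> at most points of \<open>[x n, x n + 2]\<close>; but
  comparison with the integer part \<open>t n\<close> of \<open>x n\<close> shows that \<open>G\<close> is small at most points of \<open>[t n, t n + 3]\<close>,
  an interval that contains the former.\<close>

lemma regularly_varying_negative_index_tendsto_0:
  fixes g :: "real \<Rightarrow> real"
  assumes rv: "regularly_varying (- a) g" and a: "a > 0"
  shows "(g \<longlongrightarrow> 0) at_top"
proof -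
  define G where "G t = g (exp t)" for t
  have [measurable]: "exp \<in> borel \<rightarrow>\<^sub>M restrict_space borel {0::real<..}"
    by (intro measurable_restrict_space2) auto
  have G_meas[measurable]: "G \<in> borel_measurable borel"
    unfolding G_def using rv unfolding regularly_varying_def
    by (auto intro!: measurable_compose[of exp borel "restrict_space borel {0::real<..}" g borel])
  have "\<forall>\<^sub>F x in at_top. g x > 0" using rv unfolding regularly_varying_def by blast
  then have Gpos: "\<forall>\<^sub>F t in at_top. G t > 0"
    unfolding G_def using exp_at_top by (rule eventually_compose_filterlim)
  have Grat: "((\<lambda>t. G (t + y) / G t) \<longlongrightarrow> exp (- a * y)) at_top" for y
  proof -
    have "((\<lambda>x. g (exp y * x) / g x) \<longlongrightarrow> exp y powr (- a)) at_top"
      using rv unfolding regularly_varying_def by auto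
    from filterlim_compose[OF this exp_at_top]
    show ?thesis by (simp add: G_def exp_add mult_ac powr_def)
  qed
  have G_nat: "(\<lambda>m. G (real m)) \<longlonglongrightarrow> 0"
  proof -
    have "((\<lambda>m. G (real m + 1) / G (real m)) \<longlongrightarrow> exp (- a * 1)) sequentially"
      by (rule filterlim_compose[OF Grat filterlim_real_sequentially])
    moreover have "exp (- a * 1) < exp (- a / 2)" using a by simp
    ultimately have "\<forall>\<^sub>F m in sequentially. G (real m + 1) / G (real m) < exp (- a / 2)"
      by (rule order_tendstoD(2))
    moreover have ev: "\<forall>\<^sub>F m in sequentially. G (real m) > 0"
      using Gpos filterlim_real_sequentially by (rule eventually_compose_filterlim)
    moreover have "\<forall>\<^sub>F m in sequentially. G (real (Suc m)) > 0"
      using ev by (simp add: eventually_sequentially_Suc[of "\<lambda>m. G (real m) > 0"] del: of_nat_Suc)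
    ultimately have "\<forall>\<^sub>F m in sequentially. norm (G (real (Suc m))) \<le> exp (- a / 2) * norm (G (real m))"
      by eventually_elim (auto simp: divide_simps add.commute split: if_splits)
    then obtain N where "\<And>m. m \<ge> N \<Longrightarrow> norm (G (real (Suc m))) \<le> exp (- a / 2) * norm (G (real m))"
      unfolding eventually_sequentially by blast
    then have "summable (\<lambda>m. G (real m))"
      by (intro summable_ratio_test[of "exp (- a / 2)" N]) (use a in auto)
    then show ?thesis by (rule summable_LIMSEQ_zero)
  qed
  have Glim: "(G \<longlongrightarrow> 0) at_top"
  proof (rule ccontr)
    assume "\<not> (G \<longlongrightarrow> 0) at_top"
    then obtain e where e: "e > 0" "\<not> (\<forall>\<^sub>F t in at_top. dist (G t) 0 < e)"
      unfolding tendsto_iff by blast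
    have "\<exists>t. t \<ge> real n \<and> G t \<ge> e" for n
    proof (rule ccontr)
      assume "\<not> ?thesis"
      then have "\<forall>\<^sub>F t in at_top. G t < e"
        unfolding eventually_at_top_linorder by (metis linorder_not_le)
      with Gpos have "\<forall>\<^sub>F t in at_top. dist (G t) 0 < e" by eventually_elim auto
      with e show False by simp
    qed
    then obtain x where x: "\<And>n. x n \<ge> real n" "\<And>n. G (x n) \<ge> e" by metis
    have x_lim: "filterlim x at_top sequentially"
      using x(1) by (intro filterlim_at_top_mono[OF filterlim_real_sequentially]) auto
    define t where "t n = real (nat \<lfloor>x n\<rfloor>)" for n
    have t: "t n \<le> x n" "x n \<le> t n + 1" for n
      using x(1)[of n] unfolding t_def by linarith+
    have t_lim: "filterlim t at_top sequentially"
    proof (rule filterlim_at_top_mono[OF filterlim_tendsto_add_at_top[OF tendsto_const x_lim]])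
      show "\<forall>\<^sub>F n in sequentially. - 1 + x n \<le> t n" using t by (auto simp: algebra_simps)
    qed
    define b where "b = e * exp (- 2 * a) / 2"
    have b: "b > 0" using e by (simp add: b_def)
    define V where "V n = {y\<in>{0..2}. G (x n + y) \<ge> b}" for n
    define W where "W n = {y\<in>{0..3}. G (t n + y) \<le> 2 * G (t n)}" for n
    have [measurable]: "V n \<in> sets borel" "W n \<in> sets borel" for n
      unfolding V_def W_def by measurable
    \<comment> \<open>The sets lie, after translation, in an interval of length 3, while their measures tend to
       2 and 3; hence they cannot stay disjoint.\<close>
    have V_lim: "(\<lambda>n. LINT y|lborel. indicator (V n) y :: real) \<longlonglongrightarrow> 2"
    proof (rule tendsto_integral_indicator_interval)
      fix y :: real assume y: "y \<in> {0..2}"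
      have "((\<lambda>n. G (x n + y) / G (x n)) \<longlongrightarrow> exp (- a * y)) sequentially"
        by (rule filterlim_compose[OF Grat x_lim])
      moreover have "exp (- 2 * a) / 2 < exp (- a * y)"
      proof -
        have "exp (- 2 * a) / 2 < exp (- 2 * a)" by simp
        also have "\<dots> \<le> exp (- a * y)" using y a by simp
        finally show ?thesis .
      qed
      ultimately have "\<forall>\<^sub>F n in sequentially. exp (- 2 * a) / 2 < G (x n + y) / G (x n)"
        by (rule order_tendstoD(1))
      then show "\<forall>\<^sub>F n in sequentially. y \<in> V n"
      proof eventually_elim
        case (elim n)
        have "0 < G (x n)" using x(2)[of n] e by linarith
        then have "G (x n) * (exp (- 2 * a) / 2) \<le> G (x n + y)"
          using elim by (simp add: field_simps)
        moreover have "b \<le> G (x n) * (exp (- 2 * a) / 2)"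
          unfolding b_def using x(2)[of n] by (simp add: field_simps)
        ultimately show ?case using y by (simp add: V_def)
      qed
    qed (auto simp: V_def)
    have W_lim: "(\<lambda>n. LINT y|lborel. indicator (W n) y :: real) \<longlonglongrightarrow> 3"
    proof (rule tendsto_integral_indicator_interval)
      fix y :: real assume y: "y \<in> {0..3}"
      have "((\<lambda>n. G (t n + y) / G (t n)) \<longlongrightarrow> exp (- a * y)) sequentially"
        by (rule filterlim_compose[OF Grat t_lim])
      moreover have "exp (- a * y) < 2"
      proof -
        have "0 \<le> a * y" using y a by simp
        then have "exp (- a * y) \<le> 1" by simp
        then show ?thesis by linarith
      qed
      ultimately have "\<forall>\<^sub>F n in sequentially. G (t n + y) / G (t n) < 2"
        by (rule order_tendstoD(2))
      moreover have "\<forall>\<^sub>F n in sequentially. G (t n) > 0"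
        using Gpos t_lim by (rule eventually_compose_filterlim)
      ultimately show "\<forall>\<^sub>F n in sequentially. y \<in> W n"
        by eventually_elim (use y in \<open>auto simp: W_def field_simps\<close>)
    qed (auto simp: W_def)
    have "(\<lambda>n. (LINT y|lborel. indicator (V n) y) + (LINT y|lborel. indicator (W n) y :: real)) \<longlonglongrightarrow> 2 + 3"
      by (rule tendsto_add[OF V_lim W_lim])
    then have "\<forall>\<^sub>F n in sequentially. 3 < (LINT y|lborel. indicator (V n) y) + (LINT y|lborel. indicator (W n) y :: real)"
      by (rule order_tendstoD(1)) simp
    moreover have "(\<lambda>n. G (t n)) \<longlonglongrightarrow> 0"
      unfolding t_def
      by (rule filterlim_compose[OF G_nat])
         (intro filterlim_compose[OF filterlim_nat_sequentially] filterlim_compose[OF filterlim_floor_sequentially] x_lim)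
    then have "\<forall>\<^sub>F n in sequentially. G (t n) < b / 2"
      by (rule order_tendstoD(2)) (use b in simp)
    ultimately have "\<forall>\<^sub>F n in sequentially. False"
    proof eventually_elim
      case (elim n)
      define c where "c = x n - t n"
      have c: "0 \<le> c" "c \<le> 1" using t[of n] by (auto simp: c_def)
      have iV: "integrable lborel (\<lambda>y. indicator (V n) (y - c) :: real)"
        by (rule Bochner_Integration.integrable_bound[of _ "indicator {0..3} :: real \<Rightarrow> real"])
           (use c in \<open>auto simp: indicator_def V_def\<close>)
      have iW: "integrable lborel (\<lambda>y. indicator (W n) y :: real)"
        by (rule Bochner_Integration.integrable_bound[of _ "indicator {0..3} :: real \<Rightarrow> real"])
           (auto simp: indicator_def W_def)
      have "(LINT y|lborel. indicator (V n) y :: real) = (LINT y|lborel. indicator (V n) (y - c))"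
        using lborel_integral_real_affine[of 1 "indicator (V n) :: real \<Rightarrow> real" "- c"] by simp
      then have "(LINT y|lborel. indicator (V n) y) + (LINT y|lborel. indicator (W n) y :: real) =
          (LINT y|lborel. indicator (V n) (y - c) + indicator (W n) y)"
        using iV iW by simp
      also have "\<dots> \<le> (LINT y|lborel. indicator {0..3::real} y)"
      proof (rule integral_mono)
        fix y :: real
        have "\<not> (y - c \<in> V n \<and> y \<in> W n)"
        proof
          assume "y - c \<in> V n \<and> y \<in> W n"
          then have "b \<le> G (t n + y)" "G (t n + y) \<le> 2 * G (t n)"
            by (auto simp: V_def W_def c_def add.commute)
          then show False using elim by linarith
        qed
        moreover have "y \<in> {0..3}" if "y - c \<in> V n \<or> y \<in> W n"
          using that c by (auto simp: V_def W_def)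
        ultimately show "indicator (V n) (y - c) + indicator (W n) y \<le> (indicator {0..3} y :: real)"
          by (auto simp: indicator_def)
      qed (use iV iW in auto)
      also have "\<dots> = 3" by simp
      finally show ?case using elim by simp
    qed
    then show False by simp
  qed
  have "\<forall>\<^sub>F x in at_top. g x = G (ln x)"
    using eventually_gt_at_top[of 0] by eventually_elim (simp add: G_def)
  moreover have "((\<lambda>x. G (ln x)) \<longlongrightarrow> 0) at_top"
    by (rule filterlim_compose[OF Glim ln_at_top])
  ultimately show ?thesis by (simp cong: filterlim_cong)
qed

section \<open>Order statistics and the block of largest observations\<close>

text \<open>The observation with index \<open>p\<close> is the threshold and \<open>A\<close> the set of indices above it; there is no tie
  with the threshold. For given data and \<open>card A\<close>, at most one pair \<open>(p, A)\<close> qualifies, so these events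
  split the probability space.\<close>

definition top_block :: "int set \<Rightarrow> (int \<Rightarrow> real) \<Rightarrow> int \<Rightarrow> int set \<Rightarrow> bool" where
  "top_block I y p A \<longleftrightarrow> (\<forall>i\<in>A. y p < y i) \<and> (\<forall>j\<in>I - insert p A. y j < y p)"

lemma sort_top_block:
  assumes "top_block {1..int n} y p A" and A: "A \<subseteq> {1..int n} - {p}" and p: "p \<in> {1..int n}"
  obtains xs zs where "sort (map y [1..int n]) = xs @ y p # zs"
    "length xs + Suc (card A) = n" "mset zs = image_mset y (mset_set A)"
proof -
  define B where "B = {1..int n} - insert p A"
  have fin: "finite A" "finite B" using A finite_subset by (auto simp: B_def)
  have I: "{1..int n} = insert p (A \<union> B)" using A p by (auto simp: B_def)
  have disj: "A \<inter> B = {}" "p \<notin> A \<union> B" using A by (auto simp: B_def)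
  define xs where "xs = sorted_list_of_multiset (image_mset y (mset_set B))"
  define zs where "zs = sorted_list_of_multiset (image_mset y (mset_set A))"
  have m: "mset xs = image_mset y (mset_set B)" "mset zs = image_mset y (mset_set A)"
    by (simp_all add: xs_def zs_def)
  have set: "set xs = y ` B" "set zs = y ` A"
    using m fin by (metis set_image_mset finite_set_mset_mset_set set_mset_mset)+
  have "mset (map y [1..int n]) = image_mset y (mset_set {1..int n})"
    using mset_set_set[of "[1..int n]"] by simp
  also have "\<dots> = mset (xs @ y p # zs)"
    unfolding I m mset_append mset.simps using disj fin by (simp add: mset_set_Union)
  finally have "mset (xs @ y p # zs) = mset (map y [1..int n])" by simp
  moreover have "sorted (xs @ y p # zs)"
    using assms(1) fin unfolding top_block_def sorted_append sorted_wrt.simps set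
    by (auto simp: xs_def zs_def B_def intro: less_imp_le order.strict_trans)
  ultimately have "sort (map y [1..int n]) = xs @ y p # zs"
    by (rule properties_for_sort)
  moreover have "length xs + Suc (card A) = n"
  proof -
    have "length xs = card B" using arg_cong[OF m(1), of size] fin by simp
    moreover have "n = card (insert p (A \<union> B))" by (simp flip: I)
    ultimately show ?thesis using fin disj by (simp add: card_Un_disjoint)
  qed
  ultimately show thesis using that m by blast
qed

lemma order_stat_top_block:
  assumes "top_block {1..int n} y p A" "A \<subseteq> {1..int n} - {p}" "p \<in> {1..int n}"
  shows "order_stat y n (n - card A) = y p"
  using assms
proof (rule sort_top_block)
  fix xs zs assume *: "sort (map y [1..int n]) = xs @ y p # zs" "length xs + Suc (card A) = n"
  then have "n - card A - 1 = length xs" by simp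
  with * show ?thesis by (simp add: order_stat_def)
qed

lemma hill_top_block:
  assumes "top_block {1..int n} y p A" "A \<subseteq> {1..int n} - {p}" "p \<in> {1..int n}"
  shows "hill y n (card A) = 1 / real (card A) * (\<Sum>i\<in>A. ln (y i / y p))"
proof -
  obtain xs zs where *: "sort (map y [1..int n]) = xs @ y p # zs"
    "length xs + Suc (card A) = n" "mset zs = image_mset y (mset_set A)"
    using sort_top_block[OF assms] .
  have len: "length zs = card A" using arg_cong[OF *(3), of size] by simp
  let ?f = "\<lambda>x. ln (x / y p)"
  have "(\<Sum>i=1..card A. ?f (order_stat y n (n - i + 1))) = (\<Sum>i=1..card A. ?f (zs ! (card A - i)))"
  proof (rule sum.cong)
    fix i assume i: "i \<in> {1..card A}"
    then have "n - i + 1 - 1 = length (xs @ [y p]) + (card A - i)" using *(2) by auto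
    then have "sort (map y [1..int n]) ! (n - i + 1 - 1) = ((xs @ [y p]) @ zs) ! (length (xs @ [y p]) + (card A - i))"
      using *(1) by simp
    then show "?f (order_stat y n (n - i + 1)) = ?f (zs ! (card A - i))"
      by (simp only: order_stat_def nth_append_length_plus)
  qed simp
  also have "\<dots> = (\<Sum>j<length zs. ?f (zs ! j))"
    by (rule sum.reindex_bij_witness[of _ "\<lambda>j. card A - j" "\<lambda>i. card A - i"]) (auto simp: len)
  also have "\<dots> = sum_list (map ?f zs)"
    by (simp add: sum_list_sum_nth atLeast0LessThan)
  also have "\<dots> = sum_mset (image_mset ?f (mset zs))" by (simp flip: sum_mset_sum_list)
  also have "\<dots> = (\<Sum>i\<in>A. ?f (y i))" unfolding *(3) by (simp add: sum_unfold_sum_mset multiset.map_comp comp_def)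
  finally show ?thesis
    unfolding hill_def order_stat_top_block[OF assms] by simp
qed

lemma top_block_unique:
  assumes "top_block {1..int n} y p A" "A \<subseteq> {1..int n} - {p}" "p \<in> {1..int n}"
    and "top_block {1..int n} y q B" "B \<subseteq> {1..int n} - {q}" "q \<in> {1..int n}"
    and "card A = card B"
  shows "p = q" "A = B"
proof -
  have eq: "y p = y q"
    using order_stat_top_block[OF assms(1-3)] order_stat_top_block[OF assms(4-6)] assms(7) by simp
  have above: "C = {i\<in>{1..int n}. y r < y i}" if C: "top_block {1..int n} y r C" "C \<subseteq> {1..int n} - {r}" for r C
  proof
    show "C \<subseteq> {i\<in>{1..int n}. y r < y i}" using C unfolding top_block_def by blast
    show "{i\<in>{1..int n}. y r < y i} \<subseteq> C"
    proof
      fix i assume i: "i \<in> {i\<in>{1..int n}. y r < y i}"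
      show "i \<in> C"
      proof (rule ccontr)
        assume "i \<notin> C"
        then have "i \<in> {1..int n} - insert r C" using i by auto
        then have "y i < y r" using C unfolding top_block_def by blast
        then show False using i by simp
      qed
    qed
  qed
  show "A = B" using above[OF assms(1,2)] above[OF assms(4,5)] eq by simp
  have "q \<notin> A" using above[OF assms(1,2)] eq by simp
  then show "p = q" using assms(1,6) eq unfolding top_block_def by (cases "p = q") auto
qed

lemma ex_with_card_above:
  fixes Q :: "real set"
  assumes "finite Q" "k < card Q"
  shows "\<exists>q\<in>Q. card {r\<in>Q. q < r} = k"
  using assms
proof (induction Q rule: finite_linorder_min_induct)
  case (insert b Q)
  show ?case
  proof (cases "k < card Q")
    case True
    then obtain q where q: "q \<in> Q" "card {r\<in>Q. q < r} = k" using insert by auto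
    moreover have "{r\<in>insert b Q. q < r} = {r\<in>Q. q < r}" using insert.hyps q by auto
    ultimately show ?thesis by (intro bexI[of _ q]) (simp_all only: insert_iff simp_thms)
  next
    case False
    have "b \<notin> Q" using insert.hyps by auto
    then have "k = card Q" using False insert.prems insert.hyps by simp
    moreover have "{r\<in>insert b Q. b < r} = Q" using insert.hyps by auto
    ultimately show ?thesis by (intro bexI[of _ b]) (simp_all only: insert_iff simp_thms)
  qed
qed simp

text \<open>Without ties above \<open>v\<close>, more than \<open>k\<close> values at or above \<open>v\<close> force the threshold to be at least \<open>v\<close>.\<close>

lemma top_block_exists:
  assumes fin: "finite I" and inj: "inj_on y {i\<in>I. v \<le> y i}" and k: "k < card {i\<in>I. v \<le> y i}"
  shows "\<exists>p\<in>I. \<exists>A. A \<subseteq> I - {p} \<and> card A = k \<and> v \<le> y p \<and> top_block I y p A"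
proof -
  let ?P = "{i\<in>I. v \<le> y i}"
  have "k < card (y ` ?P)" using k inj by (simp add: card_image)
  then obtain q where q: "q \<in> y ` ?P" "card {r\<in>y ` ?P. q < r} = k"
    using ex_with_card_above[of "y ` ?P" k] fin by auto
  then obtain p where p: "p \<in> I" "v \<le> y p" "q = y p" by auto
  define A where "A = {i\<in>I. y p < y i}"
  have "{r\<in>y ` ?P. q < r} = y ` A" using p by (auto simp: A_def)
  moreover have "inj_on y A" using inj by (rule inj_on_subset) (use p in \<open>auto simp: A_def\<close>)
  ultimately have "card A = k" using q by (simp add: card_image)
  moreover have "top_block I y p A"
    unfolding top_block_def
  proof (intro conjI ballI)
    fix j assume j: "j \<in> I - insert p A"
    then have "y j \<le> y p" by (auto simp: A_def)
    moreover have "y j \<noteq> y p"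
    proof
      assume "y j = y p"
      moreover have "j \<in> {i\<in>I. v \<le> y i}" "p \<in> {i\<in>I. v \<le> y i}"
        using \<open>y j = y p\<close> j p by auto
      ultimately have "j = p" by (rule inj_onD[OF inj])
      with j show False by simp
    qed
    ultimately show "y j < y p" by simp
  qed (simp add: A_def)
  ultimately show ?thesis using p by (intro bexI[of _ p] exI[of _ A]) (auto simp: A_def)
qed

lemma sorted_nth_le_iff:
  assumes "sorted xs" "m < length xs"
  shows "xs ! m \<le> x \<longleftrightarrow> m < length (filter (\<lambda>y. y \<le> x) xs)"
proof -
  let ?S = "{i. i < length xs \<and> xs ! i \<le> x}"
  have "finite ?S" by simp
  show ?thesis
  proof
    assume "xs ! m \<le> x"
    moreover have "xs ! i \<le> xs ! m" if "i \<le> m" for i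
      using sorted_nth_mono[OF assms(1) that assms(2)] .
    ultimately have "{..m} \<subseteq> ?S" using assms(2) by (auto intro: order_trans)
    then have "card {..m} \<le> card ?S" by (intro card_mono) auto
    then show "m < length (filter (\<lambda>y. y \<le> x) xs)" by (simp add: length_filter_conv_card)
  next
    assume m: "m < length (filter (\<lambda>y. y \<le> x) xs)"
    show "xs ! m \<le> x"
    proof (rule ccontr)
      assume "\<not> xs ! m \<le> x"
      moreover have "xs ! m \<le> xs ! i" if "m \<le> i" "i < length xs" for i
        using sorted_nth_mono[OF assms(1) that] .
      ultimately have "i < m" if "i \<in> ?S" for i
        using that by (metis (mono_tags, lifting) mem_Collect_eq not_le order_trans)
      then have "?S \<subseteq> {..<m}" by auto
      then have "card ?S \<le> card {..<m}" by (intro card_mono) auto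
      then show False using m by (simp add: length_filter_conv_card)
    qed
  qed
qed

text \<open>An order statistic is at most \<open>x\<close> if and only if enough of the data are, and counting is measurable.
  For an index beyond the sample the value is a constant.\<close>

lemma borel_measurable_order_stat[measurable]:
  assumes [measurable]: "\<And>i. Y i \<in> borel_measurable M"
  shows "(\<lambda>\<omega>. order_stat (\<lambda>i. Y i \<omega>) n j) \<in> borel_measurable M"
proof (cases "j - 1 < n")
  case True
  have cnt: "(\<lambda>\<omega>. length (filter (\<lambda>i. Y i \<omega> \<le> x) is)) \<in> measurable M (count_space UNIV)" for x "is"
  proof (induction "is")
    case (Cons a "is")
    note [measurable] = Cons
    have "(\<lambda>\<omega>. length (filter (\<lambda>i. Y i \<omega> \<le> x) (a # is))) =
        (\<lambda>\<omega>. if Y a \<omega> \<le> x then Suc (length (filter (\<lambda>i. Y i \<omega> \<le> x) is))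
             else length (filter (\<lambda>i. Y i \<omega> \<le> x) is))"
      by auto
    also have "\<dots> \<in> measurable M (count_space UNIV)" by measurable
    finally show ?case .
  qed simp
  have "{\<omega> \<in> space M. order_stat (\<lambda>i. Y i \<omega>) n j \<le> x} \<in> sets M" for x
  proof -
    have "order_stat (\<lambda>i. Y i \<omega>) n j \<le> x \<longleftrightarrow> j - 1 < length (filter (\<lambda>i. Y i \<omega> \<le> x) [1..int n])" for \<omega>
    proof -
      let ?l = "map (\<lambda>i. Y i \<omega>) [1..int n]"
      have "order_stat (\<lambda>i. Y i \<omega>) n j \<le> x \<longleftrightarrow> j - 1 < length (filter (\<lambda>y. y \<le> x) (sort ?l))"
        unfolding order_stat_def using True by (intro sorted_nth_le_iff) auto
      also have "length (filter (\<lambda>y. y \<le> x) (sort ?l)) = length (filter (\<lambda>y. y \<le> x) ?l)"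
        by (metis mset_filter mset_sort size_mset)
      also have "\<dots> = length (filter (\<lambda>i. Y i \<omega> \<le> x) [1..int n])"
        by (simp add: filter_map comp_def)
      finally show ?thesis .
    qed
    then show ?thesis using cnt[of x "[1..int n]"] by simp
  qed
  then show ?thesis unfolding borel_measurable_iff_le by blast
next
  case False
  have "order_stat (\<lambda>i. Y i \<omega>) n j = [] ! (j - 1 - n)" for \<omega>
  proof -
    have "(sort (map (\<lambda>i. Y i \<omega>) [1..int n]) @ []) ! (j - 1) = [] ! (j - 1 - n)"
      using False by (subst nth_append) simp
    then show ?thesis by (simp add: order_stat_def)
  qed
  then show ?thesis by simp
qed

lemma borel_measurable_hill[measurable]:
  assumes [measurable]: "\<And>i. Y i \<in> borel_measurable M"
  shows "(\<lambda>\<omega>. hill (\<lambda>i. Y i \<omega>) n k) \<in> borel_measurable M"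
  unfolding hill_def by measurable

section \<open>Independence through characteristic functions\<close>

text \<open>Uniqueness of characteristic functions applied to the law of \<open>W\<close> under \<open>M\<close> and under \<open>M\<close> reweighted
  by \<open>g\<close>. It reduces independence in the plane to the one-dimensional uniqueness theorem.\<close>

lemma (in prob_space) weighted_law_eqI:
  fixes g W :: "'a \<Rightarrow> real"
  assumes [measurable]: "W \<in> borel_measurable M" "g \<in> borel_measurable M" and B: "B \<in> sets borel"
    and g: "\<And>\<omega>. 0 \<le> g \<omega>" "\<And>\<omega>. g \<omega> \<le> K" and c: "expectation g > 0"
    and cf: "\<And>b. (CLINT \<omega>|M. g \<omega> * iexp (b * W \<omega>)) = expectation g * char (distr M borel W) b"
  shows "expectation (\<lambda>\<omega>. g \<omega> * indicator B (W \<omega>)) = expectation g * prob (W -` B \<inter> space M)"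
proof -
  let ?c = "expectation g"
  define Q where "Q = density M (\<lambda>\<omega>. ennreal (g \<omega> / ?c))"
  have int_g: "integrable M g"
    by (rule integrable_const_bound[of _ K]) (use g in auto)
  interpret Q: prob_space Q
  proof
    have "emeasure Q (space Q) = (\<integral>\<^sup>+\<omega>. ennreal (g \<omega> / ?c) \<partial>M)"
      unfolding Q_def by (subst emeasure_density) (auto intro!: nn_integral_cong)
    also have "\<dots> = ennreal (\<integral>\<omega>. g \<omega> / ?c \<partial>M)"
      by (rule nn_integral_eq_integral) (use int_g g c in auto)
    finally show "emeasure Q (space Q) = 1" using c by simp
  qed
  have [measurable]: "W \<in> borel_measurable Q" unfolding Q_def by simp
  have "distr Q borel W = distr M borel W"
  proof (rule Levy_uniqueness)
    show "char (distr Q borel W) = char (distr M borel W)"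
    proof
      fix b
      have "char (distr Q borel W) b = (CLINT \<omega>|Q. iexp (b * W \<omega>))"
        unfolding char_def by (subst integral_distr) auto
      also have "\<dots> = (CLINT \<omega>|M. (g \<omega> / ?c) *\<^sub>R iexp (b * W \<omega>))"
        unfolding Q_def by (subst integral_density) (use g c in auto)
      also have "\<dots> = (CLINT \<omega>|M. (g \<omega> * iexp (b * W \<omega>)) / ?c)"
        by (simp add: scaleR_conv_of_real)
      also have "\<dots> = (CLINT \<omega>|M. g \<omega> * iexp (b * W \<omega>)) / ?c" by simp
      also have "\<dots> = ?c * char (distr M borel W) b / ?c" by (simp only: cf)
      also have "\<dots> = char (distr M borel W) b" using c by simp
      finally show "char (distr Q borel W) b = char (distr M borel W) b" .
    qed
  qed (auto intro!: Q.real_distribution_distr real_distribution_distr)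
  then have "prob (W -` B \<inter> space M) = measure (distr Q borel W) B"
    using B by (simp add: measure_distr)
  also have "\<dots> = (LINT \<omega>|Q. indicator B (W \<omega>))"
  proof -
    have "(LINT \<omega>|Q. indicator B (W \<omega>)) = (LINT x|distr Q borel W. indicator B x :: real)"
      using B by (subst integral_distr) auto
    then show ?thesis using B by simp
  qed
  also have "\<dots> = (LINT \<omega>|M. (g \<omega> / ?c) *\<^sub>R indicator B (W \<omega>))"
    unfolding Q_def using B by (subst integral_density) (use g c in auto)
  also have "\<dots> = expectation (\<lambda>\<omega>. g \<omega> * indicator B (W \<omega>)) / ?c" by simp
  finally show ?thesis using c by (simp add: field_simps)
qed

text \<open>Kac's theorem. The weights \<open>2 + cos (a V + p)\<close> are positive, so \<open>weighted_law_eqI\<close> shows that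
  trigonometric functions of \<open>V\<close> are uncorrelated with every event \<open>{W \<in> B}\<close>. Hence \<open>V\<close> has the same
  characteristic function given \<open>{W \<in> B}\<close>, and a second application, with the indicator of this event as weight,
  gives the same law.\<close>

lemma (in prob_space) indep_var_if_char_factorizes:
  fixes V W :: "'a \<Rightarrow> real"
  assumes [measurable]: "V \<in> borel_measurable M" "W \<in> borel_measurable M"
    and cf: "\<And>a b. (CLINT \<omega>|M. iexp (a * V \<omega> + b * W \<omega>)) = char (distr M borel V) a * char (distr M borel W) b"
  shows "indep_var borel V borel W"
proof -
  let ?V = "char (distr M borel V)" and ?W = "char (distr M borel W)"
  let ?PW = "\<lambda>B. prob (W -` B \<inter> space M)"
  have charV: "?V a = (CLINT \<omega>|M. iexp (a * V \<omega>))" for a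
    unfolding char_def by (subst integral_distr) auto
  have iexp_cs: "iexp x = complex_of_real (cos x) + \<i> * complex_of_real (sin x)" for x
    by (simp add: cis_conv_exp[symmetric] complex_eq_iff)
  have cos_iexp: "complex_of_real (cos (x + p)) = (iexp p * iexp x + iexp (- p) * iexp (- x)) / 2" for x p
    unfolding iexp_cs by (simp add: complex_eq_iff cos_add)
  have step1: "expectation (\<lambda>\<omega>. cos (a * V \<omega> + p) * indicator B (W \<omega>)) =
      expectation (\<lambda>\<omega>. cos (a * V \<omega> + p)) * ?PW B"
    if [measurable]: "B \<in> sets borel" for a p B
  proof -
    let ?g = "\<lambda>\<omega>. 2 + cos (a * V \<omega> + p)"
    have int1: "integrable M (\<lambda>\<omega>. cos (a * V \<omega> + p))"
      by (rule integrable_const_bound[of _ 1]) simp_all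
    have int2: "integrable M (\<lambda>\<omega>. cos (a * V \<omega> + p) * indicator B (W \<omega>))"
      by (rule integrable_const_bound[of _ 1]) (simp_all add: indicator_def)
    have int3: "integrable M (\<lambda>\<omega>. indicator B (W \<omega>) :: real)"
      by (rule integrable_const_bound[of _ 1]) (simp_all add: indicator_def)
    have int4: "integrable M ?g" using int1 by simp
    note int = int1 int2 int3 int4
    have inte: "complex_integrable M (\<lambda>\<omega>. iexp (a * V \<omega> + b * W \<omega>))" for a b
      by (rule integrable_const_bound[of _ 1]) (simp_all del: of_real_add of_real_mult)
    have inteV: "complex_integrable M (\<lambda>\<omega>. iexp (a * V \<omega>))" for a
      by (rule integrable_const_bound[of _ 1]) (simp_all del: of_real_mult)
    have inteW: "complex_integrable M (\<lambda>\<omega>. iexp (b * W \<omega>))" for b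
      by (rule integrable_const_bound[of _ 1]) (simp_all del: of_real_mult)
    have intcos: "complex_integrable M (\<lambda>\<omega>. cos (a * V \<omega> + p) * iexp (b * W \<omega>))" for b
      by (rule integrable_const_bound[of _ 1]) (simp_all add: norm_mult del: of_real_mult)
    have "expectation ?g \<ge> expectation (\<lambda>_. 1)"
      by (rule integral_mono[OF _ int4]) (auto intro: order_trans[OF _ add_left_mono[OF cos_ge_minus_one]])
    then have pos: "expectation ?g > 0" by (simp add: prob_space)
    have "expectation (\<lambda>\<omega>. ?g \<omega> * indicator B (W \<omega>)) = expectation ?g * ?PW B"
    proof (rule weighted_law_eqI[where K = 3])
      fix b
      have *: "(CLINT \<omega>|M. cos (a * V \<omega> + p) * iexp (b * W \<omega>)) =
         (CLINT \<omega>|M. cos (a * V \<omega> + p)) * ?W b" for b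
      proof -
        have "(CLINT \<omega>|M. cos (a * V \<omega> + p) * iexp (b * W \<omega>)) =
          (CLINT \<omega>|M. iexp p / 2 * iexp (a * V \<omega> + b * W \<omega>) + iexp (- p) / 2 * iexp ((- a) * V \<omega> + b * W \<omega>))"
          unfolding cos_iexp by (intro bochner_cong) (simp_all add: field_simps exp_add exp_diff exp_minus)
        also have "\<dots> = iexp p / 2 * (?V a * ?W b) +
           iexp (- p) / 2 * (?V (- a) * ?W b)"
          unfolding cf[symmetric]
          by (subst bochner_add[OF integrable_mult_right[OF inte] integrable_mult_right[OF inte]])
             (simp only: integral_mult_right_zero)
        also have "\<dots> = (CLINT \<omega>|M. iexp p / 2 * iexp (a * V \<omega>) + iexp (- p) / 2 * iexp ((- a) * V \<omega>)) * ?W b"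
          unfolding charV
          by (subst bochner_add[OF integrable_mult_right[OF inteV] integrable_mult_right[OF inteV]])
             (simp only: integral_mult_right_zero distrib_right mult.assoc)
        also have "(CLINT \<omega>|M. iexp p / 2 * iexp (a * V \<omega>) + iexp (- p) / 2 * iexp ((- a) * V \<omega>)) =
           (CLINT \<omega>|M. cos (a * V \<omega> + p))"
          unfolding cos_iexp by (intro bochner_cong) (simp_all add: field_simps)
        finally show ?thesis .
      qed
      have "(CLINT \<omega>|M. ?g \<omega> * iexp (b * W \<omega>)) =
          (CLINT \<omega>|M. 2 * iexp (b * W \<omega>) + cos (a * V \<omega> + p) * iexp (b * W \<omega>))"
        by (intro bochner_cong) (simp_all add: algebra_simps)
      also have "\<dots> = 2 * (CLINT \<omega>|M. iexp (b * W \<omega>)) + (CLINT \<omega>|M. cos (a * V \<omega> + p) * iexp (b * W \<omega>))"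
        by (subst bochner_add[OF integrable_mult_right[OF inteW] intcos])
           (simp only: integral_mult_right_zero)
      also have "(CLINT \<omega>|M. iexp (b * W \<omega>)) = ?W b"
        unfolding char_def by (subst integral_distr) auto
      also have "2 * ?W b + (CLINT \<omega>|M. cos (a * V \<omega> + p) * iexp (b * W \<omega>))
          = expectation ?g * ?W b"
        unfolding * using int by (simp add: prob_space algebra_simps)
      finally show "(CLINT \<omega>|M. ?g \<omega> * iexp (b * W \<omega>)) = expectation ?g * ?W b" .
    qed (use pos in \<open>auto intro: order_trans[OF _ add_left_mono[OF cos_ge_minus_one]] order_trans[OF add_left_mono[OF cos_le_one]]\<close>)
    moreover have "expectation (\<lambda>\<omega>. ?g \<omega> * indicator B (W \<omega>)) =
        2 * expectation (\<lambda>\<omega>. indicator B (W \<omega>)) + expectation (\<lambda>\<omega>. cos (a * V \<omega> + p) * indicator B (W \<omega>))"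
      using int by (simp add: distrib_right)
    moreover have "expectation (\<lambda>\<omega>. indicator B (W \<omega>)) = ?PW B"
    proof -
      have "expectation (\<lambda>\<omega>. indicat_real B (W \<omega>)) = expectation (indicat_real (W -` B \<inter> space M))"
        by (intro bochner_cong) (auto simp: indicator_def)
      then show ?thesis by simp
    qed
    moreover have "expectation ?g = 2 + expectation (\<lambda>\<omega>. cos (a * V \<omega> + p))"
      using int by (simp add: prob_space)
    ultimately show ?thesis by (simp add: algebra_simps)
  qed
  have prod: "prob ((V -` A \<inter> space M) \<inter> (W -` B \<inter> space M)) = prob (V -` A \<inter> space M) * ?PW B"
    if [measurable]: "A \<in> sets borel" "B \<in> sets borel" for A B
  proof (cases "?PW B = 0")
    case True
    have "prob ((V -` A \<inter> space M) \<inter> (W -` B \<inter> space M)) \<le> ?PW B"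
      by (rule finite_measure_mono) auto
    then show ?thesis using True by (simp add: measure_le_0_iff)
  next
    case False
    let ?g = "\<lambda>\<omega>. indicator B (W \<omega>) :: real"
    have Eg: "expectation ?g = ?PW B"
    proof -
      have "expectation ?g = expectation (indicat_real (W -` B \<inter> space M))"
        by (intro bochner_cong) (auto simp: indicator_def)
      then show ?thesis by simp
    qed
    have "expectation (\<lambda>\<omega>. ?g \<omega> * indicator A (V \<omega>)) = expectation ?g * prob (V -` A \<inter> space M)"
    proof (rule weighted_law_eqI[where K = 1])
      fix a
      \<comment> \<open>The phases \<open>p = 0\<close> and \<open>p = - pi / 2\<close> give the cosine and the sine.\<close>
      have iexp_cos: "iexp x = complex_of_real (cos (x + 0)) + \<i> * complex_of_real (cos (x + (- pi/2)))" for x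
        by (subst iexp_cs) (simp add: complex_eq_iff cos_diff)
      have int: "complex_integrable M (\<lambda>\<omega>. complex_of_real (cos (a * V \<omega> + p)))"
           "complex_integrable M (\<lambda>\<omega>. complex_of_real (cos (a * V \<omega> + p) * ?g \<omega>))" for p
        by (rule integrable_const_bound[of _ 1], auto simp: indicator_def)+
      have "(CLINT \<omega>|M. ?g \<omega> * iexp (a * V \<omega>)) = (CLINT \<omega>|M. complex_of_real (cos (a * V \<omega> + 0) * ?g \<omega>) + \<i> * complex_of_real (cos (a * V \<omega> + (- pi/2)) * ?g \<omega>))"
        unfolding iexp_cos by (intro bochner_cong) (simp_all add: algebra_simps)
      also have "\<dots> = complex_of_real (expectation (\<lambda>\<omega>. cos (a * V \<omega> + 0) * ?g \<omega>)) + \<i> * complex_of_real (expectation (\<lambda>\<omega>. cos (a * V \<omega> + (- pi/2)) * ?g \<omega>))"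
        by (subst bochner_add[OF int(2) integrable_mult_right[OF int(2)]])
           (simp only: integral_mult_right_zero integral_complex_of_real)
      also have "\<dots> = complex_of_real (expectation ?g) * (complex_of_real (expectation (\<lambda>\<omega>. cos (a * V \<omega> + 0))) + \<i> * complex_of_real (expectation (\<lambda>\<omega>. cos (a * V \<omega> + (- pi/2)))))"
        unfolding step1[OF that(2)] Eg by (simp add: algebra_simps)
      also have "complex_of_real (expectation (\<lambda>\<omega>. cos (a * V \<omega> + 0))) + \<i> * complex_of_real (expectation (\<lambda>\<omega>. cos (a * V \<omega> + (- pi/2)))) = ?V a"
        unfolding charV iexp_cos
        by (subst bochner_add[OF int(1) integrable_mult_right[OF int(1)]])
           (simp only: integral_mult_right_zero integral_complex_of_real)
      finally show "(CLINT \<omega>|M. ?g \<omega> * iexp (a * V \<omega>)) = expectation ?g * ?V a" .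
    qed (use False in \<open>auto simp: Eg zero_less_measure_iff indicator_le_1\<close>)
    moreover have "expectation (\<lambda>\<omega>. ?g \<omega> * indicator A (V \<omega>)) = expectation (indicat_real ((V -` A \<inter> space M) \<inter> (W -` B \<inter> space M)))"
      by (intro bochner_cong) (auto simp: indicator_def)
    ultimately show ?thesis by (simp add: Eg)
  qed
  show ?thesis
    unfolding indep_var_eq
  proof (intro conjI)
    have stable: "Int_stable {f -` A \<inter> space M |A. A \<in> sets borel}" for f :: "'a \<Rightarrow> real"
    proof (rule Int_stableI)
      fix S T assume "S \<in> {f -` A \<inter> space M |A. A \<in> sets borel}" "T \<in> {f -` A \<inter> space M |A. A \<in> sets borel}"
      then obtain A B where *: "A \<in> sets borel" "B \<in> sets borel" "S = f -` A \<inter> space M" "T = f -` B \<inter> space M"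
        by blast
      show "S \<inter> T \<in> {f -` A \<inter> space M |A. A \<in> sets borel}"
        by (rule CollectI, rule exI[of _ "A \<inter> B"]) (use * in auto)
    qed
    show "indep_set (sigma_sets (space M) {V -` A \<inter> space M |A. A \<in> sets borel})
        (sigma_sets (space M) {W -` A \<inter> space M |A. A \<in> sets borel})"
    proof (rule indep_set_sigma_sets[OF _ stable stable])
      show "indep_set {V -` A \<inter> space M |A. A \<in> sets borel} {W -` A \<inter> space M |A. A \<in> sets borel}"
      proof (rule indep_setI)
        fix a b
        assume "a \<in> {V -` A \<inter> space M |A. A \<in> sets borel}" "b \<in> {W -` A \<inter> space M |A. A \<in> sets borel}"
        then obtain A B where "A \<in> sets borel" "B \<in> sets borel" "a = V -` A \<inter> space M" "b = W -` B \<inter> space M"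
          by blast
        then show "prob (a \<inter> b) = prob a * prob b" using prod by blast
      qed (auto intro: measurable_sets)
    qed
  qed simp_all
qed

section \<open>Asymptotic independence in Gaussian processes\<close>

lemma prob_space_std_normal: "prob_space std_normal_distribution"
  using prob_space_normal_density[of 1 0] by simp

lemma gaussian_measure_eq_distr:
  assumes "s \<ge> 0"
  shows "gaussian_measure m s = distr std_normal_distribution borel (\<lambda>x. m + s * x)"
proof -
  interpret N: prob_space std_normal_distribution by (rule prob_space_std_normal)
  show ?thesis
  proof (cases "s = 0")
    case True
    then show ?thesis by (simp add: gaussian_measure_def)
  next
    case False
    have "distributed std_normal_distribution lborel (\<lambda>x. x) std_normal_density"
      unfolding distributed_def by (auto intro!: measure_eqI simp: emeasure_distr)
    from N.normal_density_affine[OF this, of s m] False assms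
    have "distributed std_normal_distribution lborel (\<lambda>x. m + s * x) (normal_density m s)" by simp
    then have "distr std_normal_distribution lborel (\<lambda>x. m + s * x) = density lborel (normal_density m s)"
      by (rule distributed_distr_eq_density)
    moreover have "distr std_normal_distribution lborel (\<lambda>x. m + s * x) = distr std_normal_distribution borel (\<lambda>x. m + s * x)"
      by (rule distr_cong) auto
    ultimately show ?thesis using False by (simp add: gaussian_measure_def)
  qed
qed

lemma std_normal_moments:
  "integrable std_normal_distribution (\<lambda>x. x)" "integral\<^sup>L std_normal_distribution (\<lambda>x. x) = 0"
  "integrable std_normal_distribution (\<lambda>x. x\<^sup>2)" "integral\<^sup>L std_normal_distribution (\<lambda>x. x\<^sup>2) = 1"
  using integrable_std_normal_distribution_moment[of 1] integrable_std_normal_distribution_moment[of 2]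
    integral_std_normal_distribution_moment_odd[of 1] std_normal_distribution_even_moments(1)[of 1]
  by (simp_all add: fact_numeral)

lemma gaussian_measure_moments:
  assumes "distr M borel V = gaussian_measure m s" "s \<ge> 0" and [measurable]: "V \<in> borel_measurable M"
  shows "integrable M V" "integral\<^sup>L M V = m"
    "integrable M (\<lambda>\<omega>. (V \<omega>)\<^sup>2)" "(LINT \<omega>|M. (V \<omega>)\<^sup>2) = m\<^sup>2 + s\<^sup>2"
proof -
  interpret N: prob_space std_normal_distribution by (rule prob_space_std_normal)
  note eq = assms(1)[unfolded gaussian_measure_eq_distr[OF assms(2)]]
  have sq: "(m + s * x)\<^sup>2 = m\<^sup>2 + 2 * m * s * x + s\<^sup>2 * x\<^sup>2" for x
    by (simp add: power2_eq_square algebra_simps)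
  note [simp] = std_normal_moments
  have [simp]: "N.prob UNIV = 1" using N.prob_space by simp
  have [simp]: "integrable std_normal_distribution (\<lambda>x. (m + s * x)\<^sup>2)" unfolding sq by simp
  have "integrable (distr M borel V) (\<lambda>x. x)" "integrable (distr M borel V) (\<lambda>x. x\<^sup>2)"
    unfolding eq by (simp_all add: integrable_distr_eq)
  then show "integrable M V" "integrable M (\<lambda>\<omega>. (V \<omega>)\<^sup>2)"
    by (simp_all add: integrable_distr_eq)
  have "(LINT x|distr M borel V. x) = m" unfolding eq by (simp add: integral_distr N.prob_space)
  then show "integral\<^sup>L M V = m" by (simp add: integral_distr)
  have "(LINT x|distr M borel V. x\<^sup>2) = (LINT x|std_normal_distribution. (m + s * x)\<^sup>2)"
    unfolding eq by (simp add: integral_distr)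
  also have "\<dots> = m\<^sup>2 + s\<^sup>2" unfolding sq by (simp add: N.prob_space)
  finally show "(LINT \<omega>|M. (V \<omega>)\<^sup>2) = m\<^sup>2 + s\<^sup>2" by (simp add: integral_distr)
qed

lemma char_gaussian_measure:
  assumes "s \<ge> 0"
  shows "char (gaussian_measure m s) t = iexp (m * t) * exp (- ((s * t)\<^sup>2 / 2))"
proof -
  have "char (gaussian_measure m s) t = (CLINT x|std_normal_distribution. iexp (t * (m + s * x)))"
    unfolding gaussian_measure_eq_distr[OF assms] char_def by (subst integral_distr) auto
  also have "\<dots> = (CLINT x|std_normal_distribution. iexp (m * t) * iexp (t * s * x))"
    by (intro bochner_cong) (simp_all add: exp_add[symmetric] algebra_simps)
  also have "\<dots> = iexp (m * t) * char std_normal_distribution (t * s)"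
    unfolding char_def by (simp only: integral_mult_right_zero)
  finally show ?thesis by (simp add: char_std_normal_distribution mult.commute exp_of_real)
qed

lemma measure_gaussian_measure:
  assumes "s \<ge> 0" and [measurable]: "A \<in> sets borel"
  shows "measure (gaussian_measure m s) A = (LINT w|std_normal_distribution. indicator A (m + s * w))"
proof -
  have "measure (gaussian_measure m s) A = (LINT z|gaussian_measure m s. indicator A z)"
    by (simp add: gaussian_measure_eq_distr[OF assms(1)])
  also have "\<dots> = (LINT w|std_normal_distribution. indicator A (m + s * w))"
    unfolding gaussian_measure_eq_distr[OF assms(1)] by (subst integral_distr) auto
  finally show ?thesis .
qed

text \<open>Convergence in total variation: the set \<open>A\<close> is arbitrary, so weak convergence of the normal laws
  would not suffice.\<close>

lemma tendsto_measure_gaussian_measure: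
  assumes m: "m \<longlonglongrightarrow> 0" and s: "s \<longlonglongrightarrow> 1" and A[measurable]: "A \<in> sets borel"
  shows "(\<lambda>n. measure (gaussian_measure (m n) (s n)) A) \<longlonglongrightarrow> measure std_normal_distribution A"
proof -
  have meas: "measure (density lborel (normal_density \<mu> \<sigma>)) A = (LINT x|lborel. indicator A x * normal_density \<mu> \<sigma> x)"
    if "\<sigma> > 0" for \<mu> \<sigma>
  proof -
    have "measure (density lborel (normal_density \<mu> \<sigma>)) A = (LINT x|density lborel (normal_density \<mu> \<sigma>). indicator A x)"
      by simp
    also have "\<dots> = (LINT x|lborel. normal_density \<mu> \<sigma> x *\<^sub>R indicator A x)"
      by (subst integral_density) (auto simp: normal_density_nonneg)
    finally show ?thesis by (simp add: mult.commute)
  qed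
  \<comment> \<open>Truncation changes only finitely many terms and keeps all densities below one multiple of a
     normal density.\<close>
  define s' where "s' n = max (1/2) (min 2 (s n))" for n
  define m' where "m' n = max (-1) (min 1 (m n))" for n
  have s': "s' \<longlonglongrightarrow> max (1/2) (min 2 1)" unfolding s'_def by (intro tendsto_intros s)
  have m': "m' \<longlonglongrightarrow> max (-1) (min 1 0)" unfolding m'_def by (intro tendsto_intros m)
  have bnds: "1/2 \<le> s' n" "s' n \<le> 2" "\<bar>m' n\<bar> \<le> 1" for n
    by (auto simp: s'_def m'_def)
  let ?C = "exp (1/8) * 2 * sqrt 8 :: real"
  have dens: "(\<lambda>n. LINT x|lborel. indicator A x * normal_density (m' n) (s' n) x) \<longlonglongrightarrow> (LINT x|lborel. indicator A x * std_normal_density x)"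
  proof (rule integral_dominated_convergence[where w = "\<lambda>x. ?C * normal_density 0 (sqrt 8) x"])
    show "AE x in lborel. (\<lambda>n. indicator A x * normal_density (m' n) (s' n) x) \<longlonglongrightarrow> indicator A x * std_normal_density x"
    proof (rule AE_I2)
      fix x
      have "(\<lambda>n. normal_density (m' n) (s' n) x) \<longlonglongrightarrow> 1 / sqrt (2 * pi * 1\<^sup>2) * exp (- (x - 0)\<^sup>2 / (2 * 1\<^sup>2))"
        unfolding normal_density_def using m' s' by (intro tendsto_intros) auto
      then show "(\<lambda>n. indicator A x * normal_density (m' n) (s' n) x) \<longlonglongrightarrow> indicator A x * std_normal_density x"
        by (intro tendsto_intros) (simp add: std_normal_density_def)
    qed
    show "AE x in lborel. norm (indicator A x * normal_density (m' n) (s' n) x) \<le> ?C * normal_density 0 (sqrt 8) x" for n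
    proof (rule AE_I2)
      fix x
      have s0: "s' n > 0" using bnds(1)[of n] by simp
      have "(s' n)\<^sup>2 \<ge> (1/2)\<^sup>2" "(s' n)\<^sup>2 \<le> 2\<^sup>2" using bnds[of n] by (intro power_mono; simp)+
      then have sq: "1/4 \<le> (s' n)\<^sup>2" "(s' n)\<^sup>2 \<le> 4" by (simp_all add: power2_eq_square)
      have "0 \<le> (x - 2 * m' n)\<^sup>2" by simp
      moreover have "(m' n)\<^sup>2 \<le> 1" using bnds(3)[of n] by (simp add: abs_square_le_1)
      ultimately have "x\<^sup>2 / 2 - 1 \<le> (x - m' n)\<^sup>2" by (simp add: power2_eq_square algebra_simps)
      then have "(x\<^sup>2 / 2 - 1) / 8 \<le> (x - m' n)\<^sup>2 / 8" by simp
      also have "\<dots> \<le> (x - m' n)\<^sup>2 / (2 * (s' n)\<^sup>2)"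
        using sq s0 by (intro divide_left_mono) auto
      finally have e: "- (x - m' n)\<^sup>2 / (2 * (s' n)\<^sup>2) \<le> 1/8 + - x\<^sup>2 / 16" by (simp add: field_simps)
      have "sqrt (2 * pi * (s' n)\<^sup>2) \<ge> sqrt (2 * pi / 4)" using sq by simp
      also have "sqrt (2 * pi / 4) = sqrt (2 * pi) / 2" by (simp only: real_sqrt_divide real_sqrt_four)
      finally have "1 / sqrt (2 * pi * (s' n)\<^sup>2) \<le> 2 / sqrt (2 * pi)"
        using s0 by (simp add: field_simps)
      then have "normal_density (m' n) (s' n) x \<le> 2 / sqrt (2 * pi) * exp (1/8 + - x\<^sup>2 / 16)"
        unfolding normal_density_def using e by (intro mult_mono) auto
      also have "\<dots> = ?C * normal_density 0 (sqrt 8) x"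
      proof -
        have sq8: "sqrt (2 * pi * (sqrt 8)\<^sup>2) = sqrt 8 * sqrt (2 * pi)" "2 * (sqrt 8)\<^sup>2 = (16::real)"
          by (simp_all add: real_sqrt_mult[symmetric])
        have "exp (1/8 + - x\<^sup>2 / 16) = exp (1/8) * exp (- x\<^sup>2 / 16)" by (rule exp_add)
        then show ?thesis unfolding normal_density_def sq8 by simp
      qed
      finally show "norm (indicator A x * normal_density (m' n) (s' n) x) \<le> ?C * normal_density 0 (sqrt 8) x"
        by (auto simp: indicator_def normal_density_nonneg)
    qed
  qed (auto intro!: integrable_normal_density)
  have lim: "(\<lambda>n. measure (gaussian_measure (m' n) (s' n)) A) \<longlonglongrightarrow> measure std_normal_distribution A"
  proof -
    have pos: "s' n > 0" for n using bnds(1)[of n] by simp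
    have "gaussian_measure (m' n) (s' n) = density lborel (normal_density (m' n) (s' n))" for n
      using pos[of n] by (simp add: gaussian_measure_def)
    then show ?thesis using dens by (simp add: meas pos)
  qed
  have "\<forall>\<^sub>F n in sequentially. s n > 1/2" "\<forall>\<^sub>F n in sequentially. s n < 2"
    "\<forall>\<^sub>F n in sequentially. m n > -1" "\<forall>\<^sub>F n in sequentially. m n < 1"
    using order_tendstoD(1)[OF s, of "1/2"] order_tendstoD(2)[OF s, of 2]
      order_tendstoD(1)[OF m, of "-1"] order_tendstoD(2)[OF m, of 1] by simp_all
  then have "\<forall>\<^sub>F n in sequentially. measure (gaussian_measure (m' n) (s' n)) A = measure (gaussian_measure (m n) (s n)) A"
    by eventually_elim (simp add: s'_def m'_def)
  with lim show ?thesis by (rule Lim_transform_eventually)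
qed

text \<open>The residual \<open>W' = (W - \<rho> V) / sqrt (1 - \<rho>\<^sup>2)\<close> is uncorrelated with \<open>V\<close>, hence independent of it. Given \<open>V = x\<close>,
  the law of \<open>W\<close> is therefore normal with mean \<open>\<rho> x\<close> and variance \<open>1 - \<rho>\<^sup>2\<close>.\<close>

lemma (in prob_space) bivariate_gaussian_joint_prob:
  fixes V W :: "'a \<Rightarrow> real"
  assumes [measurable]: "V \<in> borel_measurable M" "W \<in> borel_measurable M"
    and gauss: "\<And>a b. \<exists>m s. s \<ge> 0 \<and> distr M borel (\<lambda>\<omega>. a * V \<omega> + b * W \<omega>) = gaussian_measure m s"
    and mean: "expectation V = 0" "expectation W = 0"
    and var: "expectation (\<lambda>\<omega>. (V \<omega>)\<^sup>2) = 1" "expectation (\<lambda>\<omega>. (W \<omega>)\<^sup>2) = 1"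
    and cov: "expectation (\<lambda>\<omega>. V \<omega> * W \<omega>) = \<rho>" and \<rho>: "\<bar>\<rho>\<bar> < 1"
    and A[measurable]: "A \<in> sets borel"
  shows "prob {\<omega>\<in>space M. V \<omega> \<in> A \<and> W \<omega> \<in> A} =
    (LINT x|std_normal_distribution. indicator A x * measure (gaussian_measure (\<rho> * x) (sqrt (1 - \<rho>\<^sup>2))) A)"
proof -
  interpret N: prob_space std_normal_distribution by (rule prob_space_std_normal)
  have mom: "integrable M V" "integrable M (\<lambda>\<omega>. (V \<omega>)\<^sup>2)" "integrable M W" "integrable M (\<lambda>\<omega>. (W \<omega>)\<^sup>2)"
  proof -
    obtain m s where "s \<ge> 0" "distr M borel V = gaussian_measure m s" using gauss[of 1 0] by auto
    then show "integrable M V" "integrable M (\<lambda>\<omega>. (V \<omega>)\<^sup>2)"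
      using gaussian_measure_moments(1,3)[of M V m s] by simp_all
    obtain m s where "s \<ge> 0" "distr M borel W = gaussian_measure m s" using gauss[of 0 1] by auto
    then show "integrable M W" "integrable M (\<lambda>\<omega>. (W \<omega>)\<^sup>2)"
      using gaussian_measure_moments(1,3)[of M W m s] by simp_all
  qed
  have intVW: "integrable M (\<lambda>\<omega>. V \<omega> * W \<omega>)"
  proof (rule Bochner_Integration.integrable_bound)
    show "integrable M (\<lambda>\<omega>. (V \<omega>)\<^sup>2 + (W \<omega>)\<^sup>2)" using mom by simp
    show "AE \<omega> in M. norm (V \<omega> * W \<omega>) \<le> norm ((V \<omega>)\<^sup>2 + (W \<omega>)\<^sup>2)"
    proof (rule AE_I2)
      fix \<omega>
      have "0 \<le> (\<bar>V \<omega>\<bar> - \<bar>W \<omega>\<bar>)\<^sup>2" by simp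
      then have "2 * (\<bar>V \<omega>\<bar> * \<bar>W \<omega>\<bar>) \<le> (V \<omega>)\<^sup>2 + (W \<omega>)\<^sup>2" by (simp add: power2_diff)
      moreover have "0 \<le> \<bar>V \<omega>\<bar> * \<bar>W \<omega>\<bar>" by simp
      ultimately have "\<bar>V \<omega>\<bar> * \<bar>W \<omega>\<bar> \<le> (V \<omega>)\<^sup>2 + (W \<omega>)\<^sup>2" by linarith
      then show "norm (V \<omega> * W \<omega>) \<le> norm ((V \<omega>)\<^sup>2 + (W \<omega>)\<^sup>2)" by (simp add: abs_mult)
    qed
  qed simp
  have cf: "(CLINT \<omega>|M. iexp (a * V \<omega> + b * W \<omega>)) = exp (- ((a\<^sup>2 + b\<^sup>2 + 2 * a * b * \<rho>) / 2))" for a b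
  proof -
    obtain m s where ms: "s \<ge> 0" "distr M borel (\<lambda>\<omega>. a * V \<omega> + b * W \<omega>) = gaussian_measure m s"
      using gauss by blast
    have [measurable]: "(\<lambda>\<omega>. a * V \<omega> + b * W \<omega>) \<in> borel_measurable M" by simp
    note g = gaussian_measure_moments[OF ms(2,1)]
    have "m = 0" using g(2) mom mean by simp
    have "m\<^sup>2 + s\<^sup>2 = expectation (\<lambda>\<omega>. a\<^sup>2 * (V \<omega>)\<^sup>2 + b\<^sup>2 * (W \<omega>)\<^sup>2 + 2 * a * b * (V \<omega> * W \<omega>))"
      using g(4) by (simp add: power2_eq_square algebra_simps)
    also have "\<dots> = a\<^sup>2 + b\<^sup>2 + 2 * a * b * \<rho>"
      using mom intVW var cov by simp
    finally have s2: "s\<^sup>2 = a\<^sup>2 + b\<^sup>2 + 2 * a * b * \<rho>" using \<open>m = 0\<close> by simp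
    have "(CLINT \<omega>|M. iexp (a * V \<omega> + b * W \<omega>)) = char (gaussian_measure m s) 1"
      unfolding ms(2)[symmetric] char_def by (subst integral_distr) auto
    also have "\<dots> = exp (- (s\<^sup>2 / 2))"
      by (simp add: char_gaussian_measure[OF ms(1)] \<open>m = 0\<close>)
    finally show ?thesis by (simp add: s2)
  qed
  define r where "r = sqrt (1 - \<rho>\<^sup>2)"
  have "\<rho>\<^sup>2 < 1" using \<rho> by (simp add: abs_square_less_1)
  then have r: "r > 0" "r\<^sup>2 = 1 - \<rho>\<^sup>2" by (simp_all add: r_def)
  define W' where "W' \<omega> = (W \<omega> - \<rho> * V \<omega>) / r" for \<omega>
  have [measurable]: "W' \<in> borel_measurable M" unfolding W'_def by simp
  have W: "W \<omega> = \<rho> * V \<omega> + r * W' \<omega>" for \<omega> using r by (simp add: W'_def)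
  have cf': "(CLINT \<omega>|M. iexp (a * V \<omega> + b * W' \<omega>)) = exp (- (a\<^sup>2 / 2)) * exp (- (b\<^sup>2 / 2))" for a b
  proof -
    have "(CLINT \<omega>|M. iexp (a * V \<omega> + b * W' \<omega>)) = (CLINT \<omega>|M. iexp ((a - \<rho> * b / r) * V \<omega> + (b / r) * W \<omega>))"
      by (intro bochner_cong refl arg_cong[where f = iexp]) (use r(1) in \<open>simp add: W'_def field_simps\<close>)
    also have "\<dots> = exp (- (((a - \<rho> * b / r)\<^sup>2 + (b / r)\<^sup>2 + 2 * (a - \<rho> * b / r) * (b / r) * \<rho>) / 2))" by (rule cf)
    also have "(a - \<rho> * b / r)\<^sup>2 + (b / r)\<^sup>2 + 2 * (a - \<rho> * b / r) * (b / r) * \<rho> = a\<^sup>2 + (b / r)\<^sup>2 * (1 - \<rho>\<^sup>2)"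
    proof -
      have "(a - \<rho> * c)\<^sup>2 + c\<^sup>2 + 2 * (a - \<rho> * c) * c * \<rho> = a\<^sup>2 + c\<^sup>2 * (1 - \<rho>\<^sup>2)" for c
        by (simp add: power2_eq_square algebra_simps)
      from this[of "b / r"] show ?thesis by simp
    qed
    also have "(b / r)\<^sup>2 * (1 - \<rho>\<^sup>2) = b\<^sup>2" using r by (simp add: power_divide flip: r(2))
    also have "exp (- ((a\<^sup>2 + b\<^sup>2) / 2)) = exp (- (a\<^sup>2 / 2)) * exp (- (b\<^sup>2 / 2))"
      by (subst exp_add[symmetric]) (simp add: add_divide_distrib)
    finally show ?thesis by simp
  qed
  have cV: "char (distr M borel V) a = exp (- (a\<^sup>2 / 2))" for a
    using cf'[of a 0] unfolding char_def by (subst integral_distr) auto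
  have cW: "char (distr M borel W') b = exp (- (b\<^sup>2 / 2))" for b
    using cf'[of 0 b] unfolding char_def by (subst integral_distr) auto
  have law: "distr M borel V = std_normal_distribution" "distr M borel W' = std_normal_distribution"
    by (rule Levy_uniqueness; auto intro!: real_distribution_distr real_dist_normal_dist simp: fun_eq_iff cV cW char_std_normal_distribution)+
  have "indep_var borel V borel W'"
    by (rule indep_var_if_char_factorizes) (auto simp only: cf' cV cW, simp_all)
  then have joint: "distr M (borel \<Otimes>\<^sub>M borel) (\<lambda>\<omega>. (V \<omega>, W' \<omega>)) = std_normal_distribution \<Otimes>\<^sub>M std_normal_distribution"
    unfolding indep_var_distribution_eq law by simp
  interpret P: pair_prob_space std_normal_distribution std_normal_distribution ..
  let ?f = "\<lambda>(x, w). indicator A x * indicator A (\<rho> * x + r * w) :: real"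
  have "prob {\<omega>\<in>space M. V \<omega> \<in> A \<and> W \<omega> \<in> A} = expectation (indicator {\<omega>\<in>space M. V \<omega> \<in> A \<and> W \<omega> \<in> A})"
    by simp
  also have "\<dots> = expectation (\<lambda>\<omega>. ?f (V \<omega>, W' \<omega>))"
    by (intro bochner_cong) (auto simp: indicator_def W)
  also have "\<dots> = integral\<^sup>L (std_normal_distribution \<Otimes>\<^sub>M std_normal_distribution) ?f"
    unfolding joint[symmetric] by (subst integral_distr) auto
  also have "\<dots> = (LINT x|std_normal_distribution. LINT w|std_normal_distribution. indicator A x * indicator A (\<rho> * x + r * w))"
    by (subst P.integral_fst'[symmetric])
       (auto intro!: P.P.integrable_const_bound[of _ 1] simp: indicator_def)
  also have "\<dots> = (LINT x|std_normal_distribution. indicator A x * measure (gaussian_measure (\<rho> * x) r) A)"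
  proof (intro bochner_cong refl)
    fix x
    have "measure (gaussian_measure (\<rho> * x) r) A = (LINT z|gaussian_measure (\<rho> * x) r. indicator A z)"
      using r by (simp add: gaussian_measure_def)
    also have "\<dots> = (LINT w|std_normal_distribution. indicator A (\<rho> * x + r * w))"
      unfolding gaussian_measure_eq_distr[OF less_imp_le[OF r(1)]] by (subst integral_distr) auto
    finally show "(LINT w|std_normal_distribution. indicator A x * indicator A (\<rho> * x + r * w)) = indicator A x * measure (gaussian_measure (\<rho> * x) r) A"
      by simp
  qed
  finally show ?thesis by (simp add: r_def)
qed

text \<open>As the correlation vanishes, the conditional law of the second coordinate given the first tends to
  the standard normal law on every Borel set; dominated convergence does the rest.\<close>

lemma (in prob_space) gaussian_process_asymptotic_independence:
  fixes X :: "int \<Rightarrow> 'a \<Rightarrow> real"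
  assumes gauss: "gaussian_process M X" and mean: "\<And>i. expectation (X i) = 0" and var: "\<And>i. variance (X i) = 1"
    and cov: "(\<lambda>j. covariance M (X 0) (X (int j))) \<longlonglongrightarrow> 0" and A[measurable]: "A \<in> sets borel"
  shows "(\<lambda>j. prob {\<omega>\<in>space M. X 0 \<omega> \<in> A \<and> X (int j) \<omega> \<in> A}) \<longlonglongrightarrow> (prob {\<omega>\<in>space M. X 0 \<omega> \<in> A})\<^sup>2"
proof -
  interpret N: prob_space std_normal_distribution by (rule prob_space_std_normal)
  have X[measurable]: "X i \<in> borel_measurable M" for i using gauss by (simp add: gaussian_process_def)
  have comb: "\<exists>m s. s \<ge> 0 \<and> distr M borel (\<lambda>\<omega>. \<Sum>j\<in>J. a j * X j \<omega>) = gaussian_measure m s" if "finite J" for J a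
    using gauss that by (auto simp: gaussian_process_def)
  have sq: "expectation (\<lambda>\<omega>. (X i \<omega>)\<^sup>2) = 1" for i using var[of i] mean[of i] by simp
  define \<rho> where "\<rho> j = covariance M (X 0) (X (int j))" for j :: nat
  have \<rho>_eq: "expectation (\<lambda>\<omega>. X 0 \<omega> * X (int j) \<omega>) = \<rho> j" for j
    by (simp add: \<rho>_def covariance_def mean)
  have \<rho>_lim: "\<rho> \<longlonglongrightarrow> 0" using cov by (simp add: \<rho>_def[abs_def])
  have law0: "distr M borel (X 0) = std_normal_distribution"
  proof -
    obtain m s where ms: "s \<ge> 0" "distr M borel (X 0) = gaussian_measure m s" using comb[of "{0}" "\<lambda>_. 1"] by auto
    from gaussian_measure_moments[OF ms(2,1)] have "m = 0" "m\<^sup>2 + s\<^sup>2 = 1" using mean[of 0] sq[of 0] by simp_all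
    then have "s = 1" using ms(1) by (simp add: power2_eq_1_iff)
    then show ?thesis using \<open>m = 0\<close> ms by (simp add: gaussian_measure_def)
  qed
  let ?p = "measure std_normal_distribution A"
  \<comment> \<open>The maximum only matters for the finitely many \<open>j\<close> whose correlation is not yet below 1
     in absolute value.\<close>
  let ?r = "\<lambda>j. sqrt (max 0 (1 - (\<rho> j)\<^sup>2))"
  let ?G = "\<lambda>j x. gaussian_measure (\<rho> j * x) (?r j)"
  have p: "prob {\<omega>\<in>space M. X 0 \<omega> \<in> A} = ?p"
    unfolding law0[symmetric] by (simp add: measure_distr vimage_def Int_def conj_commute)
  have "\<forall>\<^sub>F j in sequentially. \<bar>\<rho> j\<bar> < 1"
    using order_tendstoD(2)[OF tendsto_rabs[OF \<rho>_lim], of 1] by simp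
  then have ev: "\<forall>\<^sub>F j in sequentially. prob {\<omega>\<in>space M. X 0 \<omega> \<in> A \<and> X (int j) \<omega> \<in> A} =
     (LINT x|std_normal_distribution. indicator A x * measure (?G j x) A)"
    using eventually_gt_at_top[of 0]
  proof eventually_elim
    case (elim j)
    have "(\<rho> j)\<^sup>2 < 1" using elim by (simp add: abs_square_less_1)
    then have "max 0 (1 - (\<rho> j)\<^sup>2) = 1 - (\<rho> j)\<^sup>2" by simp
    moreover have "\<exists>m s. s \<ge> 0 \<and> distr M borel (\<lambda>\<omega>. a * X 0 \<omega> + b * X (int j) \<omega>) = gaussian_measure m s" for a b
      using comb[of "{0, int j}" "(\<lambda>_. 0)(0 := a, int j := b)"] elim by simp
    ultimately show ?case using elim
      by (simp add: bivariate_gaussian_joint_prob[OF X X _ mean mean sq sq \<rho>_eq _ A])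
  qed
  have "(\<lambda>j. LINT x|std_normal_distribution. indicator A x * measure (?G j x) A)
      \<longlonglongrightarrow> (LINT x|std_normal_distribution. indicator A x * ?p)"
  proof (rule integral_dominated_convergence[where w = "\<lambda>_. 1"])
    show "(\<lambda>x. indicator A x * measure (?G j x) A) \<in> borel_measurable std_normal_distribution" for j
    proof -
      have "(\<lambda>x. LINT w|std_normal_distribution. indicator A (\<rho> j * x + ?r j * w) :: real) \<in> borel_measurable std_normal_distribution"
        by (rule N.borel_measurable_lebesgue_integral) measurable
      then show ?thesis by (subst measure_gaussian_measure) simp_all
    qed
    show "AE x in std_normal_distribution. norm (indicator A x * measure (?G j x) A) \<le> 1" for j
    proof (rule AE_I2)
      fix x
      interpret G: prob_space "?G j x"
        by (subst gaussian_measure_eq_distr) (auto intro: N.prob_space_distr)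
      show "norm (indicator A x * measure (?G j x) A) \<le> 1" by (auto simp: indicator_def)
    qed
    show "AE x in std_normal_distribution. (\<lambda>j. indicator A x * measure (?G j x) A) \<longlonglongrightarrow> indicator A x * ?p"
    proof (rule AE_I2)
      fix x
      have "(\<lambda>j. \<rho> j * x) \<longlonglongrightarrow> 0 * x" "(\<lambda>j. ?r j) \<longlonglongrightarrow> sqrt (max 0 (1 - 0\<^sup>2))"
        by (intro tendsto_intros \<rho>_lim)+
      then show "(\<lambda>j. indicator A x * measure (?G j x) A) \<longlonglongrightarrow> indicator A x * ?p"
        by (intro tendsto_intros tendsto_measure_gaussian_measure A) simp_all
    qed
  qed auto
  also have "(LINT x|std_normal_distribution. indicator A x * ?p) = ?p\<^sup>2"
    by (simp add: power2_eq_square)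
  finally show ?thesis unfolding p by (rule Lim_transform_eventually) (use ev in eventually_elim, simp)
qed

lemma (in prob_space) stationary_process_joint_prob:
  fixes X :: "int \<Rightarrow> 'a \<Rightarrow> real"
  assumes "stationary_process M X" and [measurable]: "\<And>i. X i \<in> borel_measurable M" "A \<in> sets borel" "B \<in> sets borel"
  shows "prob {\<omega>\<in>space M. X (i + t) \<omega> \<in> A \<and> X (j + t) \<omega> \<in> B} = prob {\<omega>\<in>space M. X i \<omega> \<in> A \<and> X j \<omega> \<in> B}"
proof -
  let ?P = "Pi\<^sub>M UNIV (\<lambda>_. borel) :: (int \<Rightarrow> real) measure"
  let ?E = "{x \<in> space ?P. x i \<in> A \<and> x j \<in> B}"
  have m: "(\<lambda>\<omega> i. X (i + s) \<omega>) \<in> measurable M ?P" for s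
    by (rule measurable_PiM_single') (auto simp: space_PiM)
  have E: "?E \<in> sets ?P" by measurable
  have "measure (distr M ?P (\<lambda>\<omega> i. X (i + s) \<omega>)) ?E = prob {\<omega>\<in>space M. X (i + s) \<omega> \<in> A \<and> X (j + s) \<omega> \<in> B}" for s
    unfolding measure_distr[OF m E] by (rule arg_cong[where f = prob]) (auto simp: space_PiM)
  note this[of t] this[of 0]
  moreover have "distr M ?P (\<lambda>\<omega> i. X (i + t) \<omega>) = distr M ?P (\<lambda>\<omega> i. X (i + 0) \<omega>)"
    using assms(1) by (simp add: stationary_process_def)
  ultimately show ?thesis by simp
qed

lemma (in prob_space) stationary_process_marginal:
  fixes X :: "int \<Rightarrow> 'a \<Rightarrow> real"
  assumes "stationary_process M X" and [measurable]: "\<And>i. X i \<in> borel_measurable M"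
  shows "distr M borel (X i) = distr M borel (X j)"
proof (rule measure_eqI)
  fix A assume "A \<in> sets (distr M borel (X i))"
  then have A[measurable]: "A \<in> sets borel" by simp
  have "prob {\<omega>\<in>space M. X i \<omega> \<in> A} = prob {\<omega>\<in>space M. X j \<omega> \<in> A}"
    using stationary_process_joint_prob[OF assms A A, of j "i - j" j] by simp
  then show "emeasure (distr M borel (X i)) A = emeasure (distr M borel (X j)) A"
    by (simp add: emeasure_distr emeasure_eq_measure vimage_def Int_def conj_commute)
qed simp

section \<open>The stochastic volatility model and resampling one noise variable\<close>

locale sv_model = prob_space M for M :: "'a measure" +
  fixes X Z :: "int \<Rightarrow> 'a \<Rightarrow> real" and \<sigma> :: "real \<Rightarrow> real"
  assumes X_measurable[measurable]: "\<And>i. X i \<in> borel_measurable M"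
    and \<sigma>_measurable[measurable]: "\<sigma> \<in> borel_measurable borel"
    and \<sigma>_nonneg: "\<And>x. \<sigma> x \<ge> 0"
    and Z_indep: "indep_vars (\<lambda>_. borel) Z UNIV"
    and Z_distr: "\<And>i. distr M borel (Z i) = distr M borel (Z 1)"
    and XZ_indep: "indep_var (Pi\<^sub>M UNIV (\<lambda>_. borel)) (\<lambda>\<omega> i. X i \<omega>) (Pi\<^sub>M UNIV (\<lambda>_. borel)) (\<lambda>\<omega> i. Z i \<omega>)"
begin

abbreviation E :: "(int \<Rightarrow> real) measure" where "E \<equiv> Pi\<^sub>M UNIV (\<lambda>_. borel)"

definition \<nu> where "\<nu> = distr M borel (Z 1)"

lemma Z_measurable[measurable]: "Z i \<in> borel_measurable M"
  using Z_indep by (auto simp: indep_vars_def)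

lemma law_Z_marginal: "distr M borel (Z i) = \<nu>"
  unfolding \<nu>_def by (rule Z_distr)

lemma sets_\<nu>[simp, measurable_cong]: "sets \<nu> = sets borel" and space_\<nu>[simp]: "space \<nu> = UNIV"
  by (simp_all add: \<nu>_def)

lemma prob_space_\<nu>: "prob_space \<nu>"
  unfolding \<nu>_def by (rule prob_space_distr) simp

sublocale nu: prob_space \<nu> by (rule prob_space_\<nu>)

lemma XZ_measurable[measurable]:
  "(\<lambda>\<omega> i. X i \<omega>) \<in> measurable M E" "(\<lambda>\<omega> i. Z i \<omega>) \<in> measurable M E"
  by (rule measurable_PiM_single'; simp add: space_PiM)+

lemma resample_map_measurable[measurable]: "(\<lambda>(z, t). z(i := t)) \<in> measurable (E \<Otimes>\<^sub>M borel) E"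
  by (rule measurable_PiM_single') (auto simp: space_PiM)

lemma resampled_measurable[measurable (raw)]:
  assumes "f \<in> measurable N E" "g \<in> borel_measurable N"
  shows "(\<lambda>x. (f x)(i := g x)) \<in> measurable N E"
  using measurable_compose[OF measurable_Pair[OF assms] resample_map_measurable] by simp

lemma law_Z: "distr M E (\<lambda>\<omega> i. Z i \<omega>) = Pi\<^sub>M UNIV (\<lambda>_. \<nu>)"
  using indep_vars_iff_distr_eq_PiM[where I = "UNIV :: int set" and M' = "\<lambda>_. borel" and X = Z] Z_indep
  by (simp add: restrict_UNIV law_Z_marginal)

text \<open>Replacing \<open>Z\<^sub>i\<close> by an independent copy \<open>t\<close> does not change the joint law of the two sequences. This
  is the form in which independence is used throughout: it isolates one noise variable with everything else
  fixed, without splitting the product space.\<close>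

lemma nn_integral_resample:
  assumes f[measurable]: "f \<in> borel_measurable (E \<Otimes>\<^sub>M E)"
  shows "(\<integral>\<^sup>+\<omega>. f (\<lambda>j. X j \<omega>, \<lambda>j. Z j \<omega>) \<partial>M) =
    (\<integral>\<^sup>+\<omega>. (\<integral>\<^sup>+t. f (\<lambda>j. X j \<omega>, (\<lambda>j. Z j \<omega>)(i := t)) \<partial>\<nu>) \<partial>M)"
proof -
  let ?PX = "distr M E (\<lambda>\<omega> i. X i \<omega>)" and ?PZ = "Pi\<^sub>M UNIV (\<lambda>_. \<nu>) :: (int \<Rightarrow> real) measure"
  have sPZ[measurable_cong]: "sets ?PZ = sets E" by (rule sets_PiM_cong) auto
  interpret PX: prob_space ?PX by (rule prob_space_distr) (rule XZ_measurable)
  interpret PZ: prob_space ?PZ by (rule prob_space_PiM) (rule prob_space_\<nu>)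
  interpret PZN: pair_sigma_finite \<nu> ?PZ ..
  have joint: "distr M (E \<Otimes>\<^sub>M E) (\<lambda>\<omega>. (\<lambda>i. X i \<omega>, \<lambda>i. Z i \<omega>)) = ?PX \<Otimes>\<^sub>M ?PZ"
    using XZ_indep unfolding indep_var_distribution_eq law_Z by simp
  have *: "(\<integral>\<^sup>+\<omega>. g (\<lambda>j. X j \<omega>, \<lambda>j. Z j \<omega>) \<partial>M) = (\<integral>\<^sup>+x. (\<integral>\<^sup>+z. g (x, z) \<partial>?PZ) \<partial>?PX)"
    if g: "g \<in> borel_measurable (E \<Otimes>\<^sub>M E)" for g
  proof -
    have "(\<integral>\<^sup>+\<omega>. g (\<lambda>j. X j \<omega>, \<lambda>j. Z j \<omega>) \<partial>M) = (\<integral>\<^sup>+p. g p \<partial>distr M (E \<Otimes>\<^sub>M E) (\<lambda>\<omega>. (\<lambda>i. X i \<omega>, \<lambda>i. Z i \<omega>)))"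
      by (rule nn_integral_distr[symmetric]) (auto intro!: measurable_Pair XZ_measurable g)
    also have "\<dots> = (\<integral>\<^sup>+x. (\<integral>\<^sup>+z. g (x, z) \<partial>?PZ) \<partial>?PX)"
      unfolding joint
    proof (rule PZ.nn_integral_fst[symmetric])
      have "sets (?PX \<Otimes>\<^sub>M ?PZ) = sets (E \<Otimes>\<^sub>M E)" by (rule sets_pair_measure_cong) (auto simp: sPZ)
      then show "g \<in> borel_measurable (?PX \<Otimes>\<^sub>M ?PZ)" using g by (simp cong: measurable_cong_sets)
    qed
    finally show ?thesis .
  qed
  have upd: "(\<lambda>q. f (fst (fst q), (snd (fst q))(i := snd q))) \<in> borel_measurable ((E \<Otimes>\<^sub>M E) \<Otimes>\<^sub>M \<nu>)"
    by (rule measurable_compose[OF _ f], rule measurable_Pair, measurable)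
  have "(\<integral>\<^sup>+\<omega>. (\<integral>\<^sup>+t. f (\<lambda>j. X j \<omega>, (\<lambda>j. Z j \<omega>)(i := t)) \<partial>\<nu>) \<partial>M) =
    (\<integral>\<^sup>+x. (\<integral>\<^sup>+z. (\<integral>\<^sup>+t. f (x, z(i := t)) \<partial>\<nu>) \<partial>?PZ) \<partial>?PX)"
    using *[OF nu.borel_measurable_nn_integral_fst[OF upd]] by simp
  also have "\<dots> = (\<integral>\<^sup>+x. (\<integral>\<^sup>+z. f (x, z) \<partial>?PZ) \<partial>?PX)"
  proof (rule nn_integral_cong)
    fix x assume "x \<in> space ?PX"
    then have x: "(\<lambda>z. f (x, z)) \<in> borel_measurable E"
      using measurable_compose[OF measurable_Pair1' f, of x] by simp
    have u: "(\<lambda>(t, z). z(i := t)) \<in> measurable (\<nu> \<Otimes>\<^sub>M ?PZ) ?PZ"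
      unfolding case_prod_beta' by measurable
    have x': "(\<lambda>z. f (x, z)) \<in> borel_measurable ?PZ" using x sPZ by (simp cong: measurable_cong_sets)
    have "(\<integral>\<^sup>+z. f (x, z) \<partial>?PZ) = (\<integral>\<^sup>+z. f (x, z) \<partial>distr (\<nu> \<Otimes>\<^sub>M ?PZ) ?PZ (\<lambda>(t, z). z(i := t)))"
      using distr_pair_PiM_eq_PiM[of UNIV "\<lambda>_. \<nu>" i] prob_space_\<nu> by simp
    also have "\<dots> = (\<integral>\<^sup>+p. (case p of (t, z) \<Rightarrow> f (x, z(i := t))) \<partial>(\<nu> \<Otimes>\<^sub>M ?PZ))"
      using x' by (subst nn_integral_distr[OF u]) (simp_all add: case_prod_beta')
    also have "\<dots> = (\<integral>\<^sup>+z. (\<integral>\<^sup>+t. f (x, z(i := t)) \<partial>\<nu>) \<partial>?PZ)"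
      using PZN.nn_integral_snd[of "\<lambda>(t, z). f (x, z(i := t))"] measurable_compose[OF u x']
      by (simp add: case_prod_beta')
    finally show "(\<integral>\<^sup>+z. (\<integral>\<^sup>+t. f (x, z(i := t)) \<partial>\<nu>) \<partial>?PZ) = (\<integral>\<^sup>+z. f (x, z) \<partial>?PZ)" ..
  qed
  also have "\<dots> = (\<integral>\<^sup>+\<omega>. f (\<lambda>j. X j \<omega>, \<lambda>j. Z j \<omega>) \<partial>M)"
    by (rule *[OF f, symmetric])
  finally show ?thesis ..
qed

lemma integral_resample:
  fixes f :: "(int \<Rightarrow> real) \<times> (int \<Rightarrow> real) \<Rightarrow> 'b::{banach, second_countable_topology}"
  assumes f: "f \<in> borel_measurable (E \<Otimes>\<^sub>M E)" and bdd: "\<And>p. norm (f p) \<le> K"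
  shows "(LINT \<omega>|M. f (\<lambda>j. X j \<omega>, \<lambda>j. Z j \<omega>)) =
    (LINT \<omega>|M. (LINT t|\<nu>. f (\<lambda>j. X j \<omega>, (\<lambda>j. Z j \<omega>)(i := t))))"
proof -
  interpret P: pair_prob_space M \<nu> ..
  have m1: "(\<lambda>p. (\<lambda>i. X i (fst p), (\<lambda>i. Z i (fst p))(i := snd p))) \<in> measurable (M \<Otimes>\<^sub>M \<nu>) (E \<Otimes>\<^sub>M E)"
    by (rule measurable_Pair, rule measurable_compose[OF measurable_fst XZ_measurable(1)],
        rule resampled_measurable, rule measurable_compose[OF measurable_fst XZ_measurable(2)], measurable)
  have m2: "(\<lambda>\<omega>. (\<lambda>i. X i \<omega>, \<lambda>i. Z i \<omega>)) \<in> measurable M (E \<Otimes>\<^sub>M E)"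
    by (rule measurable_Pair; rule XZ_measurable)
  have eq: "distr (M \<Otimes>\<^sub>M \<nu>) (E \<Otimes>\<^sub>M E) (\<lambda>p. (\<lambda>i. X i (fst p), (\<lambda>i. Z i (fst p))(i := snd p))) =
    distr M (E \<Otimes>\<^sub>M E) (\<lambda>\<omega>. (\<lambda>i. X i \<omega>, \<lambda>i. Z i \<omega>))" (is "?L = ?R")
  proof (rule measure_eqI)
    fix C assume "C \<in> sets ?L"
    then have C: "indicator C \<in> borel_measurable (E \<Otimes>\<^sub>M E)" "C \<in> sets (E \<Otimes>\<^sub>M E)" by simp_all
    have "emeasure ?R C = (\<integral>\<^sup>+p. indicator C p \<partial>?R)" using C by simp
    also have "\<dots> = (\<integral>\<^sup>+\<omega>. indicator C (\<lambda>i. X i \<omega>, \<lambda>i. Z i \<omega>) \<partial>M)"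
      using C(1) by (subst nn_integral_distr[OF m2]) simp_all
    also have "\<dots> = (\<integral>\<^sup>+\<omega>. (\<integral>\<^sup>+t. indicator C (\<lambda>i. X i \<omega>, (\<lambda>i. Z i \<omega>)(i := t)) \<partial>\<nu>) \<partial>M)"
      by (rule nn_integral_resample[OF C(1)])
    also have "\<dots> = (\<integral>\<^sup>+p. indicator C (\<lambda>i. X i (fst p), (\<lambda>i. Z i (fst p))(i := snd p)) \<partial>(M \<Otimes>\<^sub>M \<nu>))"
      using nu.nn_integral_fst[OF measurable_compose[OF m1 C(1)]] by simp
    also have "\<dots> = (\<integral>\<^sup>+p. indicator C p \<partial>?L)"
      using C(1) by (subst nn_integral_distr[OF m1]) simp_all
    finally show "emeasure ?L C = emeasure ?R C" using C by simp
  qed simp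
  have "(LINT \<omega>|M. f (\<lambda>j. X j \<omega>, \<lambda>j. Z j \<omega>)) = (LINT p|?R. f p)"
    by (rule integral_distr[OF m2 f, symmetric])
  also have "\<dots> = (LINT p|(M \<Otimes>\<^sub>M \<nu>). f (\<lambda>i. X i (fst p), (\<lambda>i. Z i (fst p))(i := snd p)))"
    unfolding eq[symmetric] by (rule integral_distr[OF m1 f])
  also have "\<dots> = (LINT \<omega>|M. (LINT t|\<nu>. f (\<lambda>j. X j \<omega>, (\<lambda>j. Z j \<omega>)(i := t))))"
  proof -
    have "integrable (M \<Otimes>\<^sub>M \<nu>) (\<lambda>p. f (\<lambda>i. X i (fst p), (\<lambda>i. Z i (fst p))(i := snd p)))"
      by (rule P.P.integrable_const_bound[of _ K]) (auto simp: bdd intro: measurable_compose[OF m1 f])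
    from P.integral_fst'[OF this] show ?thesis by simp
  qed
  finally show ?thesis .
qed

end

section \<open>The number of large observations\<close>

lemma card_eq_sum_indicators:
  assumes "finite I"
  shows "real (card {i\<in>I. x i \<in> A \<and> a < z i}) = (\<Sum>i\<in>I. indicator A (x i) * indicator {a<..} (z i))"
proof -
  have "(\<Sum>i\<in>I. indicator A (x i) * indicator {a<..} (z i) :: real) = (\<Sum>i\<in>I. if x i \<in> A \<and> a < z i then 1 else 0)"
    by (rule sum.cong) (auto simp: indicator_def)
  also have "\<dots> = real (card {i\<in>I. x i \<in> A \<and> a < z i})"
    using assms by (subst sum.If_cases) (simp_all add: Int_def)
  finally show ?thesis ..
qed

context sv_model begin

lemma expectation_indicator_Z:
  fixes g :: "(int \<Rightarrow> real) \<times> (int \<Rightarrow> real) \<Rightarrow> real"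
  assumes g[measurable]: "g \<in> borel_measurable (E \<Otimes>\<^sub>M E)" and bdd: "\<And>p. \<bar>g p\<bar> \<le> K"
    and indep: "\<And>x z t. g (x, z(i := t)) = g (x, z)" and [measurable]: "B \<in> sets borel"
  shows "expectation (\<lambda>\<omega>. g (\<lambda>j. X j \<omega>, \<lambda>j. Z j \<omega>) * indicator B (Z i \<omega>)) =
    expectation (\<lambda>\<omega>. g (\<lambda>j. X j \<omega>, \<lambda>j. Z j \<omega>)) * measure \<nu> B"
proof -
  let ?f = "\<lambda>p. g p * indicator B (snd p i)"
  have "expectation (\<lambda>\<omega>. ?f (\<lambda>j. X j \<omega>, \<lambda>j. Z j \<omega>)) =
    (LINT \<omega>|M. (LINT t|\<nu>. ?f (\<lambda>j. X j \<omega>, (\<lambda>j. Z j \<omega>)(i := t))))"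
  proof (rule integral_resample)
    show "norm (?f p) \<le> \<bar>K\<bar>" for p using bdd[of p] by (auto simp: indicator_def)
  qed measurable
  also have "\<dots> = (LINT \<omega>|M. g (\<lambda>j. X j \<omega>, \<lambda>j. Z j \<omega>) * measure \<nu> B)"
    by (simp add: indep)
  finally show ?thesis by simp
qed

text \<open>Off the diagonal the noise factors out, and what is left is the correlation of indicators of \<open>X\<close>. Each
  row of the double sum has at most \<open>2 J\<close> entries with lag below \<open>J\<close>, estimated by 1; the others are at most
  \<open>e\<close>.\<close>

lemma variance_count:
  fixes n J :: nat and e :: real
  assumes stat: "stationary_process M X"
    and A[measurable]: "A \<in> sets borel" and B[measurable]: "B \<in> sets borel"
    and d: "\<And>j. j \<ge> J \<Longrightarrow> \<bar>prob {\<omega>\<in>space M. X 0 \<omega> \<in> A \<and> X (int j) \<omega> \<in> A} - (prob {\<omega>\<in>space M. X 0 \<omega> \<in> A})\<^sup>2\<bar> \<le> e"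
  defines "p \<equiv> prob {\<omega>\<in>space M. X 0 \<omega> \<in> A}" and "q \<equiv> measure \<nu> B"
  defines "N \<equiv> \<lambda>\<omega>. (\<Sum>i\<in>{1..int n}. indicator A (X i \<omega>) * indicator B (Z i \<omega>)) :: real"
  shows "expectation N = real n * (p * q)"
    and "variance N \<le> real n * (p * q) + q\<^sup>2 * real n * (2 * real J + real n * e)"
proof -
  let ?I = "{1..int n}"
  let ?D = "\<lambda>i \<omega>. indicator A (X i \<omega>) * indicator B (Z i \<omega>) :: real"
  let ?DD = "\<lambda>i j \<omega>. ?D i \<omega> * ?D j \<omega>"
  let ?c = "\<lambda>i j. (if \<bar>j - i\<bar> < int J then 1 else 0 :: real)"
  let ?bound = "real n * (p * q) + q\<^sup>2 * real n * (2 * real J + real n * e)"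
  define P where "P i j = prob {\<omega>\<in>space M. X i \<omega> \<in> A \<and> X j \<omega> \<in> A}" for i j
  have ind_X: "expectation (\<lambda>\<omega>. indicator A (X i \<omega>) * indicator A (X j \<omega>)) = P i j" for i j
  proof -
    have "expectation (\<lambda>\<omega>. indicator A (X i \<omega>) * indicator A (X j \<omega>)) = expectation (indicat_real {\<omega>\<in>space M. X i \<omega> \<in> A \<and> X j \<omega> \<in> A})"
      by (intro bochner_cong) (auto simp: indicator_def)
    then show ?thesis by (simp add: P_def)
  qed
  have P_diag: "P i i = p" for i
    using stationary_process_joint_prob[OF stat X_measurable A A, of 0 i 0] by (simp add: P_def p_def)
  have P_shift: "P i j = P 0 (j - i)" for i j
    using stationary_process_joint_prob[OF stat X_measurable A A, of 0 i "j - i"] by (simp add: P_def)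
  have P_sym: "P i j = P j i" for i j unfolding P_def by (rule arg_cong[where f = prob]) auto
  have D1: "expectation (?D i) = p * q" for i
  proof -
    have "expectation (?D i) = expectation (\<lambda>\<omega>. indicator A (X i \<omega>)) * q"
      unfolding q_def using expectation_indicator_Z[of "\<lambda>p. indicator A (fst p i)" 1 i B] by (simp add: indicator_le_1)
    moreover have "expectation (\<lambda>\<omega>. indicator A (X i \<omega>)) = P i i"
      unfolding ind_X[symmetric] by (intro bochner_cong) (auto simp: indicator_def)
    ultimately show ?thesis by (simp add: P_diag)
  qed
  have D_int: "integrable M (?DD i j)" "integrable M (?D i)" for i j
    by (rule integrable_const_bound[of _ 1]; simp add: indicator_def)+
  have D2: "expectation (?DD i j) = P i j * q\<^sup>2" if "i \<noteq> j" for i j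
  proof -
    have "expectation (?DD i j) = expectation (\<lambda>\<omega>. (indicator A (X i \<omega>) * indicator A (X j \<omega>) * indicator B (Z j \<omega>)) * indicator B (Z i \<omega>))"
      by (intro bochner_cong) (auto simp: mult_ac)
    also have "\<dots> = expectation (\<lambda>\<omega>. indicator A (X i \<omega>) * indicator A (X j \<omega>) * indicator B (Z j \<omega>)) * q"
      unfolding q_def using that
      by (subst expectation_indicator_Z[of "\<lambda>p. indicator A (fst p i) * indicator A (fst p j) * indicator B (snd p j)" 1 i B, simplified])
         (auto simp: indicator_def)
    also have "expectation (\<lambda>\<omega>. indicator A (X i \<omega>) * indicator A (X j \<omega>) * indicator B (Z j \<omega>)) = P i j * q"
      unfolding q_def ind_X[symmetric]
      by (subst expectation_indicator_Z[of "\<lambda>p. indicator A (fst p i) * indicator A (fst p j)" 1 j B, simplified])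
         (auto simp: indicator_def)
    finally show ?thesis by (simp add: power2_eq_square)
  qed
  show mean: "expectation N = real n * (p * q)"
    unfolding N_def by (subst Bochner_Integration.integral_sum) (simp_all add: D1 D_int)
  have "variance N = expectation (\<lambda>\<omega>. \<Sum>i\<in>?I. \<Sum>j\<in>?I. (?D i \<omega> * ?D j \<omega> - (p * q) * ?D i \<omega> - (p * q) * ?D j \<omega> + (p * q)\<^sup>2))"
  proof (rule bochner_cong[OF refl])
    fix \<omega>
    have "N \<omega> - expectation N = (\<Sum>i\<in>?I. ?D i \<omega> - p * q)"
      unfolding mean by (simp add: N_def sum_subtractf)
    then have "(N \<omega> - expectation N)\<^sup>2 = (\<Sum>i\<in>?I. \<Sum>j\<in>?I. (?D i \<omega> - p * q) * (?D j \<omega> - p * q))"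
      by (simp add: power2_eq_square sum_product)
    then show "(N \<omega> - expectation N)\<^sup>2 = (\<Sum>i\<in>?I. \<Sum>j\<in>?I. (?D i \<omega> * ?D j \<omega> - (p * q) * ?D i \<omega> - (p * q) * ?D j \<omega> + (p * q)\<^sup>2))"
      by (simp add: algebra_simps power2_eq_square)
  qed
  also have "\<dots> = (\<Sum>i\<in>?I. \<Sum>j\<in>?I. expectation (?DD i j) - (p * q)\<^sup>2)"
  proof -
    have i1: "integrable M (\<lambda>\<omega>. ?D i \<omega> * ?D j \<omega> - (p * q) * ?D i \<omega> - (p * q) * ?D j \<omega> + (p * q)\<^sup>2)" for i j
      by (intro Bochner_Integration.integrable_add Bochner_Integration.integrable_diff integrable_mult_right D_int integrable_const)
    have "expectation (\<lambda>\<omega>. ?D i \<omega> * ?D j \<omega> - (p * q) * ?D i \<omega> - (p * q) * ?D j \<omega> + (p * q)\<^sup>2) = expectation (?DD i j) - (p * q)\<^sup>2" for i j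
    proof -
      have "expectation (\<lambda>\<omega>. ?D i \<omega> * ?D j \<omega> - (p * q) * ?D i \<omega> - (p * q) * ?D j \<omega> + (p * q)\<^sup>2) =
        expectation (?DD i j) - (p * q) * expectation (?D i) - (p * q) * expectation (?D j) + (p * q)\<^sup>2"
        by (subst bochner_add Bochner_Integration.integral_diff,
            intro Bochner_Integration.integrable_diff integrable_mult_right D_int integrable_const,
            intro Bochner_Integration.integrable_diff integrable_mult_right D_int integrable_const)+
           (simp add: prob_space)
      then show ?thesis by (simp add: D1 power2_eq_square)
    qed
    then show ?thesis by (subst Bochner_Integration.integral_sum, intro Bochner_Integration.integrable_sum i1)
       (subst Bochner_Integration.integral_sum, rule i1, simp)
  qed
  also have "\<dots> \<le> (\<Sum>i\<in>?I. \<Sum>j\<in>?I. (if i = j then p * q else 0) + q\<^sup>2 * (?c i j + e))"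
  proof (intro sum_mono)
    fix i j
    have e0: "e \<ge> 0" using d[of J] by linarith
    show "expectation (?DD i j) - (p * q)\<^sup>2 \<le> (if i = j then p * q else 0) + q\<^sup>2 * (?c i j + e)"
    proof (cases "i = j")
      case True
      have "expectation (?DD i i) = expectation (?D i)"
        by (intro bochner_cong) (auto simp: indicator_def)
      then have "expectation (?DD i j) = p * q" using True by (simp add: D1)
      then have "expectation (?DD i j) - (p * q)\<^sup>2 \<le> p * q" using zero_le_power2[of "p * q"] by linarith
      moreover have "0 \<le> q\<^sup>2 * (?c i j + e)" using e0 by simp
      ultimately have "expectation (?DD i j) - (p * q)\<^sup>2 \<le> p * q + q\<^sup>2 * (?c i j + e)"
        by linarith
      then show ?thesis unfolding if_P[OF True] .
    next
      case False
      have Pij: "P i j = P 0 (int (nat \<bar>j - i\<bar>))"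
        using P_shift[of i j] P_shift[of j i] P_sym[of i j] by (cases "j \<ge> i") simp_all
      have "P i j - p\<^sup>2 \<le> ?c i j + e"
      proof (cases "\<bar>j - i\<bar> < int J")
        case True
        have "P i j \<le> 1" by (simp add: P_def)
        then have "P i j - p\<^sup>2 \<le> 1 + e" using e0 zero_le_power2[of p] by linarith
        then show ?thesis unfolding if_P[OF True] .
      next
        case False
        then have "J \<le> nat \<bar>j - i\<bar>" by simp
        from d[OF this] have "P 0 (int (nat \<bar>j - i\<bar>)) - p\<^sup>2 \<le> e" unfolding P_def p_def by linarith
        then show ?thesis using False Pij by simp
      qed
      then have "q\<^sup>2 * (P i j - p\<^sup>2) \<le> q\<^sup>2 * (?c i j + e)"
        by (rule mult_left_mono) simp
      moreover have "expectation (?DD i j) - (p * q)\<^sup>2 = q\<^sup>2 * (P i j - p\<^sup>2)"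
        unfolding D2[OF False] by (simp add: algebra_simps power_mult_distrib)
      ultimately show ?thesis unfolding if_not_P[OF False] by simp
    qed
  qed
  also have "\<dots> \<le> (\<Sum>i\<in>?I. p * q + q\<^sup>2 * (2 * real J + real n * e))"
  proof (rule sum_mono)
    fix i assume i: "i \<in> ?I"
    have "(\<Sum>j\<in>?I. ?c i j) = real (card {j\<in>?I. \<bar>j - i\<bar> < int J})"
      by (subst sum.If_cases) (simp_all add: Int_def)
    also have "card {j\<in>?I. \<bar>j - i\<bar> < int J} \<le> card {i - int J..<i + int J}"
      by (rule card_mono) auto
    finally have c: "(\<Sum>j\<in>?I. ?c i j) \<le> 2 * real J" by simp
    have "(\<Sum>j\<in>?I. (if i = j then p * q else 0) + q\<^sup>2 * (?c i j + e)) =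
       p * q + q\<^sup>2 * ((\<Sum>j\<in>?I. ?c i j) + real n * e)"
      using i by (simp add: sum.distrib sum_distrib_left[symmetric])
    also have "\<dots> \<le> p * q + q\<^sup>2 * (2 * real J + real n * e)"
      using c by (intro add_left_mono mult_left_mono) auto
    finally show "(\<Sum>j\<in>?I. (if i = j then p * q else 0) + q\<^sup>2 * (?c i j + e)) \<le> p * q + q\<^sup>2 * (2 * real J + real n * e)" .
  qed
  also have "\<dots> = ?bound"
    by (simp add: algebra_simps)
  finally show "variance N \<le> ?bound" .
qed

text \<open>Chebyshev's inequality. The diagonal contributes the reciprocal of the expected count and the short lags
  a term of order \<open>J / n\<close>; both vanish, however slowly the correlations decay.\<close>

lemma count_lower_bound:
  assumes stat: "stationary_process M X"
    and A[measurable]: "A \<in> sets borel" and p: "prob {\<omega>\<in>space M. X 0 \<omega> \<in> A} > 0"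
    and mix: "(\<lambda>j. prob {\<omega>\<in>space M. X 0 \<omega> \<in> A \<and> X (int j) \<omega> \<in> A}) \<longlonglongrightarrow> (prob {\<omega>\<in>space M. X 0 \<omega> \<in> A})\<^sup>2"
    and q: "filterlim (\<lambda>n. real n * measure \<nu> {a n<..}) at_top sequentially"
  shows "(\<lambda>n. prob {\<omega>\<in>space M. real (card {i\<in>{1..int n}. X i \<omega> \<in> A \<and> a n < Z i \<omega>})
      \<le> real n * measure \<nu> {a n<..} * (prob {\<omega>\<in>space M. X 0 \<omega> \<in> A} / 2)}) \<longlonglongrightarrow> 0" (is "?P \<longlonglongrightarrow> 0")
proof (rule order_tendstoI)
  fix \<delta> :: real assume \<delta>: "0 < \<delta>"
  define p where "p = prob {\<omega>\<in>space M. X 0 \<omega> \<in> A}"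
  have p0: "p > 0" using p by (simp add: p_def)
  define e where "e = \<delta> * p\<^sup>2 / 16"
  let ?T = "\<lambda>n \<omega>. {i\<in>{1..int n}. X i \<omega> \<in> A \<and> a n < Z i \<omega>}"
  have e: "e > 0" using \<delta> p0 by (simp add: e_def)
  have "\<forall>\<^sub>F j in sequentially. \<bar>prob {\<omega>\<in>space M. X 0 \<omega> \<in> A \<and> X (int j) \<omega> \<in> A} - p\<^sup>2\<bar> < e"
    using tendstoD[OF mix e] by (simp add: dist_real_def p_def)
  then obtain J where J: "\<And>j. j \<ge> J \<Longrightarrow> \<bar>prob {\<omega>\<in>space M. X 0 \<omega> \<in> A \<and> X (int j) \<omega> \<in> A} - p\<^sup>2\<bar> < e"
    unfolding eventually_sequentially by blast
  have "\<forall>\<^sub>F n in sequentially. real n * measure \<nu> {a n<..} > 16 / (\<delta> * p)"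
    using q by (simp add: filterlim_at_top_dense)
  moreover have "\<forall>\<^sub>F n in sequentially. real n > 32 * real J / (\<delta> * p\<^sup>2)"
    using filterlim_real_sequentially by (simp add: filterlim_at_top_dense)
  ultimately show "\<forall>\<^sub>F n in sequentially. ?P n < \<delta>"
    using eventually_gt_at_top[of 0]
  proof eventually_elim
    case (elim n)
    define q where "q = measure \<nu> {a n<..}"
    define N where "N = (\<lambda>\<omega>. \<Sum>i\<in>{1..int n}. indicator A (X i \<omega>) * indicator {a n<..} (Z i \<omega>) :: real)"
    have nq: "real n * q > 16 / (\<delta> * p)" using elim by (simp add: q_def)
    then have nq0: "real n * q > 0" using \<delta> p0 by (smt (verit) divide_pos_pos mult_pos_pos)
    then have q0: "q > 0" using elim by (simp add: zero_less_mult_iff)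
    have [measurable]: "N \<in> borel_measurable M" unfolding N_def by measurable
    have "integrable M (\<lambda>\<omega>. (N \<omega>)\<^sup>2)"
    proof (rule integrable_const_bound[of _ "(real n)\<^sup>2"])
      show "AE \<omega> in M. norm ((N \<omega>)\<^sup>2) \<le> (real n)\<^sup>2"
      proof (rule AE_I2)
        fix \<omega>
        have "N \<omega> \<le> (\<Sum>i\<in>{1..int n}. 1)" unfolding N_def by (rule sum_mono) (simp add: indicator_def)
        moreover have "0 \<le> N \<omega>" unfolding N_def by (rule sum_nonneg) simp
        ultimately show "norm ((N \<omega>)\<^sup>2) \<le> (real n)\<^sup>2" by (simp add: power_mono)
      qed
    qed simp
    note cheb = Chebyshev_inequality[OF _ this, of "real n * (p * q) / 2"]
    have var: "expectation N = real n * (p * q)"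
      "variance N \<le> real n * (p * q) + q\<^sup>2 * real n * (2 * real J + real n * e)"
      unfolding N_def p_def q_def
      by (rule variance_count[OF stat A _ less_imp_le[OF J[unfolded p_def]]]; simp)+
    have "?P n \<le> prob {\<omega>\<in>space M. \<bar>N \<omega> - expectation N\<bar> \<ge> real n * (p * q) / 2}"
    proof (rule finite_measure_mono)
      show "{\<omega>\<in>space M. real (card (?T n \<omega>)) \<le> real n * measure \<nu> {a n<..} * (prob {\<omega>\<in>space M. X 0 \<omega> \<in> A} / 2)}
        \<subseteq> {\<omega>\<in>space M. \<bar>N \<omega> - expectation N\<bar> \<ge> real n * (p * q) / 2}"
      proof safe
        fix \<omega> assume *: "real (card (?T n \<omega>)) \<le> real n * measure \<nu> {a n<..} * (prob {\<omega>\<in>space M. X 0 \<omega> \<in> A} / 2)"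
        have "N \<omega> = real (card (?T n \<omega>))" unfolding N_def by (rule card_eq_sum_indicators[symmetric]) simp
        then have "N \<omega> \<le> real n * (p * q) / 2" using * by (simp add: p_def q_def mult_ac)
        then show "real n * (p * q) / 2 \<le> \<bar>N \<omega> - expectation N\<bar>"
          unfolding var(1) by linarith
      qed
    qed simp
    also have "\<dots> \<le> variance N / (real n * (p * q) / 2)\<^sup>2"
      by (rule cheb) (use nq0 p0 elim q0 in auto)
    also have "\<dots> \<le> (real n * (p * q) + q\<^sup>2 * real n * (2 * real J + real n * e)) / (real n * (p * q) / 2)\<^sup>2"
      by (rule divide_right_mono[OF var(2)]) simp_all
    also have "\<dots> = 4 / (real n * q * p) + 8 * real J / (real n * p\<^sup>2) + 4 * e / p\<^sup>2"
      using elim(3) p0 q0 by (simp add: field_simps power2_eq_square)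
    also have "\<dots> < \<delta> / 4 + \<delta> / 4 + \<delta> / 2"
    proof (intro add_strict_mono add_less_le_mono)
      show "4 / (real n * q * p) < \<delta> / 4" using nq nq0 p0 \<delta> by (simp add: field_simps)
      show "8 * real J / (real n * p\<^sup>2) < \<delta> / 4" using elim(2,3) p0 \<delta> by (simp add: field_simps)
      show "4 * e / p\<^sup>2 < \<delta> / 2" using p0 \<delta> by (simp add: e_def)
    qed
    finally show ?case by simp
  qed
next
  fix \<delta> :: real assume "\<delta> < 0"
  then show "\<forall>\<^sub>F n in sequentially. \<delta> < ?P n"
    by (intro always_eventually allI less_le_trans[OF _ measure_nonneg])
qed

end

section \<open>Exponential excesses and their central limit theorem\<close>

lemma char_exponential:
  "(CLINT x|lborel. exponential_density 1 x *\<^sub>R iexp (\<theta> * x)) = 1 / (1 - \<i> * \<theta>)"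
proof -
  define c where "c = 1 - \<i> * complex_of_real \<theta>"
  have c: "c \<noteq> 0" "Re c = 1" by (auto simp: c_def complex_eq_iff)
  have ex: "exp (- c * x) = exp (- x) *\<^sub>R iexp (\<theta> * x)" for x :: real
  proof -
    have "- c * x = complex_of_real (- x) + \<i> * complex_of_real (\<theta> * x)" by (simp add: c_def algebra_simps)
    then have "exp (- c * x) = exp (complex_of_real (- x)) * iexp (\<theta> * x)" by (simp only: exp_add)
    then show ?thesis by (simp only: exp_of_real scaleR_conv_of_real)
  qed
  interpret P: prob_space "density lborel (exponential_density 1)"
    by (rule prob_space_exponential_density) simp
  have int: "integrable lborel (exponential_density 1)"
    using integrable_density[of "\<lambda>_. 1::real" lborel "exponential_density 1"] P.integrable_const[of "1::real"]
    by (simp add: exponential_density_nonneg)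
  have "set_integrable lborel (einterval 0 \<infinity>) (\<lambda>x. exp (- c * x))"
    unfolding set_integrable_def
    by (rule Bochner_Integration.integrable_bound[OF int]) (auto simp: ex c(2) exponential_density_def indicator_def einterval_def zero_ereal_def)
  then have "(LBINT x=0..\<infinity>. exp (- c * x)) = 0 - (- 1 / c)"
  proof (rule interval_integral_FTC_integrable[where F = "\<lambda>x. - exp (- c * x) / c", rotated 3])
    have "((\<lambda>x. - exp (- c * complex_of_real x) / c) \<longlongrightarrow> - exp (- c * complex_of_real 0) / c) (at_right 0)"
      by (intro tendsto_intros c)
    then show "(((\<lambda>x. - exp (- c * complex_of_real x) / c) \<circ> real_of_ereal) \<longlongrightarrow> - 1 / c) (at_right 0)"
      by (simp add: ereal_tendsto_simps zero_ereal_def)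
    have "((\<lambda>x. norm (exp (- c * complex_of_real x))) \<longlongrightarrow> 0) at_top"
    proof -
      have "((\<lambda>x::real. exp (- x)) \<longlongrightarrow> 0) at_top"
        by (intro filterlim_compose[OF exp_at_bot] filterlim_uminus_at_bot_at_top)
      then show ?thesis by (simp add: ex c(2))
    qed
    then have "((\<lambda>x. exp (- c * complex_of_real x)) \<longlongrightarrow> 0) at_top" by (rule tendsto_norm_zero_cancel)
    then have "((\<lambda>x. - exp (- c * complex_of_real x) / c) \<longlongrightarrow> - 0 / c) at_top" by (intro tendsto_intros c)
    then show "(((\<lambda>x. - exp (- c * complex_of_real x) / c) \<circ> real_of_ereal) \<longlongrightarrow> 0) (at_left \<infinity>)"
      by (simp add: ereal_tendsto_simps)
    show "((\<lambda>x. - exp (- c * complex_of_real x) / c) has_vector_derivative exp (- c * complex_of_real x)) (at x)" for x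
      using c by (auto intro!: derivative_eq_intros has_vector_derivative_real_field simp: field_simps)
  qed (auto intro!: continuous_intros)
  then have "(CLINT x|lborel. indicator {0<..} x *\<^sub>R exp (- c * complex_of_real x)) = 1 / c"
    by (simp add: interval_lebesgue_integral_def set_lebesgue_integral_def einterval_def greaterThan_def zero_ereal_def)
  moreover have "(CLINT x|lborel. exponential_density 1 x *\<^sub>R iexp (\<theta> * x)) = (CLINT x|lborel. indicator {0<..} x *\<^sub>R exp (- c * complex_of_real x))"
  proof (rule integral_cong_AE)
    show "AE x in lborel. exponential_density 1 x *\<^sub>R iexp (\<theta> * x) = indicator {0<..} x *\<^sub>R exp (- c * complex_of_real x)"
      using AE_lborel_singleton[of 0]
    proof eventually_elim
      case (elim x)
      then show ?case unfolding ex by (auto simp: exponential_density_def indicator_def)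
    qed
  qed measurable
  ultimately show ?thesis by (simp add: c_def)
qed

text \<open>The \<open>k\<close>-th power of the characteristic function of a centred exponential variable, rescaled by \<open>sqrt k\<close>. The
  base differs from \<open>1 - \<theta>\<^sup>2 / (2 k)\<close> by \<open>O(k powr (- 3 / 2))\<close>, and both bases have modulus at most 1, so that taking
  \<open>k\<close>-th powers multiplies the difference by at most \<open>k\<close>.\<close>

lemma exponential_clt_limit:
  fixes \<theta> :: real
  shows "(\<lambda>k. (iexp (- (\<theta> / sqrt k)) / (1 - \<i> * complex_of_real (\<theta> / sqrt k))) ^ k) \<longlonglongrightarrow> complex_of_real (exp (- (\<theta>\<^sup>2 / 2)))"
proof -
  define x where "x k = \<theta> / sqrt (real k)" for k :: nat
  let ?a = "\<lambda>k. iexp (- x k) / (1 - \<i> * complex_of_real (x k))"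
  let ?b = "\<lambda>k. complex_of_real (1 + (- (\<theta>\<^sup>2 / 2)) / real k)"
  have b_lim: "(\<lambda>k. ?b k ^ k) \<longlonglongrightarrow> complex_of_real (exp (- (\<theta>\<^sup>2 / 2)))"
    using tendsto_of_real[OF tendsto_exp_limit_sequentially[of "- (\<theta>\<^sup>2 / 2)"], where 'a = complex] by (simp only: of_real_power)
  have den: "1 \<le> cmod (1 - \<i> * complex_of_real y)" for y
    using abs_Re_le_cmod[of "1 - \<i> * complex_of_real y"] by simp
  have diff: "cmod (iexp (- y) / (1 - \<i> * complex_of_real y) - complex_of_real (1 - y\<^sup>2 / 2)) \<le> \<bar>y\<bar> ^ 3" for y
  proof -
    let ?c = "1 - \<i> * complex_of_real y"
    have c0: "?c \<noteq> 0" using den[of y] by auto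
    have "cmod (iexp (- y) - (\<Sum>k \<le> 2. (\<i> * (- y)) ^ k / fact k)) \<le> \<bar>- y\<bar> ^ Suc 2 / fact (Suc 2)"
      by (rule iexp_approx1)
    also have "(\<Sum>k \<le> 2. (\<i> * (- y)) ^ k / fact k) = 1 - \<i> * y - (complex_of_real y)\<^sup>2 / 2"
      by (simp add: numeral_2_eq_2 power2_eq_square complex_eq_iff)
    finally have t: "cmod (iexp (- y) - (1 - \<i> * y - (complex_of_real y)\<^sup>2 / 2)) \<le> \<bar>y\<bar> ^ 3 / 6"
      by (simp add: fact_numeral numeral_3_eq_3)
    have E: "iexp (- y) - ?c * complex_of_real (1 - y\<^sup>2 / 2) =
       (iexp (- y) - (1 - \<i> * y - (complex_of_real y)\<^sup>2 / 2)) - \<i> * complex_of_real (y ^ 3 / 2)"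
    proof -
      have "(1 - \<i> * w) * (1 - w\<^sup>2 / 2) = (1 - \<i> * w - w\<^sup>2 / 2) + \<i> * (w ^ 3 / 2)" for w :: complex
        by (simp add: field_simps power3_eq_cube power2_eq_square)
      from this[of "complex_of_real y"] show ?thesis by simp
    qed
    have "cmod (iexp (- y) - ?c * complex_of_real (1 - y\<^sup>2 / 2)) \<le> \<bar>y\<bar> ^ 3 / 6 + cmod (\<i> * complex_of_real (y ^ 3 / 2))"
      unfolding E by (rule order_trans[OF norm_triangle_ineq4 add_right_mono[OF t]])
    also have "cmod (\<i> * complex_of_real (y ^ 3 / 2)) = \<bar>y\<bar> ^ 3 / 2"
      by (simp add: norm_mult norm_divide norm_power power_abs)
    also have "\<bar>y\<bar> ^ 3 / 6 + \<bar>y\<bar> ^ 3 / 2 \<le> \<bar>y\<bar> ^ 3" using zero_le_power_abs[of y 3] by linarith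
    finally have n: "cmod (iexp (- y) - ?c * complex_of_real (1 - y\<^sup>2 / 2)) \<le> \<bar>y\<bar> ^ 3" .
    have "iexp (- y) / ?c - complex_of_real (1 - y\<^sup>2 / 2) = (iexp (- y) - ?c * complex_of_real (1 - y\<^sup>2 / 2)) / ?c"
      using c0 by (simp only: diff_divide_distrib nonzero_mult_div_cancel_left) simp
    then have "cmod (iexp (- y) / ?c - complex_of_real (1 - y\<^sup>2 / 2)) = cmod (iexp (- y) - ?c * complex_of_real (1 - y\<^sup>2 / 2)) / cmod ?c"
      by (simp only: norm_divide)
    also have "\<dots> \<le> cmod (iexp (- y) - ?c * complex_of_real (1 - y\<^sup>2 / 2)) / 1"
      by (rule divide_left_mono) (use den[of y] in auto)
    finally show ?thesis using n by simp
  qed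
  have "(\<lambda>k. ?a k ^ k - ?b k ^ k) \<longlonglongrightarrow> 0"
  proof (rule Lim_null_comparison)
    show "(\<lambda>k. \<bar>\<theta>\<bar> ^ 3 / sqrt (real k)) \<longlonglongrightarrow> 0"
      by (rule tendsto_divide_0[OF tendsto_const])
         (intro filterlim_at_top_imp_at_infinity filterlim_compose[OF sqrt_at_top] filterlim_real_sequentially)
    have "\<forall>\<^sub>F k in sequentially. real k \<ge> \<theta>\<^sup>2"
      using filterlim_real_sequentially by (simp add: filterlim_at_top)
    then show "\<forall>\<^sub>F k in sequentially. norm (?a k ^ k - ?b k ^ k) \<le> \<bar>\<theta>\<bar> ^ 3 / sqrt (real k)"
      using eventually_gt_at_top[of 0]
    proof eventually_elim
      case (elim k)
      have x2: "(x k)\<^sup>2 = \<theta>\<^sup>2 / real k" by (simp add: x_def power_divide)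
      have b_eq: "?b k = complex_of_real (1 - (x k)\<^sup>2 / 2)" by (simp add: x2)
      have "norm (?a k) = 1 / cmod (1 - \<i> * complex_of_real (x k))" by (simp only: norm_divide norm_exp_i_times)
      also have "\<dots> \<le> 1" using den[of "x k"] by (simp add: divide_le_eq)
      finally have na: "norm (?a k) \<le> 1" .
      have "0 \<le> \<theta>\<^sup>2 / real k" "\<theta>\<^sup>2 / real k \<le> 1" using elim by simp_all
      moreover have "\<bar>1 - z / 2\<bar> \<le> 1" if "0 \<le> z" "z \<le> 1" for z :: real using that by linarith
      ultimately have "\<bar>1 - (x k)\<^sup>2 / 2\<bar> \<le> 1" unfolding x2 by blast
      then have nb: "norm (?b k) \<le> 1" unfolding b_eq norm_of_real .
      have "norm (?a k ^ k - ?b k ^ k) \<le> real k * norm (?a k - ?b k)"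
        by (rule norm_power_diff[OF na nb])
      also have "\<dots> \<le> real k * \<bar>x k\<bar> ^ 3" unfolding b_eq by (intro mult_left_mono diff) simp
      also have "\<dots> = \<bar>\<theta>\<bar> ^ 3 / sqrt (real k)"
      proof -
        have "real k = sqrt k * sqrt k" by simp
        then show ?thesis using elim(2) by (simp add: x_def power3_eq_cube field_simps del: real_sqrt_mult_self)
      qed
      finally show ?case .
    qed
  qed
  from tendsto_add[OF this b_lim] show ?thesis by (simp add: x_def)
qed

locale continuous_tail = prob_space \<nu> for \<nu> :: "real measure" +
  fixes S :: "real \<Rightarrow> real"
  assumes sets_eq[measurable_cong]: "sets \<nu> = sets borel"
    and S_def: "S z = measure \<nu> {z<..}"
    and S_cont: "continuous_on {0<..} S"
    and S_pos: "z > 0 \<Longrightarrow> S z > 0"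
begin

lemma space_eq[simp]: "space \<nu> = UNIV" using sets_eq_imp_space_eq[OF sets_eq] by simp

lemma S_antimono: "x \<le> y \<Longrightarrow> S y \<le> S x"
  unfolding S_def by (rule finite_measure_mono) auto

lemma S_measurable[measurable]: "S \<in> borel_measurable borel"
proof -
  have "mono (\<lambda>x. - S x)" by (auto simp: mono_def S_antimono)
  from borel_measurable_uminus[OF borel_measurable_mono[OF this]] show ?thesis by simp
qed

sublocale fbm: finite_borel_measure \<nu>
  by unfold_locales (simp add: sets_eq)

lemma cdf_eq: "cdf \<nu> x = 1 - S x"
proof -
  have "S x = measure \<nu> (space \<nu> - {..x})" unfolding S_def by (rule arg_cong[where f = "measure \<nu>"]) auto
  also have "\<dots> = 1 - measure \<nu> {..x}" by (rule prob_compl) (simp add: sets_eq)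
  finally show ?thesis by (simp add: cdf_def)
qed

lemma S_at_top: "(S \<longlongrightarrow> 0) at_top"
proof -
  interpret real_distribution \<nu> by unfold_locales (simp_all add: sets_eq)
  have "((\<lambda>x. 1 - cdf \<nu> x) \<longlongrightarrow> 1 - 1) at_top" by (intro tendsto_intros cdf_lim_at_top_prob)
  then show ?thesis by (simp add: cdf_eq)
qed

lemma measure_singleton_eq_0: assumes "c > 0" shows "measure \<nu> {c} = 0"
proof -
  have "isCont S c" using S_cont assms by (simp add: continuous_on_eq_continuous_at)
  then have "isCont (cdf \<nu>) c" unfolding cdf_eq[abs_def] by (intro continuous_intros)
  then show ?thesis by (simp add: fbm.isCont_cdf)
qed

text \<open>By continuity \<open>S(Z)\<close> is uniformly distributed below \<open>S v\<close> given \<open>Z > v\<close>, so that \<open>- ln (S(Z) / S v)\<close> is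
  standard exponential. Flat pieces of the tail function carry no mass.\<close>

lemma exponential_excess:
  assumes v: "v > 0"
  shows "(CLINT t|\<nu>. indicator {v<..} t * iexp (\<theta> * (- ln (S t / S v)))) = 1 / (1 - \<i> * \<theta>) * S v"
proof -
  let ?X = "\<lambda>t. - ln (S t / S v)"
  have Sv: "S v > 0" using S_pos v .
  define Q where "Q = uniform_measure \<nu> {v<..}"
  have em: "emeasure \<nu> {v<..} \<noteq> 0" "emeasure \<nu> {v<..} \<noteq> \<infinity>"
    using Sv by (auto simp: emeasure_eq_measure S_def)
  interpret Q: prob_space Q unfolding Q_def by (rule prob_space_uniform_measure[OF em])
  have [measurable_cong]: "sets Q = sets borel" unfolding Q_def by (simp add: sets_eq)
  have "distributed Q lborel ?X (exponential_density 1)"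
    unfolding Q.exponential_distributed_iff[OF zero_less_one]
  proof (intro conjI allI impI)
    show "?X \<in> borel_measurable Q" by measurable
    fix a :: real assume a: "0 \<le> a"
    define r where "r = S v * exp (- a)"
    have r: "0 < r" "r \<le> S v" using Sv a by (auto simp: r_def mult_le_cancel_left1)
    have "\<forall>\<^sub>F x in at_top. S x < r" using order_tendstoD(2)[OF S_at_top r(1)] .
    then obtain b0 where b0: "\<And>x. x \<ge> b0 \<Longrightarrow> S x < r" unfolding eventually_at_top_linorder by blast
    define b where "b = max b0 v"
    have b: "v \<le> b" "S b < r" using b0 by (auto simp: b_def)
    \<comment> \<open>The event \<open>- ln (S t / S v) \<le> a\<close> is \<open>t \<le> w\<close> for the last point \<open>w\<close> at which \<open>S\<close> is at least \<open>r\<close>;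
       by continuity \<open>S w = r\<close>.\<close>
    define C where "C = {v..b} \<inter> S -` {r..}"
    have contC: "continuous_on {v..b} S" using S_cont by (rule continuous_on_subset) (use v in auto)
    have "closed C" unfolding C_def by (rule continuous_closed_preimage[OF contC]) auto
    moreover have "v \<in> C" using r b by (auto simp: C_def)
    moreover have bdd: "bdd_above C" by (auto simp: C_def)
    ultimately have wC: "Sup C \<in> C" using closed_contains_Sup by blast
    define w where "w = Sup C"
    have w: "v \<le> w" "w \<le> b" "r \<le> S w" using wC by (auto simp: w_def C_def)
    have above: "S z < r" if "w < z" for z
    proof (rule ccontr)
      assume "\<not> S z < r"
      moreover from this have "z < b" using b S_antimono[of b z] by (meson not_le order_le_less_trans)
      ultimately have "z \<in> C" using that w by (simp add: C_def not_less)
      then have "z \<le> w" unfolding w_def using bdd by (rule cSup_upper)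
      with that show False by simp
    qed
    have Sw: "S w = r"
    proof (rule antisym)
      have "w > 0" using w v by simp
      then have "(S \<longlongrightarrow> S w) (at_right w)"
        using S_cont by (auto simp: continuous_on_eq_continuous_at isCont_def intro: tendsto_within_subset)
      moreover have "\<forall>\<^sub>F z in at_right w. S z \<le> r"
        using above by (auto simp: eventually_at_right_field intro!: exI[of _ "w + 1"] less_imp_le)
      ultimately show "S w \<le> r" by (rule tendsto_upperbound) simp
    qed (rule w)
    have eq: "{v<..} \<inter> {t. ?X t \<le> a} = {v<..} - {w<..}"
    proof (intro set_eqI iffI)
      fix t
      have key: "?X t \<le> a \<longleftrightarrow> r \<le> S t" if "v < t"
      proof -
        have "S t > 0" using S_pos that v by simp
        then have "?X t \<le> a \<longleftrightarrow> exp (- a) \<le> S t / S v" using Sv by (subst ln_ge_iff[symmetric]) auto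
        then show ?thesis using Sv by (simp add: r_def field_simps)
      qed
      show "t \<in> {v<..} - {w<..}" if "t \<in> {v<..} \<inter> {t. ?X t \<le> a}"
        using that key above[of t] by force
      show "t \<in> {v<..} \<inter> {t. ?X t \<le> a}" if "t \<in> {v<..} - {w<..}"
        using that key w S_antimono[of t w] by auto
    qed
    have "Q.prob {t \<in> space Q. ?X t \<le> a} = measure \<nu> ({v<..} \<inter> {t. ?X t \<le> a}) / measure \<nu> {v<..}"
      unfolding Q_def by (subst measure_uniform_measure[OF em]) (auto simp: sets_eq)
    also have "\<dots> = (S v - S w) / S v"
      unfolding eq S_def[symmetric] using w
      by (subst finite_measure_Diff) (auto simp: sets_eq S_def)
    also have "\<dots> = 1 - exp (- a * 1)" using Sv by (simp add: Sw r_def diff_divide_distrib)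
    finally show "Q.prob {t \<in> space Q. ?X t \<le> a} = 1 - exp (- a * 1)" .
  qed
  then have law: "distr Q lborel ?X = density lborel (exponential_density 1)"
    by (rule distributed_distr_eq_density)
  have "(CLINT t|\<nu>. indicator {v<..} t * iexp (\<theta> * ?X t)) = S v * (CLINT t|Q. iexp (\<theta> * ?X t))"
  proof -
    have "(CLINT t|Q. iexp (\<theta> * ?X t)) = (CLINT t|\<nu>. (indicator {v<..} t / S v) *\<^sub>R iexp (\<theta> * ?X t))"
    proof -
      have "Q = density \<nu> (\<lambda>t. ennreal (indicator {v<..} t / S v))"
        unfolding Q_def uniform_measure_def
        by (intro arg_cong2[where f = density] refl ext)
           (auto simp: indicator_def emeasure_eq_measure S_def[symmetric] divide_ennreal[OF _ Sv, symmetric] Sv)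
      then show ?thesis using Sv
        by (simp only:) (subst integral_density, auto)
    qed
    also have "\<dots> = (CLINT t|\<nu>. (indicator {v<..} t * iexp (\<theta> * ?X t)) / S v)"
      by (intro bochner_cong) (auto simp: indicator_def scaleR_conv_of_real)
    finally show ?thesis using Sv by simp
  qed
  also have "(CLINT t|Q. iexp (\<theta> * ?X t)) = (CLINT x|distr Q lborel ?X. iexp (\<theta> * x))"
    by (subst integral_distr) auto
  also have "\<dots> = (CLINT x|lborel. exponential_density 1 x *\<^sub>R iexp (\<theta> * x))"
    unfolding law by (subst integral_density) (auto simp: exponential_density_nonneg)
  also have "\<dots> = 1 / (1 - \<i> * \<theta>)" by (rule char_exponential)
  finally show ?thesis by (simp only: mult.commute)
qed

end

section \<open>Excesses over a random threshold\<close>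

context sv_model begin

definition S where "S z = measure \<nu> {z<..}"

lemma S_upper_tail: "S = upper_tail M (Z 1)"
  by (rule ext) (simp add: S_def \<nu>_def upper_tail_def measure_distr vimage_def Int_def conj_commute)

definition obs :: "(int \<Rightarrow> real) \<times> (int \<Rightarrow> real) \<Rightarrow> int \<Rightarrow> real" where
  "obs w i = \<sigma> (fst w i) * snd w i"

definition XZ :: "'a \<Rightarrow> (int \<Rightarrow> real) \<times> (int \<Rightarrow> real)" where
  "XZ \<omega> = (\<lambda>j. X j \<omega>, \<lambda>j. Z j \<omega>)"

lemma obs_measurable[measurable]: "(\<lambda>w. obs w i) \<in> borel_measurable (E \<Otimes>\<^sub>M E)"
  unfolding obs_def by measurable

lemma XZ_meas[measurable]: "XZ \<in> measurable M (E \<Otimes>\<^sub>M E)"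
  unfolding XZ_def by (rule measurable_Pair; rule XZ_measurable)

lemma obs_XZ_measurable[measurable]: "(\<lambda>\<omega>. obs (XZ \<omega>) i) \<in> borel_measurable M"
  by (rule measurable_compose[OF XZ_meas obs_measurable])

lemma obs_XZ: "obs (XZ \<omega>) i = \<sigma> (X i \<omega>) * Z i \<omega>"
  by (simp add: obs_def XZ_def)

end

locale sv_tail = sv_model +
  assumes S_cont: "continuous_on {0<..} S" and S_pos: "\<And>z. z > 0 \<Longrightarrow> S z > 0"
begin

sublocale tail: continuous_tail \<nu> S
proof unfold_locales
  show "sets \<nu> = sets borel" by (rule sets_\<nu>)
  show "S z = measure \<nu> {z<..}" for z by (rule S_def)
  show "continuous_on {0<..} S" by (rule S_cont)
  show "0 < S z" if "0 < z" for z using that by (rule S_pos)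
qed

text \<open>Stated for a pair of sequences \<open>w = (x, z)\<close> and not for a sample point, so that a single coordinate of \<open>z\<close>
  can be resampled.\<close>

definition exceed :: "real \<Rightarrow> int set \<Rightarrow> int \<Rightarrow> int set \<Rightarrow> (int \<Rightarrow> real) \<times> (int \<Rightarrow> real) \<Rightarrow> bool" where
  "exceed v I p A w \<longleftrightarrow> v \<le> obs w p \<and> top_block I (obs w) p A"

text \<open>For \<open>i\<close> above the threshold, this is the exponential variable of \<open>exponential_excess\<close> at the level
  that \<open>Z\<^sub>i\<close> has to exceed.\<close>

definition excess :: "int \<Rightarrow> (int \<Rightarrow> real) \<times> (int \<Rightarrow> real) \<Rightarrow> int \<Rightarrow> real" where
  "excess p w i = - ln (S (snd w i) / S (obs w p / \<sigma> (fst w i)))"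

lemma exceed_measurable[measurable]:
  assumes "finite I" "A \<subseteq> I"
  shows "Measurable.pred (E \<Otimes>\<^sub>M E) (exceed v I p A)"
proof -
  have [simp]: "finite A" using assms finite_subset by blast
  show ?thesis unfolding exceed_def top_block_def using assms(1) by measurable
qed

lemma excess_measurable[measurable]: "(\<lambda>w. excess p w i) \<in> borel_measurable (E \<Otimes>\<^sub>M E)"
  unfolding excess_def by measurable

lemma norm_prod_iexp: "cmod (\<Prod>i\<in>B. iexp (f i)) = 1"
  by (simp add: prod_norm[symmetric])

text \<open>Integrating out \<open>Z\<^sub>b\<close> alone: the threshold and all other observations do not involve it, so that it is
  constrained only by \<open>Z\<^sub>b > y / \<sigma>(X\<^sub>b)\<close>, and its excess contributes the exponential characteristic function.\<close>

lemma integral_excess_step: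
  fixes \<theta> :: real
  assumes I: "finite I" "A \<subseteq> I - {p}" "b \<in> A" "B \<subseteq> A" "b \<notin> B" and v: "v > 0"
  defines "f \<equiv> \<lambda>B w. if exceed v I p A w then \<Prod>i\<in>B. iexp (\<theta> * excess p w i) else 0"
  shows "(CLINT t|\<nu>. f (insert b B) (x, z(b := t))) = 1 / (1 - \<i> * \<theta>) * (CLINT t|\<nu>. f B (x, z(b := t)))"
proof -
  have fin: "finite A" "finite B" using I by (meson finite_subset Diff_subset)+
  have bp: "b \<noteq> p" using I by auto
  define y where "y = \<sigma> (x p) * z p"
  define rest where "rest \<longleftrightarrow> v \<le> y \<and> (\<forall>i\<in>A - {b}. y < \<sigma> (x i) * z i) \<and> (\<forall>j\<in>I - insert p A. \<sigma> (x j) * z j < y)"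
  have ex: "exceed v I p A (x, z(b := t)) \<longleftrightarrow> rest \<and> y < \<sigma> (x b) * t" for t
  proof -
    have 1: "(\<forall>i\<in>A. y < \<sigma> (x i) * (z(b := t)) i) \<longleftrightarrow> (\<forall>i\<in>A - {b}. y < \<sigma> (x i) * z i) \<and> y < \<sigma> (x b) * t"
      using I(3) by auto
    have 2: "(\<forall>j\<in>I - insert p A. \<sigma> (x j) * (z(b := t)) j < y) \<longleftrightarrow> (\<forall>j\<in>I - insert p A. \<sigma> (x j) * z j < y)"
      using I(3) by auto
    show ?thesis unfolding exceed_def top_block_def obs_def rest_def fst_conv snd_conv using 1 2 bp
      by (auto simp: y_def)
  qed
  have exc_b: "excess p (x, z(b := t)) b = - ln (S t / S (y / \<sigma> (x b)))" for t
    using bp by (simp add: excess_def obs_def y_def)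
  have exc_i: "excess p (x, z(b := t)) i = excess p (x, z) i" if "i \<in> B" for t i
    using bp I that by (auto simp: excess_def obs_def y_def)
  define c where "c = (\<Prod>i\<in>B. iexp (\<theta> * excess p (x, z) i))"
  show ?thesis
  proof (cases "rest \<and> \<sigma> (x b) \<noteq> 0")
    case True
    then have s: "\<sigma> (x b) > 0" using \<sigma>_nonneg[of "x b"] by simp
    define V where "V = y / \<sigma> (x b)"
    have V: "V > 0" using True v s by (auto simp: rest_def V_def)
    have lt: "y < \<sigma> (x b) * t \<longleftrightarrow> V < t" for t using s by (simp add: V_def field_simps)
    have "f (insert b B) (x, z(b := t)) = c * (indicator {V<..} t * iexp (\<theta> * (- ln (S t / S V))))" for t
      unfolding f_def ex using True I(5) fin by (auto simp: lt exc_b exc_i c_def V_def[symmetric])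
    then have 1: "(CLINT t|\<nu>. f (insert b B) (x, z(b := t))) = c * (1 / (1 - \<i> * \<theta>) * S V)"
      by (simp only: integral_mult_right_zero tail.exponential_excess[OF V])
    have "f B (x, z(b := t)) = c * complex_of_real (indicator {V<..} t)" for t
      unfolding f_def ex using True by (auto simp: lt exc_i c_def)
    then have "(CLINT t|\<nu>. f B (x, z(b := t))) = c * complex_of_real (LINT t|\<nu>. indicator {V<..} t)"
      by (simp only: integral_mult_right_zero integral_complex_of_real)
    also have "(LINT t|\<nu>. indicator {V<..} t) = S V" by (simp add: S_def)
    finally have 2: "(CLINT t|\<nu>. f B (x, z(b := t))) = c * complex_of_real (S V)" .
    show ?thesis unfolding 1 2 by (simp only: mult.left_commute)
  next
    case False
    then have "\<not> exceed v I p A (x, z(b := t))" for t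
      unfolding ex using v by (auto simp: rest_def)
    then show ?thesis unfolding f_def by simp
  qed
qed

text \<open>Given that \<open>p\<close> and \<open>A\<close> describe the largest observations, the excesses are independent standard
  exponential variables. They are integrated out one by one.\<close>

lemma integral_excess_prod:
  assumes I: "finite I" "A \<subseteq> I - {p}" and B: "B \<subseteq> A" and v: "v > 0"
  shows "(CLINT \<omega>|M. (if exceed v I p A (XZ \<omega>) then \<Prod>i\<in>B. iexp (\<theta> * excess p (XZ \<omega>) i) else 0)) =
    (1 / (1 - \<i> * \<theta>)) ^ card B * prob {\<omega>\<in>space M. exceed v I p A (XZ \<omega>)}"
proof -
  have fA: "finite A" using I by (meson finite_subset Diff_subset)
  then have "finite B" using B finite_subset by blast
  then show ?thesis using B
  proof (induction B)
    case empty
    have "(CLINT \<omega>|M. (if exceed v I p A (XZ \<omega>) then \<Prod>i\<in>{}. iexp (\<theta> * excess p (XZ \<omega>) i) else 0)) =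
      (CLINT \<omega>|M. complex_of_real (indicator {\<omega>\<in>space M. exceed v I p A (XZ \<omega>)} \<omega>))"
      by (intro bochner_cong) (auto simp: indicator_def)
    moreover have "Measurable.pred M (\<lambda>\<omega>. exceed v I p A (XZ \<omega>))"
      by (rule measurable_compose[OF XZ_meas exceed_measurable]) (use I in auto)
    ultimately show ?case by simp
  next
    case (insert b B)
    define f where "f B w = (if exceed v I p A w then \<Prod>i\<in>B. iexp (\<theta> * excess p w i) else 0)" for B w
    have f_meas: "f B \<in> borel_measurable (E \<Otimes>\<^sub>M E)" for B
    proof -
      have [measurable]: "Measurable.pred (E \<Otimes>\<^sub>M E) (exceed v I p A)"
        using I by (intro exceed_measurable) auto
      show ?thesis unfolding f_def by measurable
    qed
    have f_bdd: "norm (f B w) \<le> 1" for B w by (simp add: f_def norm_prod_iexp del: of_real_mult)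
    have "(CLINT \<omega>|M. f (insert b B) (XZ \<omega>)) = (CLINT \<omega>|M. (CLINT t|\<nu>. f (insert b B) (\<lambda>j. X j \<omega>, (\<lambda>j. Z j \<omega>)(b := t))))"
      unfolding XZ_def by (rule integral_resample[OF f_meas f_bdd])
    also have "\<dots> = (CLINT \<omega>|M. 1 / (1 - \<i> * \<theta>) * (CLINT t|\<nu>. f B (\<lambda>j. X j \<omega>, (\<lambda>j. Z j \<omega>)(b := t))))"
      unfolding f_def using insert I v by (subst integral_excess_step) auto
    also have "\<dots> = 1 / (1 - \<i> * \<theta>) * (CLINT \<omega>|M. (CLINT t|\<nu>. f B (\<lambda>j. X j \<omega>, (\<lambda>j. Z j \<omega>)(b := t))))"
      by (rule integral_mult_right_zero)
    also have "(CLINT \<omega>|M. (CLINT t|\<nu>. f B (\<lambda>j. X j \<omega>, (\<lambda>j. Z j \<omega>)(b := t)))) = (CLINT \<omega>|M. f B (XZ \<omega>))"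
      unfolding XZ_def by (rule integral_resample[OF f_meas f_bdd, symmetric])
    also have "\<dots> = (1 / (1 - \<i> * \<theta>)) ^ card B * prob {\<omega>\<in>space M. exceed v I p A (XZ \<omega>)}"
      unfolding f_def using insert by simp
    finally show ?case using insert unfolding f_def by simp
  qed
qed

text \<open>Given everything but \<open>Z\<^sub>i\<close>, a tie forces \<open>Z\<^sub>i\<close> to take one particular positive value, and the noise has no atoms
  there.\<close>

lemma prob_ties:
  assumes "finite I"
  shows "prob {\<omega>\<in>space M. \<exists>i\<in>I. \<exists>j\<in>I. i \<noteq> j \<and> obs (XZ \<omega>) i = obs (XZ \<omega>) j \<and> 0 < obs (XZ \<omega>) i} = 0"
proof -
  have 1: "AE \<omega> in M. \<not> (obs (XZ \<omega>) i = obs (XZ \<omega>) j \<and> 0 < obs (XZ \<omega>) i)" if ij: "i \<noteq> j" for i j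
  proof -
    let ?f = "\<lambda>w. indicat_real {w \<in> space (E \<Otimes>\<^sub>M E). obs w i = obs w j \<and> 0 < obs w i} w"
    have sp: "w \<in> space (E \<Otimes>\<^sub>M E)" for w :: "(int \<Rightarrow> real) \<times> (int \<Rightarrow> real)"
      by (simp add: space_pair_measure space_PiM)
    have fm: "?f \<in> borel_measurable (E \<Otimes>\<^sub>M E)" by measurable
    have "(LINT t|\<nu>. ?f (x, z(i := t))) = 0" for x z
    proof (cases "\<sigma> (x i) > 0 \<and> \<sigma> (x j) * z j > 0")
      case True
      let ?c = "\<sigma> (x j) * z j / \<sigma> (x i)"
      have "(LINT t|\<nu>. ?f (x, z(i := t))) = (LINT t|\<nu>. indicator {?c} t)"
        using True ij by (intro bochner_cong refl) (auto simp: indicator_def sp obs_def field_simps)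
      also have "\<dots> = measure \<nu> {?c}" by simp
      also have "\<dots> = 0" by (rule tail.measure_singleton_eq_0) (use True in simp)
      finally show ?thesis .
    next
      case False
      then have "\<not> (\<sigma> (x i) * t = \<sigma> (x j) * z j \<and> 0 < \<sigma> (x i) * t)" for t
        using \<sigma>_nonneg[of "x i"] by (cases "\<sigma> (x i) = 0") auto
      then have "?f (x, z(i := t)) = 0" for t
        using ij by (simp add: indicator_def obs_def)
      then show ?thesis by simp
    qed
    then have "(LINT \<omega>|M. ?f (XZ \<omega>)) = 0"
      unfolding XZ_def by (subst integral_resample[OF fm, of 1 i]) (simp_all add: indicator_le_1)
    moreover have "(LINT \<omega>|M. ?f (XZ \<omega>)) = prob {\<omega>\<in>space M. obs (XZ \<omega>) i = obs (XZ \<omega>) j \<and> 0 < obs (XZ \<omega>) i}"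
    proof -
      have "(LINT \<omega>|M. ?f (XZ \<omega>)) = (LINT \<omega>|M. indicator {\<omega>\<in>space M. obs (XZ \<omega>) i = obs (XZ \<omega>) j \<and> 0 < obs (XZ \<omega>) i} \<omega>)"
        by (intro bochner_cong) (auto simp: indicator_def sp)
      then show ?thesis by simp
    qed
    ultimately have "{\<omega>\<in>space M. obs (XZ \<omega>) i = obs (XZ \<omega>) j \<and> 0 < obs (XZ \<omega>) i} \<in> null_sets M"
      by (intro null_setsI) (simp add: emeasure_eq_measure, measurable)
    then show ?thesis by (rule AE_I') auto
  qed
  have "AE \<omega> in M. \<forall>i\<in>I. \<forall>j\<in>I. i \<noteq> j \<longrightarrow> \<not> (obs (XZ \<omega>) i = obs (XZ \<omega>) j \<and> 0 < obs (XZ \<omega>) i)"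
    using assms 1 by (intro AE_finite_allI) auto
  note ae = this
  define T where "T = {\<omega>\<in>space M. \<exists>i\<in>I. \<exists>j\<in>I. i \<noteq> j \<and> obs (XZ \<omega>) i = obs (XZ \<omega>) j \<and> 0 < obs (XZ \<omega>) i}"
  have "AE \<omega> in M. \<omega> \<notin> T" unfolding T_def using ae by eventually_elim blast
  moreover have "T \<in> events" unfolding T_def using assms by measurable
  ultimately have "T \<in> null_sets M" by (simp add: AE_iff_null_sets)
  then show ?thesis unfolding T_def by (rule measure_eq_0_null_sets)
qed

text \<open>Summing \<open>integral_excess_prod\<close> over all \<open>(p, A)\<close> shows that the excesses have the characteristic
  function of independent exponential variables on the event that the threshold is at least \<open>v\<close>. Any statistic \<open>W\<close>
  that is within \<open>R\<close> of an affine function of the sum of the excesses inherits this, up to the mean of \<open>R\<close> and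
  twice the probability of the complement.\<close>

lemma char_approx_by_excesses:
  fixes W R :: "'a \<Rightarrow> real" and n k :: nat
  assumes W[measurable]: "W \<in> borel_measurable M" and R: "integrable M R" "\<And>\<omega>. 0 \<le> R \<omega>" and v: "v > 0"
    and close: "\<And>\<omega> p A. p \<in> {1..int n} \<Longrightarrow> A \<subseteq> {1..int n} - {p} \<Longrightarrow> card A = k \<Longrightarrow>
      exceed v {1..int n} p A (XZ \<omega>) \<Longrightarrow> \<bar>W \<omega> - (c * (\<Sum>i\<in>A. excess p (XZ \<omega>) i) + d)\<bar> \<le> R \<omega>"
  shows "cmod ((CLINT \<omega>|M. iexp (W \<omega>)) - iexp d * (1 / (1 - \<i> * c)) ^ k) \<le>
    expectation R + 2 * prob {\<omega>\<in>space M. card {i\<in>{1..int n}. v \<le> obs (XZ \<omega>) i} \<le> k}"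
proof -
  let ?I = "{1..int n}"
  define \<phi> where "\<phi> = 1 / (1 - \<i> * complex_of_real c)"
  define PA where "PA = (SIGMA p:?I. {A. A \<subseteq> ?I - {p} \<and> card A = k})"
  define ex where "ex = (\<lambda>(p, A) \<omega>. exceed v ?I p A (XZ \<omega>))"
  define h where "h = (\<lambda>(p, A) \<omega>. if exceed v ?I p A (XZ \<omega>) then \<Prod>i\<in>A. iexp (c * excess p (XZ \<omega>) i) else 0)"
  define G where "G = {\<omega>\<in>space M. \<exists>a\<in>PA. ex a \<omega>}"
  have finPA: "finite PA" unfolding PA_def by (intro finite_SigmaI) auto
  have ex_meas: "Measurable.pred M (ex a)" if "a \<in> PA" for a
    using that unfolding ex_def PA_def by (auto intro!: measurable_compose[OF XZ_meas exceed_measurable] split: prod.splits)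
  have G[measurable]: "G \<in> sets M" unfolding G_def using finPA ex_meas by measurable
  \<comment> \<open>At most one pair \<open>(p, A)\<close> is realised, so at most one summand of \<open>h\<close> is nonzero.\<close>
  have uniq: "a = b" if "a \<in> PA" "b \<in> PA" "ex a \<omega>" "ex b \<omega>" for a b \<omega>
    using that top_block_unique[of n "obs (XZ \<omega>)" "fst a" "snd a" "fst b" "snd b"]
    by (auto simp: PA_def ex_def exceed_def prod_eq_iff split: prod.splits)
  have h_meas[measurable]: "h a \<in> borel_measurable M" if "a \<in> PA" for a
  proof -
    obtain p A where a: "a = (p, A)" by (cases a)
    have [measurable]: "Measurable.pred M (\<lambda>\<omega>. exceed v ?I p A (XZ \<omega>))" using ex_meas[OF that] by (simp add: a ex_def)
    have [measurable]: "(\<lambda>\<omega>. excess p (XZ \<omega>) i) \<in> borel_measurable M" for i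
      by (rule measurable_compose[OF XZ_meas excess_measurable])
    show ?thesis unfolding h_def a by simp
  qed
  have h_bdd: "cmod (h a \<omega>) \<le> 1" for a \<omega>
    by (cases a) (simp add: h_def norm_prod_iexp del: of_real_mult)
  have h_int: "integrable M (h a)" if "a \<in> PA" for a
    by (rule integrable_const_bound[of _ 1]) (use that h_bdd in auto)
  have h_sum: "(\<Sum>a\<in>PA. h a \<omega>) = h a \<omega>" if "a \<in> PA" "ex a \<omega>" for a \<omega>
  proof -
    have "h b \<omega> = 0" if "b \<in> PA - {a}" for b
      using uniq[of b a \<omega>] that \<open>a \<in> PA\<close> \<open>ex a \<omega>\<close> by (auto simp: h_def ex_def split: prod.splits)
    then have "(\<Sum>b\<in>PA - {a}. h b \<omega>) = 0" by (rule sum.neutral[rule_format])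
    then show ?thesis using finPA that(1) by (simp add: sum.remove)
  qed
  have "(CLINT \<omega>|M. (\<Sum>a\<in>PA. h a \<omega>)) = (\<Sum>a\<in>PA. (CLINT \<omega>|M. h a \<omega>))"
    by (rule Bochner_Integration.integral_sum) (rule h_int)
  also have "\<dots> = (\<Sum>a\<in>PA. \<phi> ^ k * prob {\<omega>\<in>space M. ex a \<omega>})"
  proof (rule sum.cong[OF refl])
    fix a assume "a \<in> PA"
    then obtain p A where a: "a = (p, A)" "p \<in> ?I" "A \<subseteq> ?I - {p}" "card A = k" by (auto simp: PA_def)
    show "(CLINT \<omega>|M. h a \<omega>) = \<phi> ^ k * prob {\<omega>\<in>space M. ex a \<omega>}"
      using integral_excess_prod[of ?I A p A v c] a v by (simp add: h_def ex_def \<phi>_def)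
  qed
  also have "\<dots> = \<phi> ^ k * (\<Sum>a\<in>PA. prob {\<omega>\<in>space M. ex a \<omega>})"
    by (simp add: sum_distrib_left)
  also have "(\<Sum>a\<in>PA. prob {\<omega>\<in>space M. ex a \<omega>}) = prob (\<Union>a\<in>PA. {\<omega>\<in>space M. ex a \<omega>})"
  proof (rule finite_measure_finite_Union[OF finPA, symmetric])
    show "(\<lambda>a. {\<omega>\<in>space M. ex a \<omega>}) ` PA \<subseteq> events" using ex_meas by (auto simp: pred_def)
    show "disjoint_family_on (\<lambda>a. {\<omega>\<in>space M. ex a \<omega>}) PA"
      unfolding disjoint_family_on_def using uniq by blast
  qed
  also have "(\<Union>a\<in>PA. {\<omega>\<in>space M. ex a \<omega>}) = G" by (auto simp: G_def)
  finally have hG: "(CLINT \<omega>|M. (\<Sum>a\<in>PA. h a \<omega>)) = \<phi> ^ k * prob G" .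
  have n\<phi>: "cmod \<phi> \<le> 1"
  proof -
    have "1 \<le> cmod (1 - \<i> * complex_of_real c)"
      using abs_Re_le_cmod[of "1 - \<i> * complex_of_real c"] by simp
    then show ?thesis by (simp add: \<phi>_def norm_divide divide_le_eq)
  qed
  have lip: "cmod (iexp a - iexp b) \<le> \<bar>a - b\<bar>" for a b
  proof -
    have "iexp a - iexp b = iexp b * (iexp (a - b) - 1)"
      by (simp add: algebra_simps exp_add[symmetric])
    then have "cmod (iexp a - iexp b) = cmod (iexp (a - b) - 1)"
      by (simp only: norm_mult norm_exp_i_times)
    also have "\<dots> \<le> \<bar>a - b\<bar>" using iexp_approx1[of "a - b" 0] by simp
    finally show ?thesis .
  qed
  have h_total_int: "integrable M (\<lambda>\<omega>. iexp d * (\<Sum>a\<in>PA. h a \<omega>))"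
    by (intro integrable_mult_right Bochner_Integration.integrable_sum h_int)
  have W_int: "complex_integrable M (\<lambda>\<omega>. iexp (W \<omega>))"
    by (rule integrable_const_bound[of _ 1]) simp_all
  have indG: "integrable M (indicat_real (space M - G))"
    by (rule integrable_real_indicator) (simp_all add: emeasure_eq_measure)
  have pt: "cmod (iexp (W \<omega>) - iexp d * (\<Sum>a\<in>PA. h a \<omega>)) \<le> R \<omega> + indicator (space M - G) \<omega>" if "\<omega> \<in> space M" for \<omega>
  proof (cases "\<omega> \<in> G")
    case True
    then obtain p A where a: "(p, A) \<in> PA" "ex (p, A) \<omega>" by (auto simp: G_def)
    then have pA: "p \<in> ?I" "A \<subseteq> ?I - {p}" "card A = k" "exceed v ?I p A (XZ \<omega>)" by (auto simp: PA_def ex_def)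
    have "(\<Sum>a\<in>PA. h a \<omega>) = (\<Prod>i\<in>A. iexp (c * excess p (XZ \<omega>) i))"
      using h_sum[OF a] pA by (simp add: h_def)
    also have "\<dots> = iexp (c * (\<Sum>i\<in>A. excess p (XZ \<omega>) i))"
      using pA finite_subset[OF pA(2)] by (subst exp_sum[symmetric]) (simp_all add: sum_distrib_left)
    finally have "iexp d * (\<Sum>a\<in>PA. h a \<omega>) = iexp (c * (\<Sum>i\<in>A. excess p (XZ \<omega>) i) + d)"
      by (simp add: exp_add[symmetric] algebra_simps)
    then have "cmod (iexp (W \<omega>) - iexp d * (\<Sum>a\<in>PA. h a \<omega>)) \<le> \<bar>W \<omega> - (c * (\<Sum>i\<in>A. excess p (XZ \<omega>) i) + d)\<bar>"
      by (simp only: lip)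
    also have "\<dots> \<le> R \<omega>" by (rule close[OF pA])
    finally show ?thesis using True by simp
  next
    case False
    then have "h a \<omega> = 0" if "a \<in> PA" for a
      using that \<open>\<omega> \<in> space M\<close> by (auto simp: G_def h_def ex_def split: prod.splits)
    then have "cmod (iexp (W \<omega>) - iexp d * (\<Sum>a\<in>PA. h a \<omega>)) = 1" by simp
    then show ?thesis using False that R(2)[of \<omega>] by simp
  qed
  have "cmod ((CLINT \<omega>|M. iexp (W \<omega>)) - iexp d * (\<phi> ^ k * prob G)) = cmod (CLINT \<omega>|M. iexp (W \<omega>) - iexp d * (\<Sum>a\<in>PA. h a \<omega>))"
    using W_int h_total_int by (simp only: Bochner_Integration.integral_diff integral_mult_right_zero hG)
  also have "\<dots> \<le> (LINT \<omega>|M. cmod (iexp (W \<omega>) - iexp d * (\<Sum>a\<in>PA. h a \<omega>)))"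
    by (rule integral_norm_bound)
  also have "\<dots> \<le> (LINT \<omega>|M. R \<omega> + indicator (space M - G) \<omega>)"
  proof (rule integral_mono)
    show "integrable M (\<lambda>\<omega>. cmod (iexp (W \<omega>) - iexp d * (\<Sum>a\<in>PA. h a \<omega>)))"
      by (intro integrable_norm Bochner_Integration.integrable_diff W_int h_total_int)
    show "integrable M (\<lambda>\<omega>. R \<omega> + indicator (space M - G) \<omega>)"
      by (intro Bochner_Integration.integrable_add R(1) indG)
  qed (rule pt)
  also have "\<dots> = expectation R + prob (space M - G)"
    by (subst bochner_add[OF R(1) indG]) simp
  finally have 1: "cmod ((CLINT \<omega>|M. iexp (W \<omega>)) - iexp d * (\<phi> ^ k * prob G)) \<le> expectation R + prob (space M - G)" .
  have "cmod (iexp d * (\<phi> ^ k * prob G) - iexp d * \<phi> ^ k) = cmod (\<phi> ^ k) * (1 - prob G)"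
  proof -
    have "iexp d * (\<phi> ^ k * prob G) - iexp d * \<phi> ^ k = - (iexp d * (\<phi> ^ k * complex_of_real (1 - prob G)))"
      by (simp add: algebra_simps)
    then have "cmod (iexp d * (\<phi> ^ k * prob G) - iexp d * \<phi> ^ k) = cmod (\<phi> ^ k) * \<bar>1 - prob G\<bar>"
      by (simp only: norm_minus_cancel norm_mult norm_exp_i_times norm_of_real)
    then show ?thesis by simp
  qed
  also have "\<dots> \<le> 1 * (1 - prob G)"
    using n\<phi> by (intro mult_right_mono) (simp_all add: norm_power power_le_one)
  also have "\<dots> = prob (space M - G)" by (simp add: prob_compl)
  finally have 2: "cmod (iexp d * (\<phi> ^ k * prob G) - iexp d * \<phi> ^ k) \<le> prob (space M - G)" .
  have 3: "prob (space M - G) \<le> prob {\<omega>\<in>space M. card {i\<in>?I. v \<le> obs (XZ \<omega>) i} \<le> k}"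
  proof -
    let ?T = "{\<omega>\<in>space M. \<exists>i\<in>?I. \<exists>j\<in>?I. i \<noteq> j \<and> obs (XZ \<omega>) i = obs (XZ \<omega>) j \<and> 0 < obs (XZ \<omega>) i}"
    let ?C = "{\<omega>\<in>space M. card {i\<in>?I. v \<le> obs (XZ \<omega>) i} \<le> k}"
    have T[measurable]: "?T \<in> events" by measurable
    have "card {i\<in>?I. v \<le> obs (XZ \<omega>) i} = (\<Sum>i\<in>?I. if v \<le> obs (XZ \<omega>) i then 1 else 0)" for \<omega>
      by (subst sum.If_cases) (simp_all add: Int_def)
    then have "?C = {\<omega>\<in>space M. (\<Sum>i\<in>?I. if v \<le> obs (XZ \<omega>) i then 1 else 0) \<le> k}" by simp
    also have "\<dots> \<in> events" by measurable
    finally have C: "?C \<in> events" .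
    have "space M - G \<subseteq> ?T \<union> ?C"
    proof
      fix \<omega> assume w: "\<omega> \<in> space M - G"
      show "\<omega> \<in> ?T \<union> ?C"
      proof (rule ccontr)
        assume neg: "\<omega> \<notin> ?T \<union> ?C"
        have "inj_on (obs (XZ \<omega>)) {i\<in>?I. v \<le> obs (XZ \<omega>) i}"
        proof (rule inj_onI)
          fix i j assume ij: "i \<in> {i\<in>?I. v \<le> obs (XZ \<omega>) i}" "j \<in> {i\<in>?I. v \<le> obs (XZ \<omega>) i}" "obs (XZ \<omega>) i = obs (XZ \<omega>) j"
          then have "0 < obs (XZ \<omega>) i" using v by auto
          then show "i = j" using neg w ij by blast
        qed
        moreover have "k < card {i\<in>?I. v \<le> obs (XZ \<omega>) i}" using neg w by auto
        ultimately obtain p A where "p \<in> ?I" "A \<subseteq> ?I - {p}" "card A = k" "v \<le> obs (XZ \<omega>) p" "top_block ?I (obs (XZ \<omega>)) p A"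
          using top_block_exists[of ?I "obs (XZ \<omega>)" v k] by auto
        then have "(p, A) \<in> PA" "ex (p, A) \<omega>" by (auto simp: PA_def ex_def exceed_def)
        then show False using w by (auto simp: G_def)
      qed
    qed
    then have "prob (space M - G) \<le> prob (?T \<union> ?C)" using T C by (intro finite_measure_mono sets.Un)
    also have "\<dots> \<le> prob ?T + prob ?C" using T C by (rule measure_Un_le)
    finally show ?thesis using prob_ties[of ?I] by simp
  qed
  have "cmod ((CLINT \<omega>|M. iexp (W \<omega>)) - iexp d * \<phi> ^ k) \<le> (expectation R + prob (space M - G)) + prob (space M - G)"
    by (rule norm_diff_triangle_le[OF 1 2])
  then show ?thesis using 3 unfolding \<phi>_def by linarith
qed

end

section \<open>The second order condition and the approximation error\<close>

text \<open>The integral representation turns \<open>ln S(z) - ln S(w) + \<alpha> ln (z / w)\<close> into the integral of \<open>\<eta>(s) / s\<close>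
  over \<open>[w, z]\<close>, where \<open>\<eta>\<close> is dominated by \<open>C \<eta>'(w)\<close>.\<close>

lemma assumption_SO_log_increment:
  assumes "assumption_SO S \<alpha> \<beta> \<eta>'"
  obtains C where "C > 0" "\<And>z. 0 < z \<Longrightarrow> 0 < S z"
    "\<And>w z. 0 < w \<Longrightarrow> w \<le> z \<Longrightarrow> \<bar>ln (S z / S w) + \<alpha> * ln (z / w)\<bar> \<le> C * \<eta>' w * ln (z / w)"
proof -
  obtain \<eta> c C where \<eta>m: "\<eta> \<in> borel_measurable (restrict_space borel {0..})" and c: "c > 0" and C: "C > 0"
    and S: "\<And>z. z > 0 \<Longrightarrow> S z = c * z powr (- \<alpha>) * exp (LBINT s=1..z. \<eta> s / s)"
    and \<eta>: "\<And>s. s \<ge> 0 \<Longrightarrow> \<bar>\<eta> s\<bar> \<le> C * \<eta>' s"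
    using assms unfolding assumption_SO_def by blast
  have anti: "\<eta>' z \<le> \<eta>' w" if "0 \<le> w" "w \<le> z" for w z
  proof -
    have "antimono_on {0..} \<eta>'" using assms unfolding assumption_SO_def by blast
    from monotone_onD[OF this, of w z] that show ?thesis by simp
  qed
  define f where "f s = (if 0 < s then \<eta> s / s else 0)" for s
  have f_meas[measurable]: "f \<in> borel_measurable borel"
  proof -
    have "(\<lambda>s. indicator {0..} s *\<^sub>R \<eta> s) \<in> borel_measurable borel"
      using \<eta>m by (subst (asm) borel_measurable_restrict_space_iff) auto
    then have "(\<lambda>s. indicator {0<..} s * (indicator {0..} s *\<^sub>R \<eta> s) / s) \<in> borel_measurable borel"
      by measurable
    also have "(\<lambda>s. indicator {0<..} s * (indicator {0..} s *\<^sub>R \<eta> s) / s) = f"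
      by (auto simp: f_def indicator_def)
    finally show ?thesis .
  qed
  have f_bound: "\<bar>f s\<bar> \<le> C * \<eta>' a * (1 / s)" if "0 < a" "a \<le> s" for a s
  proof -
    have "\<bar>\<eta> s\<bar> \<le> C * \<eta>' a" using \<eta>[of s] anti[of a s] that C by (smt (verit) mult_left_mono)
    then show ?thesis using that by (simp add: f_def divide_right_mono)
  qed
  have f_int: "interval_lebesgue_integrable lborel (ereal a) (ereal b) f" if "0 < a" "a \<le> b" for a b
  proof -
    have "set_integrable lborel {a..b} (\<lambda>s. C * \<eta>' a * (1 / s))"
      by (intro borel_integrable_atLeastAtMost') (use that in \<open>auto intro!: continuous_intros\<close>)
    then have "set_integrable lborel (einterval a b) (\<lambda>s. C * \<eta>' a * (1 / s))"
      by (rule set_integrable_subset) (auto simp: einterval_def)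
    then have "set_integrable lborel (einterval a b) f"
      unfolding set_integrable_def
    proof (rule Bochner_Integration.integrable_bound)
      show "AE x in lborel. norm (indicator (einterval (ereal a) (ereal b)) x *\<^sub>R f x)
          \<le> norm (indicator (einterval (ereal a) (ereal b)) x *\<^sub>R (C * \<eta>' a * (1 / x)))"
      proof (rule AE_I2)
        fix x
        have "\<bar>f x\<bar> \<le> \<bar>C * \<eta>' a * (1 / x)\<bar>" if "a < x"
          using f_bound[OF \<open>0 < a\<close>, of x] that abs_ge_self[of "C * \<eta>' a * (1 / x)"] by linarith
        then show "norm (indicator (einterval (ereal a) (ereal b)) x *\<^sub>R f x)
          \<le> norm (indicator (einterval (ereal a) (ereal b)) x *\<^sub>R (C * \<eta>' a * (1 / x)))"
          by (auto simp: indicator_def einterval_def)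
      qed
    qed measurable
    then show ?thesis using that by (simp add: interval_lebesgue_integrable_def)
  qed
  have f_eq: "(LBINT s=1..z. \<eta> s / s) = (LBINT s=ereal 1..ereal z. f s)" if "z > 0" for z
    unfolding one_ereal_def
    by (rule interval_integral_cong) (use that in \<open>auto simp: f_def einterval_def min_def max_def split: if_splits\<close>)
  have key: "\<bar>ln (S z / S w) + \<alpha> * ln (z / w)\<bar> \<le> C * \<eta>' w * ln (z / w)" if w: "0 < w" "w \<le> z" for w z
  proof -
    have z: "0 < z" using w by simp
    let ?m = "min 1 w" and ?M = "max 1 z"
    have "(LBINT s=ereal 1..ereal w. f s) + (LBINT s=ereal w..ereal z. f s) = (LBINT s=ereal 1..ereal z. f s)"
    proof (rule interval_integral_sum)
      have "min (ereal 1) (min (ereal w) (ereal z)) = ereal ?m" "max (ereal 1) (max (ereal w) (ereal z)) = ereal ?M"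
        using w by (auto simp: min_def max_def)
      then show "interval_lebesgue_integrable lborel (min (ereal 1) (min (ereal w) (ereal z)))
         (max (ereal 1) (max (ereal w) (ereal z))) f"
        using f_int[of ?m ?M] w by simp
    qed
    then have d: "(LBINT s=ereal 1..ereal z. f s) - (LBINT s=ereal 1..ereal w. f s) = (LBINT s=ereal w..ereal z. f s)"
      by simp
    have lnS: "ln (S x) = ln c - \<alpha> * ln x + (LBINT s=ereal 1..ereal x. f s)" if "0 < x" for x
      using that c by (simp add: S f_eq ln_mult ln_powr)
    have "S z > 0" "S w > 0" using S c z w by simp_all
    then have "ln (S z / S w) + \<alpha> * ln (z / w) = (LBINT s=ereal w..ereal z. f s)"
      using z w by (simp add: ln_div lnS d[symmetric] algebra_simps)
    also have "\<bar>\<dots>\<bar> \<le> (LBINT s=ereal w..ereal z. \<bar>f s\<bar>)"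
      using interval_integral_norm[OF f_int[OF w]] w by simp
    also have "\<dots> \<le> (LBINT s=ereal w..ereal z. C * \<eta>' w * (1 / s))"
    proof -
      have "set_integrable lborel {w..z} (\<lambda>s. C * \<eta>' w * (1 / s))"
        by (intro borel_integrable_atLeastAtMost') (use w in \<open>auto intro!: continuous_intros\<close>)
      then have 1: "set_integrable lborel (einterval w z) (\<lambda>s. C * \<eta>' w * (1 / s))"
        by (rule set_integrable_subset) (auto simp: einterval_def)
      have 2: "set_integrable lborel (einterval w z) (\<lambda>s. \<bar>f s\<bar>)"
        using f_int[OF w] w by (simp add: interval_lebesgue_integrable_def set_integrable_abs)
      show ?thesis using w unfolding interval_lebesgue_integral_def
        using set_integral_mono[OF 2 1] f_bound[OF w(1)] by (simp add: einterval_def)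
    qed
    also have "\<dots> = C * \<eta>' w * ln z - C * \<eta>' w * ln w"
    proof (rule interval_integral_FTC_finite)
      show "continuous_on {min w z..max w z} (\<lambda>s. C * \<eta>' w * (1 / s))"
        using w by (auto intro!: continuous_intros)
      show "((\<lambda>s. C * \<eta>' w * ln s) has_vector_derivative C * \<eta>' w * (1 / x)) (at x within {min w z..max w z})"
        if "min w z \<le> x" "x \<le> max w z" for x
        unfolding has_real_derivative_iff_has_vector_derivative[symmetric]
        using that w by (auto intro!: derivative_eq_intros)
    qed
    also have "\<dots> = C * \<eta>' w * ln (z / w)" using w z by (simp add: ln_div algebra_simps)
    finally show ?thesis .
  qed
  show thesis
    by (rule that[OF C _ key]) (simp_all add: S c)
qed

text \<open>The increment bound makes \<open>ln S\<close> a Lipschitz function of \<open>ln z\<close>.\<close>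

lemma assumption_SO_continuous:
  assumes SO: "assumption_SO S \<alpha> \<beta> \<eta>'"
  shows "continuous_on {0<..} S"
proof -
  obtain C where C: "C > 0" "\<And>z. 0 < z \<Longrightarrow> 0 < S z"
    "\<And>w z. 0 < w \<Longrightarrow> w \<le> z \<Longrightarrow> \<bar>ln (S z / S w) + \<alpha> * ln (z / w)\<bar> \<le> C * \<eta>' w * ln (z / w)"
    using assumption_SO_log_increment[OF SO] by metis
  obtain B where B: "\<And>x. x \<ge> 0 \<Longrightarrow> \<eta>' x \<le> B"
    using SO unfolding assumption_SO_def bounded_iff by (force simp: abs_le_iff)
  have le: "\<bar>ln (S z) - ln (S w)\<bar> \<le> (\<bar>\<alpha>\<bar> + C * \<bar>B\<bar>) * \<bar>ln z - ln w\<bar>" if "0 < w" "w \<le> z" for w z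
  proof -
    have l: "ln (z / w) = ln z - ln w" "0 \<le> ln z - ln w" "ln (S z / S w) = ln (S z) - ln (S w)"
      using that C(2)[of w] C(2)[of z] by (simp_all add: ln_div)
    have "C * \<eta>' w \<le> C * \<bar>B\<bar>" using B[of w] that C by (intro mult_left_mono) auto
    then have "C * \<eta>' w * (ln z - ln w) \<le> C * \<bar>B\<bar> * (ln z - ln w)" using l(2) by (intro mult_right_mono)
    moreover have "\<bar>\<alpha> * (ln z - ln w)\<bar> = \<bar>\<alpha>\<bar> * (ln z - ln w)" using l(2) by (simp add: abs_mult)
    ultimately show ?thesis using C(3)[OF that] l unfolding l by (simp add: distrib_right)
  qed
  have lip: "\<bar>ln (S z) - ln (S w)\<bar> \<le> (\<bar>\<alpha>\<bar> + C * \<bar>B\<bar>) * \<bar>ln z - ln w\<bar>" if "0 < w" "0 < z" for w z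
    using le[of w z] le[of z w] that by (cases "w \<le> z") (simp_all add: abs_minus_commute)
  have cont: "isCont (\<lambda>z. ln (S z)) w" if w: "w > 0" for w
  proof -
    have "((\<lambda>z. ln (S z) - ln (S w)) \<longlongrightarrow> 0) (at w)"
    proof (rule Lim_null_comparison)
      show "\<forall>\<^sub>F z in at w. norm (ln (S z) - ln (S w)) \<le> (\<bar>\<alpha>\<bar> + C * \<bar>B\<bar>) * \<bar>ln z - ln w\<bar>"
        using eventually_at_in_open'[of "{0<..}" w] w by (auto elim!: eventually_mono intro: lip)
      have "((\<lambda>z. (\<bar>\<alpha>\<bar> + C * \<bar>B\<bar>) * \<bar>ln z - ln w\<bar>) \<longlongrightarrow> (\<bar>\<alpha>\<bar> + C * \<bar>B\<bar>) * \<bar>ln w - ln w\<bar>) (at w)"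
        using w by (intro tendsto_intros) auto
      then show "((\<lambda>z. (\<bar>\<alpha>\<bar> + C * \<bar>B\<bar>) * \<bar>ln z - ln w\<bar>) \<longlongrightarrow> 0) (at w)" by simp
    qed
    then show ?thesis unfolding isCont_def by (simp add: Lim_null[symmetric])
  qed
  have "continuous_on {0<..} (\<lambda>z. exp (ln (S z)))"
    using cont by (intro continuous_on_exp continuous_at_imp_continuous_on) auto
  moreover have "exp (ln (S z)) = S z" if "z \<in> {0<..}" for z using C(2) that by simp
  ultimately show ?thesis by (simp only: continuous_on_cong[OF refl, of "{0<..}" "\<lambda>z. exp (ln (S z))" S])
qed

text \<open>This writes a logarithmic excess as a sum of exceedance indicators, whose means are values of the tail
  function.\<close>

lemma ln_le_suminf_indicator:
  assumes "w > 1"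
  shows "ennreal (ln w) \<le> (\<Sum>j. indicator {2 ^ j<..} w)"
proof -
  define J where "J = nat \<lceil>log 2 w\<rceil>"
  have l: "log 2 w > 0" using assms by simp
  have J: "log 2 w \<le> real J" using l unfolding J_def by linarith
  have "ln w \<le> log 2 w"
  proof -
    have "ln w = log 2 w * ln 2" using assms by (simp add: log_def)
    also have "\<dots> \<le> log 2 w * 1" using l ln_2_less_1 by (intro mult_left_mono) auto
    finally show ?thesis by simp
  qed
  with J have "ennreal (ln w) \<le> ennreal (real J)" by (intro ennreal_leI) linarith
  also have "\<dots> = (\<Sum>j<J. 1)" by (simp add: ennreal_of_nat_eq_real_of_nat)
  also have "\<dots> = (\<Sum>j<J. indicator {2 ^ j<..} w)"
  proof (rule sum.cong[OF refl])
    fix j assume "j \<in> {..<J}"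
    then have "real j < log 2 w" using l unfolding J_def by (simp add: less_ceiling_iff zless_nat_conj nat_less_iff) linarith
    then have "2 powr real j < w" using assms by (simp add: less_log_iff)
    then show "(1::ennreal) = indicator {2 ^ j<..} w" by (simp add: powr_realpow)
  qed
  also have "\<dots> \<le> (\<Sum>j. indicator {2 ^ j<..} w)" by (rule sum_le_suminf) auto
  finally show ?thesis .
qed

context sv_model begin

lemma nn_integral_exceedance:
  assumes [measurable]: "h \<in> borel_measurable borel" and v: "v > 0"
  shows "(\<integral>\<^sup>+\<omega>. h (\<sigma> (X i \<omega>)) * indicator {v<..} (obs (XZ \<omega>) i) \<partial>M) =
    (\<integral>\<^sup>+\<omega>. (if 0 < \<sigma> (X i \<omega>) then h (\<sigma> (X i \<omega>)) * S (v / \<sigma> (X i \<omega>)) else 0) \<partial>M)"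
proof -
  let ?f = "\<lambda>w. h (\<sigma> (fst w i)) * indicator {v<..} (obs w i)"
  have "(\<integral>\<^sup>+\<omega>. ?f (\<lambda>j. X j \<omega>, \<lambda>j. Z j \<omega>) \<partial>M) = (\<integral>\<^sup>+\<omega>. (\<integral>\<^sup>+t. ?f (\<lambda>j. X j \<omega>, (\<lambda>j. Z j \<omega>)(i := t)) \<partial>\<nu>) \<partial>M)"
    by (rule nn_integral_resample) measurable
  also have "\<dots> = (\<integral>\<^sup>+\<omega>. (if 0 < \<sigma> (X i \<omega>) then h (\<sigma> (X i \<omega>)) * S (v / \<sigma> (X i \<omega>)) else 0) \<partial>M)"
  proof (rule nn_integral_cong)
    fix \<omega>
    let ?s = "\<sigma> (X i \<omega>)"
    show "(\<integral>\<^sup>+t. ?f (\<lambda>j. X j \<omega>, (\<lambda>j. Z j \<omega>)(i := t)) \<partial>\<nu>) = (if 0 < ?s then h ?s * S (v / ?s) else 0)"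
    proof (cases "0 < ?s")
      case True
      have "(\<integral>\<^sup>+t. ?f (\<lambda>j. X j \<omega>, (\<lambda>j. Z j \<omega>)(i := t)) \<partial>\<nu>) = (\<integral>\<^sup>+t. h ?s * indicator {v / ?s<..} t \<partial>\<nu>)"
        using True by (intro nn_integral_cong) (auto simp: obs_def indicator_def field_simps)
      also have "\<dots> = h ?s * emeasure \<nu> {v / ?s<..}" by (simp add: nn_integral_cmult)
      finally show ?thesis using True by (simp add: S_def nu.emeasure_eq_measure)
    next
      case False
      then have "?s = 0" using \<sigma>_nonneg[of "X i \<omega>"] by simp
      then show ?thesis using v by (simp add: obs_def)
    qed
  qed
  finally show ?thesis by (simp add: XZ_def)
qed

text \<open>The mean error of replacing one logarithmic excess by an exponential variable. The logarithm is split
  into the indicators of exceeding \<open>v * 2 ^ j\<close>; each of them has conditional probability \<open>S (v * 2 ^ j / \<sigma>)\<close>, which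
  the Potter bound compares with \<open>S v\<close>, with geometric decay in \<open>j\<close> and polynomial growth in \<open>\<sigma>\<close>.\<close>

lemma expectation_weighted_log_excess:
  fixes \<eta>' :: "real \<Rightarrow> real"
  assumes \<eta>0: "\<eta>0 = (\<lambda>y. if 0 < y then \<eta>' y else 0)" and \<eta>m[measurable]: "\<eta>0 \<in> borel_measurable borel"
    and \<eta>_nonneg: "\<And>y. 0 < y \<Longrightarrow> 0 \<le> \<eta>' y"
    and pot_\<eta>: "\<And>s. 0 < s \<Longrightarrow> \<eta>' (v / s) \<le> A1 * (1 + \<bar>s\<bar>) powr r1 * \<eta>' v"
    and pot_S: "\<And>s m. 0 < s \<Longrightarrow> S (v * 2 ^ m / s) \<le> A2 * (1 + \<bar>s\<bar>) powr r2 * (d ^ m * S v)"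
    and v: "v > 0" and A: "0 \<le> A1" "0 \<le> A2" and d: "0 < d" "d < 1"
    and mom: "integrable M (\<lambda>\<omega>. (1 + \<sigma> (X i \<omega>)) powr (r1 + r2))"
  defines "g \<equiv> \<lambda>\<omega>. if v < obs (XZ \<omega>) i then \<eta>0 (v / \<sigma> (X i \<omega>)) * ln (obs (XZ \<omega>) i / v) else 0"
  defines "K \<equiv> A1 * A2 * (1 / (1 - d)) * expectation (\<lambda>\<omega>. (1 + \<sigma> (X i \<omega>)) powr (r1 + r2))"
  shows "integrable M g" "expectation g \<le> K * (\<eta>' v * S v)" "\<And>\<omega>. 0 \<le> g \<omega>"
proof -
  have gm[measurable]: "g \<in> borel_measurable M" unfolding g_def by measurable
  have S0: "0 \<le> S z" for z by (simp add: S_def)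
  have \<eta>v: "0 \<le> \<eta>' v" using \<eta>_nonneg v .
  show g0: "0 \<le> g \<omega>" for \<omega>
    using v \<eta>_nonneg by (auto simp: g_def \<eta>0)
  let ?w = "\<lambda>\<omega>. (1 + \<sigma> (X i \<omega>)) powr (r1 + r2)"
  let ?Q = "A1 * A2 * (\<eta>' v * S v)"
  let ?E = "\<lambda>\<omega>. ennreal (\<eta>0 (v / \<sigma> (X i \<omega>)))"
  let ?Iw = "\<integral>\<^sup>+\<omega>. ennreal (?w \<omega>) \<partial>M"
  have Q0: "0 \<le> ?Q" using A \<eta>v S0 by simp
  have "(\<integral>\<^sup>+\<omega>. ennreal (g \<omega>) \<partial>M) \<le> (\<integral>\<^sup>+\<omega>. (\<Sum>j. ?E \<omega> * indicator {v * 2 ^ j<..} (obs (XZ \<omega>) i)) \<partial>M)"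
  proof (rule nn_integral_mono)
    fix \<omega>
    show "ennreal (g \<omega>) \<le> (\<Sum>j. ?E \<omega> * indicator {v * 2 ^ j<..} (obs (XZ \<omega>) i))"
    proof (cases "v < obs (XZ \<omega>) i")
      case True
      have "ennreal (g \<omega>) = ?E \<omega> * ennreal (ln (obs (XZ \<omega>) i / v))"
        using True v by (simp add: g_def ennreal_mult'')
      also have "\<dots> \<le> ?E \<omega> * (\<Sum>j. indicator {2 ^ j<..} (obs (XZ \<omega>) i / v))"
        by (intro mult_left_mono ln_le_suminf_indicator) (use True v in auto)
      also have "\<dots> = (\<Sum>j. ?E \<omega> * indicator {2 ^ j<..} (obs (XZ \<omega>) i / v))"
        by (rule ennreal_suminf_cmult[symmetric])
      also have "\<dots> = (\<Sum>j. ?E \<omega> * indicator {v * 2 ^ j<..} (obs (XZ \<omega>) i))"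
        using v by (intro suminf_cong) (auto simp: indicator_def field_simps)
      finally show ?thesis .
    qed (simp add: g_def)
  qed
  also have "\<dots> = (\<Sum>j. (\<integral>\<^sup>+\<omega>. ?E \<omega> * indicator {v * 2 ^ j<..} (obs (XZ \<omega>) i) \<partial>M))"
    by (rule nn_integral_suminf) measurable
  also have "\<dots> \<le> (\<Sum>j. ennreal (d ^ j) * (ennreal ?Q * ?Iw))"
  proof (rule suminf_le)
    fix j
    have "(\<integral>\<^sup>+\<omega>. ?E \<omega> * indicator {v * 2 ^ j<..} (obs (XZ \<omega>) i) \<partial>M) =
      (\<integral>\<^sup>+\<omega>. (if 0 < \<sigma> (X i \<omega>) then ?E \<omega> * S (v * 2 ^ j / \<sigma> (X i \<omega>)) else 0) \<partial>M)"
      using v by (intro nn_integral_exceedance[of "\<lambda>s. ennreal (\<eta>0 (v / s))"]) simp_all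
    also have "\<dots> \<le> (\<integral>\<^sup>+\<omega>. ennreal (d ^ j * ?Q) * ennreal (?w \<omega>) \<partial>M)"
    proof (rule nn_integral_mono)
      fix \<omega>
      let ?s = "\<sigma> (X i \<omega>)"
      show "(if 0 < ?s then ennreal (\<eta>0 (v / ?s)) * S (v * 2 ^ j / ?s) else 0) \<le> ennreal (d ^ j * ?Q) * ennreal (?w \<omega>)"
      proof (cases "0 < ?s")
        case True
        have "\<eta>0 (v / ?s) * S (v * 2 ^ j / ?s) \<le> (A1 * (1 + \<bar>?s\<bar>) powr r1 * \<eta>' v) * (A2 * (1 + \<bar>?s\<bar>) powr r2 * (d ^ j * S v))"
          using pot_\<eta>[OF True] pot_S[OF True, of j] True v S0 A \<eta>v \<eta>_nonneg by (intro mult_mono) (auto simp: \<eta>0)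
        also have "\<dots> = d ^ j * ?Q * ?w \<omega>" using True by (simp add: powr_add)
        finally have "\<eta>0 (v / ?s) * S (v * 2 ^ j / ?s) \<le> d ^ j * ?Q * ?w \<omega>" .
        then show ?thesis using True S0 Q0 d
          by (simp add: ennreal_mult''[symmetric] ennreal_mult[symmetric] ennreal_leI)
      qed simp
    qed
    also have "\<dots> = ennreal (d ^ j * ?Q) * ?Iw"
      by (rule nn_integral_cmult) measurable
    also have "\<dots> = ennreal (d ^ j) * (ennreal ?Q * ?Iw)"
      using Q0 d by (simp add: ennreal_mult mult.assoc)
    finally show "(\<integral>\<^sup>+\<omega>. ?E \<omega> * indicator {v * 2 ^ j<..} (obs (XZ \<omega>) i) \<partial>M) \<le> \<dots>" .
  qed auto
  also have "\<dots> = (\<Sum>j. ennreal (d ^ j)) * (ennreal ?Q * ?Iw)"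
    by (rule ennreal_suminf_multc)
  also have "(\<Sum>j. ennreal (d ^ j)) = ennreal (1 / (1 - d))"
    using d by (subst suminf_ennreal2) (auto simp: suminf_geometric summable_geometric)
  also have "?Iw = ennreal (expectation ?w)"
    by (rule nn_integral_eq_integral[OF mom]) simp
  also have "ennreal (1 / (1 - d)) * (ennreal ?Q * ennreal (expectation ?w)) = ennreal (K * (\<eta>' v * S v))"
    using d Q0 by (simp add: K_def ennreal_mult'[symmetric] ennreal_mult''[symmetric] mult_ac)
  finally have le: "(\<integral>\<^sup>+\<omega>. ennreal (g \<omega>) \<partial>M) \<le> ennreal (K * (\<eta>' v * S v))" .
  then show "integrable M g"
    using g0 by (intro integrableI_bounded) (auto intro: le_less_trans)
  then have "ennreal (expectation g) \<le> ennreal (K * (\<eta>' v * S v))"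
    using le g0 by (subst (asm) nn_integral_eq_integral) auto
  moreover have "0 \<le> K * (\<eta>' v * S v)" using A d \<eta>v S0 by (simp add: K_def)
  ultimately show "expectation g \<le> K * (\<eta>' v * S v)" by simp
qed

text \<open>The upper half of a weak form of Breiman's lemma; together with \<open>prob_exceedance_ge\<close> it shows that the tail of the observations
  is of the order of the tail of the noise.\<close>

lemma prob_exceedance_le:
  assumes pot_S: "\<And>s. 0 < s \<Longrightarrow> S (v / s) \<le> A2 * (1 + \<bar>s\<bar>) powr r2 * S v" and v: "v > 0" and A: "0 \<le> A2"
    and mom: "integrable M (\<lambda>\<omega>. (1 + \<sigma> (X i \<omega>)) powr r2)"
  shows "prob {\<omega>\<in>space M. v < obs (XZ \<omega>) i} \<le> A2 * expectation (\<lambda>\<omega>. (1 + \<sigma> (X i \<omega>)) powr r2) * S v"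
proof -
  have S0: "0 \<le> S z" for z by (simp add: S_def)
  let ?w = "\<lambda>\<omega>. (1 + \<sigma> (X i \<omega>)) powr r2"
  have "ennreal (prob {\<omega>\<in>space M. v < obs (XZ \<omega>) i}) = (\<integral>\<^sup>+\<omega>. indicator {\<omega>\<in>space M. v < obs (XZ \<omega>) i} \<omega> \<partial>M)"
    by (simp add: emeasure_eq_measure)
  also have "\<dots> = (\<integral>\<^sup>+\<omega>. 1 * indicator {v<..} (obs (XZ \<omega>) i) \<partial>M)"
    by (intro nn_integral_cong) (auto simp: indicator_def)
  also have "\<dots> = (\<integral>\<^sup>+\<omega>. (if 0 < \<sigma> (X i \<omega>) then 1 * ennreal (S (v / \<sigma> (X i \<omega>))) else 0) \<partial>M)"
    by (rule nn_integral_exceedance[of "\<lambda>_. 1"]) (use v in auto)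
  also have "\<dots> \<le> (\<integral>\<^sup>+\<omega>. ennreal (A2 * S v * ?w \<omega>) \<partial>M)"
  proof (rule nn_integral_mono)
    fix \<omega>
    let ?s = "\<sigma> (X i \<omega>)"
    show "(if 0 < ?s then 1 * ennreal (S (v / ?s)) else 0) \<le> ennreal (A2 * S v * ?w \<omega>)"
      using pot_S[of ?s] by (auto intro!: ennreal_leI simp: mult_ac)
  qed
  also have "\<dots> = ennreal (A2 * S v * expectation ?w)"
    using mom A S0 by (subst nn_integral_eq_integral) auto
  finally show ?thesis using A S0[of v] by (simp add: ennreal_le_iff mult_ac)
qed

end

section \<open>The Hill estimator\<close>

context sv_tail begin

text \<open>The increment bound with \<open>w = y / \<sigma>(X\<^sub>i)\<close> and \<open>z = Z\<^sub>i\<close>, for which \<open>z / w = Y\<^sub>i / y\<close>. Since \<open>y \<ge> v\<close> and \<open>\<eta>'\<close> is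
  nonincreasing, the random threshold \<open>y\<close> may be replaced by \<open>v\<close> in the error.\<close>

lemma hill_linearization:
  assumes incr: "\<And>w z. 0 < w \<Longrightarrow> w \<le> z \<Longrightarrow> \<bar>ln (S z / S w) + \<alpha> * ln (z / w)\<bar> \<le> C * \<eta>' w * ln (z / w)"
    and anti: "\<And>w z. 0 < w \<Longrightarrow> w \<le> z \<Longrightarrow> \<eta>' z \<le> \<eta>' w" and nonneg: "\<And>w. 0 < w \<Longrightarrow> 0 \<le> \<eta>' w"
    and C: "0 < C" and \<alpha>: "0 < \<alpha>" and v: "0 < v"
    and p: "p \<in> {1..int n}" and A: "A \<subseteq> {1..int n} - {p}" "card A = k" "0 < k"
    and ex: "exceed v {1..int n} p A (XZ \<omega>)"
  defines "g \<equiv> \<lambda>i. if v < obs (XZ \<omega>) i then (\<lambda>y. if 0 < y then \<eta>' y else 0) (v / \<sigma> (X i \<omega>)) * ln (obs (XZ \<omega>) i / v) else 0"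
  shows "\<bar>t * (sqrt k * (hill (obs (XZ \<omega>)) n k - 1 / \<alpha>)) -
      (t / (\<alpha> * sqrt k) * (\<Sum>i\<in>A. excess p (XZ \<omega>) i) + (- t * sqrt k / \<alpha>))\<bar>
    \<le> \<bar>t\<bar> * C / (\<alpha> * sqrt k) * (\<Sum>i\<in>{1..int n}. g i)"
proof -
  let ?I = "{1..int n}" and ?y = "obs (XZ \<omega>)"
  have top: "top_block ?I ?y p A" and vy: "v \<le> ?y p" using ex by (auto simp: exceed_def)
  have y0: "0 < ?y p" using v vy by simp
  have g0: "0 \<le> g i" for i using v nonneg by (auto simp: g_def)
  have g_ge: "\<bar>\<alpha> * ln (?y i / ?y p) - excess p (XZ \<omega>) i\<bar> \<le> C * g i" if i: "i \<in> A" for i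
  proof -
    have yi: "?y p < ?y i" using top i by (auto simp: top_block_def)
    have y_eq: "?y i = \<sigma> (X i \<omega>) * Z i \<omega>" by (rule obs_XZ)
    have s: "0 < \<sigma> (X i \<omega>)"
      using yi y0 \<sigma>_nonneg[of "X i \<omega>"] unfolding y_eq by (cases "\<sigma> (X i \<omega>) = 0") auto
    let ?w = "?y p / \<sigma> (X i \<omega>)"
    have w: "0 < ?w" "?w \<le> Z i \<omega>" using y0 s yi unfolding y_eq by (simp_all add: field_simps)
    have zw: "Z i \<omega> / ?w = ?y i / ?y p" using s unfolding y_eq by (simp add: field_simps)
    have "\<bar>\<alpha> * ln (?y i / ?y p) - excess p (XZ \<omega>) i\<bar> = \<bar>ln (S (Z i \<omega>) / S ?w) + \<alpha> * ln (Z i \<omega> / ?w)\<bar>"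
      unfolding zw by (simp add: excess_def XZ_def)
    also have "\<dots> \<le> C * \<eta>' ?w * ln (?y i / ?y p)" using incr[OF w] by (simp only: zw)
    also have "\<dots> \<le> C * \<eta>' (v / \<sigma> (X i \<omega>)) * ln (?y i / v)"
    proof (intro mult_mono mult_nonneg_nonneg)
      show "\<eta>' ?w \<le> \<eta>' (v / \<sigma> (X i \<omega>))" using v s vy by (intro anti divide_right_mono) auto
      show "ln (?y i / ?y p) \<le> ln (?y i / v)"
        using v vy y0 yi by (subst ln_le_cancel_iff) (auto intro!: divide_left_mono)
      show "0 \<le> \<eta>' (v / \<sigma> (X i \<omega>))" using v s by (intro nonneg) simp
    qed (use C y0 yi nonneg[OF w(1)] in auto)
    also have "\<dots> = C * g i" using v s vy yi by (simp add: g_def)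
    finally show ?thesis .
  qed
  have hill: "hill ?y n k = 1 / real k * (\<Sum>i\<in>A. ln (?y i / ?y p))"
    using hill_top_block[OF top A(1) p] A(2) by simp
  have sk: "sqrt k > 0" "sqrt k * sqrt k = real k" using A(3) by simp_all
  have "t * (sqrt k * (hill ?y n k - 1 / \<alpha>)) - (t / (\<alpha> * sqrt k) * (\<Sum>i\<in>A. excess p (XZ \<omega>) i) + (- t * sqrt k / \<alpha>))
     = t / (\<alpha> * sqrt k) * (\<Sum>i\<in>A. \<alpha> * ln (?y i / ?y p) - excess p (XZ \<omega>) i)"
    (is "?lhs = _")
  proof -
    have "sqrt k * (1 / real k) = 1 / sqrt k" using sk by (simp add: field_simps)
    then have "t * (sqrt k * hill ?y n k) = t * (1 / sqrt k) * (\<Sum>i\<in>A. ln (?y i / ?y p))"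
      unfolding hill mult.assoc[symmetric] by (simp only: mult.assoc)
    also have "\<dots> = t / (\<alpha> * sqrt k) * (\<Sum>i\<in>A. \<alpha> * ln (?y i / ?y p))"
      using \<alpha> by (simp add: sum_distrib_left[symmetric])
    finally show ?thesis by (simp add: sum_subtractf algebra_simps)
  qed
  then have "\<bar>?lhs\<bar> = \<bar>t\<bar> / (\<alpha> * sqrt k) * \<bar>\<Sum>i\<in>A. \<alpha> * ln (?y i / ?y p) - excess p (XZ \<omega>) i\<bar>"
    using \<alpha> sk by (simp only: abs_mult abs_divide abs_of_pos)
  also have "\<dots> \<le> \<bar>t\<bar> / (\<alpha> * sqrt k) * (C * (\<Sum>i\<in>?I. g i))"
  proof (rule mult_left_mono)
    have "\<bar>\<Sum>i\<in>A. \<alpha> * ln (?y i / ?y p) - excess p (XZ \<omega>) i\<bar> \<le> (\<Sum>i\<in>A. C * g i)"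
      by (rule order_trans[OF sum_abs sum_mono]) (rule g_ge)
    also have "\<dots> \<le> (\<Sum>i\<in>?I. C * g i)"
      using A C g0 by (intro sum_mono2) auto
    finally show "\<bar>\<Sum>i\<in>A. \<alpha> * ln (?y i / ?y p) - excess p (XZ \<omega>) i\<bar> \<le> C * (\<Sum>i\<in>?I. g i)"
      by (simp add: sum_distrib_left)
  qed (use \<alpha> sk in simp)
  finally show ?thesis by (simp add: mult_ac)
qed

lemma prob_exceedance_ge:
  assumes s0: "0 < s0" and v: "0 < v"
  shows "prob {\<omega>\<in>space M. s0 < \<sigma> (X i \<omega>)} * S (v / s0) \<le> prob {\<omega>\<in>space M. v < obs (XZ \<omega>) i}"
proof -
  have "prob {\<omega>\<in>space M. s0 < \<sigma> (X i \<omega>)} * S (v / s0) = expectation (\<lambda>\<omega>. indicator {s0<..} (\<sigma> (X i \<omega>)) * indicator {v / s0<..} (Z i \<omega>))"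
  proof -
    have "expectation (\<lambda>\<omega>. indicator {s0<..} (\<sigma> (X i \<omega>)) * indicator {v / s0<..} (Z i \<omega>)) =
       expectation (\<lambda>\<omega>. indicator {s0<..} (\<sigma> (X i \<omega>))) * measure \<nu> {v / s0<..}"
      using expectation_indicator_Z[of "\<lambda>p. indicator {s0<..} (\<sigma> (fst p i))" 1 i "{v / s0<..}"] by (simp add: indicator_le_1)
    moreover have "expectation (\<lambda>\<omega>. indicator {s0<..} (\<sigma> (X i \<omega>))) = expectation (indicat_real {\<omega>\<in>space M. s0 < \<sigma> (X i \<omega>)})"
      by (intro bochner_cong) (auto simp: indicator_def)
    ultimately show ?thesis by (simp add: S_def)
  qed
  also have "\<dots> \<le> expectation (indicat_real {\<omega>\<in>space M. v < obs (XZ \<omega>) i})"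
  proof (rule integral_mono)
    show "integrable M (\<lambda>\<omega>. indicator {s0<..} (\<sigma> (X i \<omega>)) * indicator {v / s0<..} (Z i \<omega>) :: real)"
      by (rule integrable_const_bound[of _ 1]) (auto simp: indicator_def)
    show "integrable M (indicat_real {\<omega>\<in>space M. v < obs (XZ \<omega>) i})"
      by (rule integrable_real_indicator) (simp_all add: emeasure_eq_measure)
    fix \<omega> assume w: "\<omega> \<in> space M"
    show "indicator {s0<..} (\<sigma> (X i \<omega>)) * indicator {v / s0<..} (Z i \<omega>) \<le> indicat_real {\<omega>\<in>space M. v < obs (XZ \<omega>) i} \<omega>"
    proof (cases "s0 < \<sigma> (X i \<omega>) \<and> v / s0 < Z i \<omega>")
      case True
      have "v = s0 * (v / s0)" using s0 by simp
      also have "\<dots> < \<sigma> (X i \<omega>) * Z i \<omega>" using True s0 v by (intro mult_strict_mono) auto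
      finally show ?thesis using w by (simp add: obs_XZ indicator_def)
    qed (auto simp: indicator_def)
  qed
  finally show ?thesis by simp
qed

end

lemma (in prob_space) ex_level_prob_pos:
  assumes [measurable]: "V \<in> borel_measurable M" and V0: "\<And>\<omega>. 0 \<le> V \<omega>" and pos: "0 < expectation (\<lambda>\<omega>. V \<omega> powr q)"
  obtains s :: real where "0 < s" "0 < prob {\<omega>\<in>space M. s < V \<omega>}"
proof (rule ccontr)
  assume neg: "\<not> thesis"
  have "AE \<omega> in M. V \<omega> \<le> 1 / real (Suc n)" for n
  proof -
    have "prob {\<omega>\<in>space M. 1 / real (Suc n) < V \<omega>} = 0"
      using neg that[of "1 / real (Suc n)"] measure_nonneg[of M "{\<omega>\<in>space M. 1 / real (Suc n) < V \<omega>}"] by (auto simp: less_le)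
    then have "{\<omega>\<in>space M. 1 / real (Suc n) < V \<omega>} \<in> null_sets M"
      by (intro null_setsI) (simp_all add: emeasure_eq_measure)
    then show ?thesis by (rule AE_I') auto
  qed
  then have "AE \<omega> in M. \<forall>n. V \<omega> \<le> 1 / real (Suc n)" by (simp add: AE_all_countable)
  then have "AE \<omega> in M. V \<omega> powr q = 0"
  proof eventually_elim
    case (elim \<omega>)
    have "V \<omega> \<le> 0"
      by (rule LIMSEQ_le_const[OF LIMSEQ_inverse_real_of_nat]) (use elim in \<open>auto simp: inverse_eq_divide\<close>)
    then show ?case using V0[of \<omega>] by simp
  qed
  then have "expectation (\<lambda>\<omega>. V \<omega> powr q) = 0" by (subst integral_cong_AE[where g = "\<lambda>_. 0"]) auto
  with pos show False by simp
qed

lemma one_plus_powr_le: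
  assumes "0 \<le> (s::real)" "m \<le> q" "0 \<le> q"
  shows "(1 + s) powr m \<le> 2 powr q * (1 + s powr q)"
proof -
  have "(1 + s) powr m \<le> (1 + s) powr q" using assms by (intro powr_mono) auto
  also have "\<dots> \<le> (2 * max 1 s) powr q" using assms by (intro powr_mono2) auto
  also have "\<dots> = 2 powr q * max 1 s powr q" using assms by (simp add: powr_mult)
  also have "\<dots> \<le> 2 powr q * (1 + s powr q)"
    using assms by (intro mult_left_mono) (auto simp: max_def)
  finally show ?thesis .
qed

theorem corollary2p7:
  fixes M :: "'a measure"
    and X Z Y :: "int \<Rightarrow> 'a \<Rightarrow> real"
    and \<sigma> L L0 \<eta>' F U :: "real \<Rightarrow> real"
    and H \<alpha> \<beta> \<epsilon> \<gamma> :: real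
    and k :: "nat \<Rightarrow> nat"
    and u :: "nat \<Rightarrow> real"
  assumes "prob_space M"
    and "gaussian_process M X" and "stationary_process M X"
    and "\<And>i. prob_space.expectation M (X i) = 0"
    and "\<And>i. prob_space.variance M (X i) = 1"
    and "1 / 2 < H" and "H < 1" and "slowly_varying L0"
    and "\<And>j. j \<noteq> 0 \<Longrightarrow>
          covariance M (X 0) (X j) = \<bar>real_of_int j\<bar> powr (2 * H - 2) * L0 \<bar>real_of_int j\<bar>"
    and "\<sigma> \<in> borel_measurable borel" and "\<And>x. \<sigma> x \<ge> 0"
    and "prob_space.indep_vars M (\<lambda>_. borel) Z UNIV"
    and "\<And>i. distr M borel (Z i) = distr M borel (Z 1)"
    and "prob_space.indep_var M
           (Pi\<^sub>M UNIV (\<lambda>_. borel)) (\<lambda>\<omega> i. X i \<omega>)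
           (Pi\<^sub>M UNIV (\<lambda>_. borel)) (\<lambda>\<omega> i. Z i \<omega>)"
    and "\<alpha> > 0" and "slowly_varying L"
    and "\<And>x. x > 0 \<Longrightarrow> upper_tail M (Z 1) x = x powr (- \<alpha>) * L x"
    and "Y = (\<lambda>i \<omega>. \<sigma> (X i \<omega>) * Z i \<omega>)"
    and "F = cdf (distr M borel (Y 1))"
    and "U = tail_quantile F"
    and "filterlim k at_top sequentially"
    and "filterlim (\<lambda>n. real n / real (k n)) at_top sequentially"
    and "u = (\<lambda>n. U (real n / real (k n)))"
    and "\<forall>\<^sub>F n in sequentially. real (k n) = real n * (1 - F (u n))"
    and "assumption_H M \<sigma> (Z 1) \<alpha> u"
    and "assumption_SO (upper_tail M (Z 1)) \<alpha> \<beta> \<eta>'"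
    and "\<epsilon> > 0"
    and "integrable M (\<lambda>\<omega>. \<sigma> (X 1 \<omega>) powr (2 * \<alpha> * (\<beta> + 1) + \<epsilon>))"
    and "0 < prob_space.expectation M (\<lambda>\<omega>. \<sigma> (X 1 \<omega>) powr (2 * \<alpha> * (\<beta> + 1) + \<epsilon>))"
    and "(\<lambda>n. sqrt (real (k n)) * \<eta>' (U (real n / real (k n)))) \<longlonglongrightarrow> 0"
    and "\<gamma> = 1 / \<alpha>"
  shows "weak_conv_m
           (\<lambda>n. distr M borel (\<lambda>\<omega>. sqrt (real (k n)) * (hill (\<lambda>i. Y i \<omega>) n (k n) - \<gamma>)))
           (density lborel (normal_density 0 \<gamma>))"
proof -
  interpret prob_space M by (rule assms(1))
  have X_meas: "X i \<in> borel_measurable M" for i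
    using assms(2) by (simp add: gaussian_process_def)
  interpret sv_model M X Z \<sigma>
    by unfold_locales (rule X_meas assms(10,11,12,13,14))+
  have SO: "assumption_SO S \<alpha> \<beta> \<eta>'" unfolding S_upper_tail by (rule assms(26))
  obtain C where C: "0 < C" and S_pos: "\<And>z. 0 < z \<Longrightarrow> 0 < S z"
    and incr: "\<And>w z. 0 < w \<Longrightarrow> w \<le> z \<Longrightarrow> \<bar>ln (S z / S w) + \<alpha> * ln (z / w)\<bar> \<le> C * \<eta>' w * ln (z / w)"
    using assumption_SO_log_increment[OF SO] by metis
  interpret sv_tail M X Z \<sigma>
    by unfold_locales (rule assumption_SO_continuous[OF SO], rule S_pos)

  have \<alpha>: "0 < \<alpha>" and \<beta>: "0 \<le> \<beta>" and \<epsilon>: "0 < \<epsilon>" using assms(15,27) SO by (simp_all add: assumption_SO_def)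
  define q where "q = 2 * \<alpha> * (\<beta> + 1) + \<epsilon>"
  \<comment> \<open>\<open>r1\<close> and \<open>r2\<close> exceed the indices of \<open>\<eta>'\<close> and \<open>S\<close> by \<open>\<alpha> / 2\<close>; their sum is still at most the
     order \<open>q\<close> of the available moment.\<close>
  define r1 where "r1 = \<alpha> * \<beta> + \<alpha> / 2"
  define r2 where "r2 = 3 * \<alpha> / 2"
  have q0: "0 \<le> q" using \<alpha> \<beta> \<epsilon> by (simp add: q_def)
  have rq: "r1 + r2 \<le> q" "r2 \<le> q"
  proof -
    have "0 \<le> \<alpha> * \<beta>" using \<alpha> \<beta> by simp
    then show "r1 + r2 \<le> q" "r2 \<le> q" using \<alpha> \<epsilon> by (simp_all add: q_def r1_def r2_def algebra_simps)
  qed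

  have rv_S: "regularly_varying (- \<alpha>) S"
    by (rule regularly_varying_powr_mult[OF assms(16)]) (simp add: S_upper_tail assms(17))
  have rv_\<eta>: "regularly_varying (- (\<alpha> * \<beta>)) \<eta>'" using SO by (simp add: assumption_SO_def)
  have \<eta>_anti: "\<eta>' z \<le> \<eta>' w" if "0 < w" "w \<le> z" for w z
  proof -
    have "antimono_on {0..} \<eta>'" using SO unfolding assumption_SO_def by blast
    from monotone_onD[OF this, of w z] that show ?thesis by simp
  qed
  obtain B where B: "\<And>x. 0 < x \<Longrightarrow> \<eta>' x \<le> B"
    using SO unfolding assumption_SO_def bounded_iff by (force simp: abs_le_iff)
  have S_le_1: "S z \<le> 1" and S_nonneg: "0 \<le> S z" for z by (simp_all add: S_def)
  have r1: "\<alpha> * \<beta> < r1" and r2: "\<alpha> < r2" using \<alpha> by (simp_all add: r1_def r2_def)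
  obtain A1 x1 where A1: "1 \<le> A1" "0 < x1" and \<eta>_pos: "\<forall>x\<ge>x1. 0 < \<eta>' x"
    and pot_\<eta>: "\<forall>x\<ge>x1. \<forall>s>0. \<eta>' (x / s) \<le> A1 * (1 + \<bar>s\<bar>) powr r1 * \<eta>' x"
    using regularly_varying_potter[OF rv_\<eta> \<eta>_anti B r1] .
  obtain A2 x2 where A2: "1 \<le> A2" "0 < x2" and "\<forall>x\<ge>x2. 0 < S x"
    and pot_S: "\<forall>x\<ge>x2. \<forall>s>0. S (x / s) \<le> A2 * (1 + \<bar>s\<bar>) powr r2 * S x"
    using regularly_varying_potter[OF rv_S tail.S_antimono S_le_1 r2] .
  define d where "d = 2 powr (- (\<alpha> / 2))"
  have d: "0 < d" "d < 1" using \<alpha> by (simp_all add: d_def powr_less_one)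
  obtain x3 where x3: "0 < x3" and decay: "\<forall>x\<ge>x3. \<forall>m. S (x * 2 ^ m) \<le> d ^ m * S x"
    using regularly_varying_double_decay[OF rv_S, of "\<alpha> / 2", folded d_def] \<alpha> by auto
  define xx where "xx = max x1 (max x2 x3)"
  have xx: "0 < xx" "x1 \<le> xx" "x2 \<le> xx" "x3 \<le> xx" using A1 by (auto simp: xx_def)
  have \<eta>_nonneg: "0 \<le> \<eta>' y" if "0 < y" for y
    using \<eta>_pos[rule_format, of "max x1 y"] \<eta>_anti[of y "max x1 y"] that by simp
  have pot_S2: "S (x * 2 ^ m / s) \<le> A2 * (1 + \<bar>s\<bar>) powr r2 * (d ^ m * S x)" if "xx \<le> x" "0 < s" for x s m
  proof -
    have "x * 1 \<le> x * 2 ^ m" using that xx by (intro mult_left_mono) auto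
    then have "x2 \<le> x * 2 ^ m" using that xx by linarith
    then have "S (x * 2 ^ m / s) \<le> A2 * (1 + \<bar>s\<bar>) powr r2 * S (x * 2 ^ m)" using that by (intro pot_S[rule_format])
    also have "\<dots> \<le> A2 * (1 + \<bar>s\<bar>) powr r2 * (d ^ m * S x)"
      using decay[rule_format, of x m] that xx A2 by (intro mult_left_mono) auto
    finally show ?thesis .
  qed

  have mom1: "integrable M (\<lambda>\<omega>. (1 + \<sigma> (X 1 \<omega>)) powr m)" if "m \<le> q" for m
  proof (rule Bochner_Integration.integrable_bound)
    show "integrable M (\<lambda>\<omega>. 2 powr q * (1 + \<sigma> (X 1 \<omega>) powr q))"
      using assms(28) unfolding q_def by simp
    show "AE \<omega> in M. norm ((1 + \<sigma> (X 1 \<omega>)) powr m) \<le> norm (2 powr q * (1 + \<sigma> (X 1 \<omega>) powr q))"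
      using one_plus_powr_le[OF \<sigma>_nonneg that q0] by (auto simp: abs_mult)
  qed simp
  have marg: "distr M borel (X i) = distr M borel (X 1)" for i
    by (rule stationary_process_marginal[OF assms(3) X_meas])
  have mom: "integrable M (\<lambda>\<omega>. (1 + \<sigma> (X i \<omega>)) powr m)"
    and mom_eq: "expectation (\<lambda>\<omega>. (1 + \<sigma> (X i \<omega>)) powr m) = expectation (\<lambda>\<omega>. (1 + \<sigma> (X 1 \<omega>)) powr m)"
    if "m \<le> q" for i m
  proof -
    have "integrable (distr M borel (X 1)) (\<lambda>x. (1 + \<sigma> x) powr m)"
      using mom1[OF that] by (subst integrable_distr_eq) simp_all
    then have "integrable (distr M borel (X i)) (\<lambda>x. (1 + \<sigma> x) powr m)" by (simp only: marg[of i])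
    then show "integrable M (\<lambda>\<omega>. (1 + \<sigma> (X i \<omega>)) powr m)" by (subst (asm) integrable_distr_eq) simp_all
    have "(LINT x|distr M borel (X i). (1 + \<sigma> x) powr m) = (LINT x|distr M borel (X 1). (1 + \<sigma> x) powr m)"
      by (simp only: marg[of i])
    then show "expectation (\<lambda>\<omega>. (1 + \<sigma> (X i \<omega>)) powr m) = expectation (\<lambda>\<omega>. (1 + \<sigma> (X 1 \<omega>)) powr m)"
      by (simp add: integral_distr)
  qed

  obtain s0 where s0: "0 < s0" and p1: "0 < prob {\<omega>\<in>space M. s0 < \<sigma> (X 1 \<omega>)}"
    using ex_level_prob_pos[of "\<lambda>\<omega>. \<sigma> (X 1 \<omega>)" q] assms(29) \<sigma>_nonneg unfolding q_def by auto
  define A where "A = {x. s0 < \<sigma> x}"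
  have A[measurable]: "A \<in> sets borel" unfolding A_def by measurable
  define p0 where "p0 = prob {\<omega>\<in>space M. X 0 \<omega> \<in> A}"
  have prob_A: "prob {\<omega>\<in>space M. X i \<omega> \<in> A} = p0" for i
  proof -
    have "measure (distr M borel (X i)) A = measure (distr M borel (X 0)) A" by (simp only: marg[of i] marg[of 0])
    then show ?thesis by (simp add: p0_def measure_distr vimage_def Int_def conj_commute)
  qed
  have p0: "0 < p0" using p1 prob_A[of 1] by (simp add: A_def)
  have cov0: "(\<lambda>j. covariance M (X 0) (X (int j))) \<longlonglongrightarrow> 0"
  proof -
    have "regularly_varying (- (2 - 2 * H)) (\<lambda>x. x powr (2 * H - 2) * L0 x)"
      using regularly_varying_powr_mult[OF assms(8), of _ "2 * H - 2"] by simp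
    then have "((\<lambda>x. x powr (2 * H - 2) * L0 x) \<longlongrightarrow> 0) at_top"
      by (rule regularly_varying_negative_index_tendsto_0) (use assms(7) in simp)
    from filterlim_compose[OF this filterlim_real_sequentially]
    have "(\<lambda>j. real j powr (2 * H - 2) * L0 (real j)) \<longlonglongrightarrow> 0" .
    moreover have "\<forall>\<^sub>F j in sequentially. real j powr (2 * H - 2) * L0 (real j) = covariance M (X 0) (X (int j))"
      using eventually_gt_at_top[of 0] by eventually_elim (simp add: assms(9))
    ultimately show ?thesis by (rule Lim_transform_eventually)
  qed
  note mixing = gaussian_process_asymptotic_independence[OF assms(2,4,5) cov0 A, folded p0_def]

  let ?Fbar = "\<lambda>x. prob {\<omega>\<in>space M. x < obs (XZ \<omega>) 1}"
  have Y_obs: "(\<lambda>i. Y i \<omega>) = obs (XZ \<omega>)" for \<omega> by (rule ext) (simp add: obs_XZ assms(18))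
  have Fbar: "1 - F x = ?Fbar x" for x
  proof -
    have "F x = prob {\<omega>\<in>space M. obs (XZ \<omega>) 1 \<le> x}"
      using assms(19) by (simp add: assms(18) cdf_def measure_distr vimage_def Int_def conj_commute obs_XZ)
    moreover have "{\<omega>\<in>space M. x < obs (XZ \<omega>) 1} = space M - {\<omega>\<in>space M. obs (XZ \<omega>) 1 \<le> x}" by auto
    ultimately show ?thesis by (simp add: prob_compl)
  qed
  have k_top: "filterlim (\<lambda>n. real (k n)) at_top sequentially"
    by (rule filterlim_compose[OF filterlim_real_sequentially assms(21)])
  have ev_k: "\<forall>\<^sub>F n in sequentially. 0 < k n"
  proof -
    have "\<forall>\<^sub>F n in sequentially. 1 \<le> k n" using assms(21) unfolding filterlim_at_top by blast
    then show ?thesis by eventually_elim simp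
  qed
  have ev_F: "\<forall>\<^sub>F n in sequentially. ?Fbar (u n) = real (k n) / real n"
    using assms(24) eventually_gt_at_top[of 0] by eventually_elim (simp add: Fbar)
  have kn0: "(\<lambda>n. real (k n) / real n) \<longlonglongrightarrow> 0"
    using tendsto_inverse_0_at_top[OF assms(22)] by simp
  \<comment> \<open>The tail of \<open>Y\<close> is positive everywhere and equals \<open>k / n \<rightarrow> 0\<close> at \<open>u n\<close>.\<close>
  have u_top: "filterlim u at_top sequentially"
    unfolding filterlim_at_top_dense
  proof
    fix B :: real
    define B' where "B' = max B 1"
    have "0 < p0 * S (B' / s0)" using p0 s0 by (intro mult_pos_pos S_pos) (auto simp: B'_def)
    also have "\<dots> \<le> ?Fbar B'"
      using prob_exceedance_ge[OF s0, of B' 1] prob_A[of 1] by (simp add: A_def B'_def)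
    finally have "\<forall>\<^sub>F n in sequentially. real (k n) / real n < ?Fbar B'" using order_tendstoD(2)[OF kn0] by blast
    with ev_F show "\<forall>\<^sub>F n in sequentially. B < u n"
    proof eventually_elim
      case (elim n)
      show ?case
      proof (rule ccontr)
        assume "\<not> B < u n"
        then have "u n \<le> B'" by (simp add: B'_def)
        then have "?Fbar B' \<le> ?Fbar (u n)" by (intro finite_measure_mono) auto
        then show False using elim by simp
      qed
    qed
  qed

  define K2 where "K2 = A2 * expectation (\<lambda>\<omega>. (1 + \<sigma> (X 1 \<omega>)) powr r2)"
  have K2: "?Fbar x \<le> K2 * S x" if "xx \<le> x" for x
    unfolding K2_def using that xx A2 pot_S mom1[OF rq(2)] by (intro prob_exceedance_le) auto
  \<comment> \<open>\<open>m\<close> is so large that \<open>S (u / 2 ^ m)\<close> is at least \<open>2 / p0\<close> times the tail of \<open>Y\<close> at \<open>u\<close>. Then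
     \<open>n S (a n) p0\<close>, the expected number of indices with volatility above \<open>s0\<close> and noise above \<open>a n\<close>,
     is at least \<open>2 k\<close>, and all of these observations exceed \<open>v n = s0 * a n\<close>.\<close>
  obtain m where m: "d ^ m * (2 * K2 / p0) \<le> 1"
  proof -
    have "(\<lambda>m. d ^ m * (2 * K2 / p0)) \<longlonglongrightarrow> 0 * (2 * K2 / p0)"
      using d by (intro tendsto_intros LIMSEQ_power_zero) auto
    then have "\<forall>\<^sub>F m in sequentially. d ^ m * (2 * K2 / p0) < 1" by (intro order_tendstoD(2)[of _ 0]) simp_all
    then obtain m where "d ^ m * (2 * K2 / p0) < 1" unfolding eventually_sequentially by blast
    then show thesis by (intro that[of m]) simp
  qed
  define a where "a n = u n / 2 ^ m" for n
  define v where "v n = s0 * a n" for n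
  let ?T = "\<lambda>n \<omega>. {i\<in>{1..int n}. X i \<omega> \<in> A \<and> a n < Z i \<omega>}"
  let ?V = "\<lambda>n \<omega>. {i\<in>{1..int n}. v n \<le> obs (XZ \<omega>) i}"
  have a_top: "filterlim a at_top sequentially"
    unfolding a_def[abs_def] divide_inverse
    by (rule filterlim_at_top_mult_tendsto_pos[OF tendsto_const _ u_top]) simp
  have v_top: "filterlim v at_top sequentially"
    unfolding v_def[abs_def] by (rule filterlim_tendsto_pos_mult_at_top[OF tendsto_const s0 a_top])
  have ev_large: "\<forall>\<^sub>F n in sequentially. xx \<le> u n \<and> xx \<le> a n \<and> xx \<le> v n \<and> xx \<le> u n / s0"
  proof -
    have "filterlim (\<lambda>n. u n / s0) at_top sequentially"
      unfolding divide_inverse by (rule filterlim_at_top_mult_tendsto_pos[OF tendsto_const _ u_top]) (use s0 in simp)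
    then show ?thesis using u_top a_top v_top unfolding filterlim_at_top by (auto simp: eventually_conj_iff)
  qed

  have count_ge: "\<forall>\<^sub>F n in sequentially. real (k n) \<le> real n * S (a n) * (p0 / 2)"
    using ev_F ev_large eventually_gt_at_top[of 0]
  proof eventually_elim
    case (elim n)
    have "real (k n) / real n \<le> K2 * S (u n)" using K2[of "u n"] elim by simp
    also have "S (u n) \<le> d ^ m * S (a n)" using decay[rule_format, of "a n" m] elim xx by (simp add: a_def)
    then have "K2 * S (u n) \<le> K2 * (d ^ m * S (a n))"
      using A2 by (intro mult_left_mono) (auto simp: K2_def)
    also have "K2 * (d ^ m * S (a n)) = (d ^ m * (2 * K2 / p0)) * (S (a n) * (p0 / 2))" using p0 by simp
    also have "\<dots> \<le> 1 * (S (a n) * (p0 / 2))" using m S_nonneg p0 by (intro mult_right_mono) auto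
    finally show ?case using elim(3) by (simp add: field_simps)
  qed
  have count_top: "filterlim (\<lambda>n. real n * measure \<nu> {a n<..}) at_top sequentially"
  proof -
    have "filterlim (\<lambda>n. (2 / p0) * real (k n)) at_top sequentially"
      by (rule filterlim_tendsto_pos_mult_at_top[OF tendsto_const _ k_top]) (use p0 in simp)
    moreover have "\<forall>\<^sub>F n in sequentially. (2 / p0) * real (k n) \<le> real n * measure \<nu> {a n<..}"
      using count_ge by eventually_elim (use p0 in \<open>simp add: S_def field_simps\<close>)
    ultimately show ?thesis by (rule filterlim_at_top_mono)
  qed
  \<comment> \<open>The probability that the threshold may lie below \<open>v n\<close>.\<close>
  define bad where "bad n = prob {\<omega>\<in>space M. card (?V n \<omega>) \<le> k n}" for n
  have bad0: "bad \<longlonglongrightarrow> 0"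
  proof (rule tendsto_sandwich[OF _ _ tendsto_const])
    let ?P = "\<lambda>n. prob {\<omega>\<in>space M. real (card (?T n \<omega>)) \<le> real n * measure \<nu> {a n<..} * (p0 / 2)}"
    show "?P \<longlonglongrightarrow> 0"
      unfolding p0_def by (rule count_lower_bound[OF assms(3) A _ _ count_top]) (use p0 mixing in \<open>simp_all add: p0_def\<close>)
    show "\<forall>\<^sub>F n in sequentially. 0 \<le> bad n" by (simp add: bad_def)
    show "\<forall>\<^sub>F n in sequentially. bad n \<le> ?P n"
      using count_ge ev_large
    proof eventually_elim
      case (elim n)
      have cm: "(\<lambda>\<omega>. real (card (?T n \<omega>))) \<in> borel_measurable M"
        by (subst card_eq_sum_indicators) measurable
      show ?case unfolding bad_def
      proof (rule finite_measure_mono)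
        show "{\<omega>\<in>space M. real (card (?T n \<omega>)) \<le> real n * measure \<nu> {a n<..} * (p0 / 2)} \<in> events"
          using cm by measurable
        show "{\<omega>\<in>space M. card (?V n \<omega>) \<le> k n} \<subseteq>
          {\<omega>\<in>space M. real (card (?T n \<omega>)) \<le> real n * measure \<nu> {a n<..} * (p0 / 2)}"
        proof safe
          fix \<omega> assume c: "card (?V n \<omega>) \<le> k n"
          have a0: "0 < a n" using elim xx by linarith
          have "v n \<le> obs (XZ \<omega>) i" if "X i \<omega> \<in> A" "a n < Z i \<omega>" for i
            unfolding v_def obs_XZ using that s0 a0 by (intro mult_mono) (auto simp: A_def)
          then have "(?T n \<omega>) \<subseteq> (?V n \<omega>)" by blast
          then have "card (?T n \<omega>) \<le> card (?V n \<omega>)"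
            by (rule card_mono[rotated]) (rule finite_subset[of _ "{1..int n}"], auto)
          then have "real (card (?T n \<omega>)) \<le> real (k n)" using c by simp
          then show "real (card (?T n \<omega>)) \<le> real n * measure \<nu> {a n<..} * (p0 / 2)"
            using elim by (simp add: S_def)
        qed
      qed
    qed
  qed

  define \<eta>0 where "\<eta>0 = (\<lambda>y. if 0 < y then \<eta>' y else 0)"
  have \<eta>0_meas: "\<eta>0 \<in> borel_measurable borel"
  proof -
    have "\<eta>' \<in> borel_measurable (restrict_space borel {0<..})" using rv_\<eta> by (simp add: regularly_varying_def)
    then have "(\<lambda>y. indicator {0<..} y *\<^sub>R \<eta>' y) \<in> borel_measurable borel"
      by (subst (asm) borel_measurable_restrict_space_iff) auto
    also have "(\<lambda>y. indicator {0<..} y *\<^sub>R \<eta>' y) = \<eta>0" by (auto simp: \<eta>0_def indicator_def)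
    finally show ?thesis .
  qed
  define g where "g n i \<omega> = (if v n < obs (XZ \<omega>) i then \<eta>0 (v n / \<sigma> (X i \<omega>)) * ln (obs (XZ \<omega>) i / v n) else 0)" for n i \<omega>
  define K where "K = A1 * A2 * (1 / (1 - d)) * expectation (\<lambda>\<omega>. (1 + \<sigma> (X 1 \<omega>)) powr (r1 + r2))"
  have K0: "0 \<le> K" using A1 A2 d by (simp add: K_def)
  have g_bounds: "integrable M (g n i)" "expectation (g n i) \<le> K * (\<eta>' (v n) * S (v n))" "\<And>\<omega>. 0 \<le> g n i \<omega>"
    if v: "xx \<le> v n" for n i
  proof -
    have v0: "0 < v n" using v xx by linarith
    have A12: "0 \<le> A1" "0 \<le> A2" using A1 A2 by simp_all
    have pe: "\<eta>' (v n / s) \<le> A1 * (1 + \<bar>s\<bar>) powr r1 * \<eta>' (v n)" if "0 < s" for s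
      using pot_\<eta> v xx that by simp
    show "integrable M (g n i)" "expectation (g n i) \<le> K * (\<eta>' (v n) * S (v n))" "\<And>\<omega>. 0 \<le> g n i \<omega>"
      using expectation_weighted_log_excess[where \<eta>' = \<eta>' and v = "v n" and i = i,
          OF \<eta>0_def \<eta>0_meas \<eta>_nonneg pe pot_S2[OF v] v0 A12 d mom[OF rq(1)]]
      unfolding g_def[abs_def] K_def mom_eq[OF rq(1), of i] by simp_all
  qed

  \<comment> \<open>\<open>u n\<close> and \<open>v n\<close> differ by a constant factor, and \<open>S (u n)\<close> is at most a multiple of \<open>k / n\<close>.\<close>
  define K3 where "K3 = A1 * (1 + 2 ^ m / s0) powr r1 * (A2 * (1 + 2 ^ m / s0) powr r2 * (A2 * (1 + 1 / s0) powr r2 / p0))"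
  have err_bound: "\<forall>\<^sub>F n in sequentially. \<eta>' (v n) * S (v n) \<le> K3 * (\<eta>' (u n) * (real (k n) / real n))"
    using ev_large ev_F
  proof eventually_elim
    case (elim n)
    have u0: "0 < u n" "0 < v n" using elim xx by linarith+
    have v_eq: "v n = u n / (2 ^ m / s0)" using s0 by (simp add: v_def a_def)
    have 1: "\<eta>' (v n) \<le> A1 * (1 + 2 ^ m / s0) powr r1 * \<eta>' (u n)"
      unfolding v_eq using pot_\<eta>[rule_format, of "u n" "2 ^ m / s0"] elim xx s0 by simp
    have 2: "S (v n) \<le> A2 * (1 + 2 ^ m / s0) powr r2 * S (u n)"
      unfolding v_eq using pot_S[rule_format, of "u n" "2 ^ m / s0"] elim xx s0 by simp
    have "S (u n) = S ((u n / s0) / (1 / s0))" using s0 by simp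
    also have "\<dots> \<le> A2 * (1 + \<bar>1 / s0\<bar>) powr r2 * S (u n / s0)"
      using elim xx s0 by (intro pot_S[rule_format]) auto
    also have "S (u n / s0) \<le> (real (k n) / real n) / p0"
    proof -
      have "p0 * S (u n / s0) \<le> real (k n) / real n"
        using prob_exceedance_ge[OF s0 u0(1), of 1] prob_A[of 1] elim by (simp add: A_def)
      then show ?thesis by (subst pos_le_divide_eq[OF p0]) (simp only: mult.commute)
    qed
    then have "A2 * (1 + \<bar>1 / s0\<bar>) powr r2 * S (u n / s0) \<le> A2 * (1 + \<bar>1 / s0\<bar>) powr r2 * ((real (k n) / real n) / p0)"
      using A2 by (intro mult_left_mono) auto
    finally have 3: "S (u n) \<le> A2 * (1 + 1 / s0) powr r2 / p0 * (real (k n) / real n)" using s0 by (simp add: mult_ac)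
    have "S (v n) \<le> A2 * (1 + 2 ^ m / s0) powr r2 * (A2 * (1 + 1 / s0) powr r2 / p0 * (real (k n) / real n))"
      by (rule order_trans[OF 2 mult_left_mono[OF 3]]) (use A2 in simp)
    then have "\<eta>' (v n) * S (v n) \<le> (A1 * (1 + 2 ^ m / s0) powr r1 * \<eta>' (u n)) *
        (A2 * (1 + 2 ^ m / s0) powr r2 * (A2 * (1 + 1 / s0) powr r2 / p0 * (real (k n) / real n)))"
      using 1 S_nonneg A1 \<eta>_nonneg[OF u0(1)] by (intro mult_mono) auto
    then show ?case by (simp add: K3_def mult_ac)
  qed

  define W where "W n \<omega> = sqrt (real (k n)) * (hill (obs (XZ \<omega>)) n (k n) - \<gamma>)" for n \<omega>
  have W_meas[measurable]: "W n \<in> borel_measurable M" for n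
    unfolding W_def using borel_measurable_hill[of "\<lambda>i \<omega>. obs (XZ \<omega>) i" M n "k n", OF obs_XZ_measurable] by measurable
  have \<gamma>: "0 < \<gamma>" "\<gamma> = 1 / \<alpha>" using assms(31) \<alpha> by simp_all

  have char_lim: "(\<lambda>n. (CLINT \<omega>|M. iexp (t * W n \<omega>))) \<longlonglongrightarrow> complex_of_real (exp (- ((t * \<gamma>)\<^sup>2 / 2)))" for t
  proof -
    define x where "x n = t * \<gamma> / sqrt (real (k n))" for n
    have main: "(\<lambda>n. (iexp (- x n) / (1 - \<i> * complex_of_real (x n))) ^ k n) \<longlonglongrightarrow> complex_of_real (exp (- ((t * \<gamma>)\<^sup>2 / 2)))"
      unfolding x_def using filterlim_compose[OF exponential_clt_limit[of "t * \<gamma>"] assms(21)] .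
    define err where "err n = \<bar>t\<bar> * C / \<alpha> * K * K3 * (sqrt (real (k n)) * \<eta>' (u n)) + 2 * bad n" for n
    have "err \<longlonglongrightarrow> \<bar>t\<bar> * C / \<alpha> * K * K3 * 0 + 2 * 0"
      unfolding err_def[abs_def] using assms(30) bad0 unfolding assms(23)[symmetric, THEN fun_cong]
      by (intro tendsto_intros) (simp_all add: assms(23))
    then have err0: "err \<longlonglongrightarrow> 0" by simp
    have close: "\<forall>\<^sub>F n in sequentially. cmod ((CLINT \<omega>|M. iexp (t * W n \<omega>)) - (iexp (- x n) / (1 - \<i> * complex_of_real (x n))) ^ k n) \<le> err n"
      using ev_large ev_k err_bound eventually_gt_at_top[of 0]
    proof eventually_elim
      case (elim n)
      have v: "xx \<le> v n" "0 < v n" using elim xx by linarith+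
      let ?c = "\<bar>t\<bar> * C / (\<alpha> * sqrt (real (k n)))"
      let ?R = "\<lambda>\<omega>. ?c * (\<Sum>i\<in>{1..int n}. g n i \<omega>)"
      let ?d = "- t * sqrt (real (k n)) / \<alpha>"
      have c0: "0 \<le> ?c" using C \<alpha> by simp
      have R_int: "integrable M ?R" using g_bounds(1)[OF v(1)] by (intro integrable_mult_right Bochner_Integration.integrable_sum) auto
      have "cmod ((CLINT \<omega>|M. iexp (t * W n \<omega>)) - iexp ?d * (1 / (1 - \<i> * complex_of_real (t / (\<alpha> * sqrt (real (k n)))))) ^ k n)
          \<le> expectation ?R + 2 * bad n"
        unfolding bad_def
      proof (rule char_approx_by_excesses[OF _ R_int _ v(2)])
        show "(\<lambda>\<omega>. t * W n \<omega>) \<in> borel_measurable M" by measurable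
        show "0 \<le> ?R \<omega>" for \<omega> using g_bounds(3)[OF v(1)] c0 by (intro mult_nonneg_nonneg sum_nonneg) auto
        fix \<omega> p A
        assume "p \<in> {1..int n}" "A \<subseteq> {1..int n} - {p}" "card A = k n" "exceed (v n) {1..int n} p A (XZ \<omega>)"
        then show "\<bar>t * W n \<omega> - (t / (\<alpha> * sqrt (real (k n))) * (\<Sum>i\<in>A. excess p (XZ \<omega>) i) + ?d)\<bar> \<le> ?R \<omega>"
          using hill_linearization[OF incr \<eta>_anti \<eta>_nonneg C \<alpha> v(2), of p n A "k n" \<omega> t] elim
          unfolding W_def \<gamma>(2) g_def \<eta>0_def by simp
      qed
      moreover have "iexp ?d * (1 / (1 - \<i> * complex_of_real (t / (\<alpha> * sqrt (real (k n)))))) ^ k n =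
         (iexp (- x n) / (1 - \<i> * complex_of_real (x n))) ^ k n"
      proof -
        have x_eq: "t / (\<alpha> * sqrt (real (k n))) = x n" by (simp add: x_def \<gamma>(2))
        have "real (k n) * - x n = - (t / \<alpha>) * (real (k n) / sqrt (real (k n)))" by (simp add: x_def \<gamma>(2))
        also have "\<dots> = ?d" by (subst real_div_sqrt) simp_all
        finally have "iexp ?d = exp (of_nat (k n) * (\<i> * complex_of_real (- x n)))"
          by (metis (no_types, lifting) mult.left_commute of_real_mult of_real_of_nat_eq)
        also have "\<dots> = iexp (- x n) ^ k n" by (rule exp_of_nat_mult)
        finally have "iexp ?d = iexp (- x n) ^ k n" .
        then show ?thesis unfolding x_eq by (simp only: power_divide power_one times_divide_eq_right mult_1_right)
      qed
      moreover have "expectation ?R \<le> \<bar>t\<bar> * C / \<alpha> * K * K3 * (sqrt (real (k n)) * \<eta>' (u n))"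
      proof -
        have "expectation ?R = ?c * (\<Sum>i\<in>{1..int n}. expectation (g n i))"
          using g_bounds(1)[OF v(1)] by simp
        also have "\<dots> \<le> ?c * (\<Sum>i\<in>{1..int n}. K * (\<eta>' (v n) * S (v n)))"
          using c0 g_bounds(2)[OF v(1)] by (intro mult_left_mono sum_mono) auto
        also have "\<dots> = ?c * (real n * (K * (\<eta>' (v n) * S (v n))))" by simp
        also have "\<dots> \<le> ?c * (real n * (K * (K3 * (\<eta>' (u n) * (real (k n) / real n)))))"
          using c0 K0 elim by (intro mult_left_mono) auto
        also have "\<dots> = \<bar>t\<bar> * C / \<alpha> * K * K3 * (real (k n) / sqrt (real (k n)) * \<eta>' (u n))"
          using elim by (simp add: field_simps)
        also have "real (k n) / sqrt (real (k n)) = sqrt (real (k n))"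
          by (rule real_div_sqrt) simp
        finally show ?thesis .
      qed
      ultimately show ?case unfolding err_def by simp
    qed
    have "(\<lambda>n. (CLINT \<omega>|M. iexp (t * W n \<omega>)) - (iexp (- x n) / (1 - \<i> * complex_of_real (x n))) ^ k n) \<longlonglongrightarrow> 0"
      by (rule Lim_null_comparison[OF _ err0]) (use close in simp)
    from tendsto_add[OF this main] show ?thesis by simp
  qed

  have target: "density lborel (normal_density 0 \<gamma>) = gaussian_measure 0 \<gamma>"
    using \<gamma> by (simp add: gaussian_measure_def)
  have "weak_conv_m (\<lambda>n. distr M borel (W n)) (density lborel (normal_density 0 \<gamma>))"
  proof (rule levy_continuity)
    show "real_distribution (distr M borel (W n))" for n by (rule real_distribution_distr) simp
    show "real_distribution (density lborel (normal_density 0 \<gamma>))"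
      using prob_space_normal_density[OF \<gamma>(1), of 0] by (simp add: real_distribution_def real_distribution_axioms_def)
    fix t
    have "char (distr M borel (W n)) t = (CLINT \<omega>|M. iexp (t * W n \<omega>))" for n
      unfolding char_def by (subst integral_distr) auto
    moreover have "char (density lborel (normal_density 0 \<gamma>)) t = complex_of_real (exp (- ((t * \<gamma>)\<^sup>2 / 2)))"
      unfolding target using \<gamma> by (simp add: char_gaussian_measure mult.commute exp_of_real)
    ultimately show "(\<lambda>n. char (distr M borel (W n)) t) \<longlonglongrightarrow> char (density lborel (normal_density 0 \<gamma>)) t"
      using char_lim[of t] by simp
  qed
  then show ?thesis unfolding W_def[abs_def] Y_obs .
qed

end
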